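(* Let $X\subset\mathcal H(\mathbb D)$ be a Banach space such that $\mathrm{BMOA}\subset X\subset H^\infty_{\log}$, and let $g\in H^\infty$ with $\widehat g(n)\ge0$ for all $n\in\mathbb N\cup\{0\}$. Then the following statements are equivalent: (i) $T_g:H^\infty_{\log}\to H^\infty$ is bounded (equivalently compact); (ii) $T_g:X\to H^\infty$ is bounded (equivalently compact); (iii) $T_g:\mathrm{BMOA}\to H^\infty$ is bounded (equivalently compact); (iv) $\sum_{n=0}^\infty\widehat g(n+1)\log(n+2)<\infty$; (v) $\int_0^1 M_\infty(r,g')\log\frac{e}{1-r}\,dr<\infty$. Moreover, $$\|T_g\|_{\mathrm{BMOA}\to H^\infty}\asymp\|T_g\|_{X\to H^\infty}\asymp\|T_g\|_{H^\infty_{\log}\to H^\infty}\asymp\int_0^1M_\infty(r,g')\log\frac{e}{1-r}\,dr\asymp\sum_{n=0}^\infty\widehat g(n+1)\log(n+2).$$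
   Context: $\mathbb D=\{z\in\mathbb C:|z|<1\}$ and $\mathcal H(\mathbb D)$ is the space of analytic functions in $\mathbb D$. For $f\in\mathcal H(\mathbb D)$, $\widehat f(n)$ denotes the $n$-th Maclaurin coefficient and $M_\infty(r,f)=\max_{0\le\theta\le2\pi}|f(re^{i\theta})|$. For $g\in\mathcal H(\mathbb D)$, $T_g(f)(z)=\int_0^z f(\zeta)g'(\zeta)\,d\zeta$, $z\in\mathbb D$. $H^\infty$ is the space of bounded analytic functions in $\mathbb D$ with the supremum norm. $H^\infty_{\log}$ is the space of $f\in\mathcal H(\mathbb D)$ with $\|f\|_{H^\infty_{\log}}=\sup_{z\in\mathbb D}|f(z)|\left(\log\frac{e}{1-|z|}\right)^{-1}<\infty$. $\mathrm{BMOA}$ is the space of functions in the Hardy space $H^1$ having bounded mean oscillation on the boundary $\mathbb T$ of $\mathbb D$, equipped with the norm $$\|f\|_{\mathrm{BMOA}}^2=\sup_{a\in\mathbb D}\frac{\int_{S(a)}|f'(z)|^2(1-|z|^2)\,dA(z)}{1-|a|}+|f(0)|^2,$$ where $dA=\frac{dx\,dy}{\pi}$, $S(a)=\{\zeta:|a|<|\zeta|<1,\ |\arg\zeta-\arg a|<(1-|a|)/2\}$ is the Carleson square induced by $a\in\mathbb D\setminus\{0\}$, and $S(0)=\mathbb D$. Here $H^1$ is the space of $f\in\mathcal H(\mathbb D)$ with $\sup_{0<r<1}\frac1{2\pi}\int_0^{2\pi}|f(re^{i\theta})|\,d\theta<\infty$. $\|T_g\|_{Y\to H^\infty}$ is the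 operator norm of $T_g:Y\to H^\infty$. The notation $a\asymp b$ means that $C^{-1}b\le a\le Cb$ for some constant $C>0$ (not depending on $g$).
   Formalization: The Banach space X ⊂ H(D) is assumed to be continuously included in H(D) (locally uniform convergence); without this the equivalence fails, e.g. for g(z)=z and the space H^∞_log renormed through a discontinuous linear bijection. *)

theory Defs
  imports "HOL-Complex_Analysis.Complex_Analysis"
begin

abbreviation unit_disc :: "complex set" where
  "unit_disc \<equiv> ball 0 1"

text \<open>
  Functions on the disc are total functions that vanish off the disc, so that equality of functions
  on the disc is equality in HOL and the spaces below are genuine vector spaces.
\<close>

definition HD :: "(complex \<Rightarrow> complex) set" where
  "HD = {f. f holomorphic_on unit_disc \<and> (\<forall>z. z \<notin> unit_disc \<longrightarrow> f z = 0)}"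

definition maclaurin_coeff :: "(complex \<Rightarrow> complex) \<Rightarrow> nat \<Rightarrow> complex" where
  "maclaurin_coeff f n = fps_nth (fps_expansion f 0) n"

definition M_inf :: "real \<Rightarrow> (complex \<Rightarrow> complex) \<Rightarrow> real" where
  "M_inf r f = (SUP \<theta>\<in>{0..2*pi}. cmod (f (of_real r * cis \<theta>)))"

definition T_op :: "(complex \<Rightarrow> complex) \<Rightarrow> (complex \<Rightarrow> complex) \<Rightarrow> complex \<Rightarrow> complex" where
  "T_op g f = (\<lambda>z. if z \<in> unit_disc
     then contour_integral (linepath 0 z) (\<lambda>\<zeta>. f \<zeta> * deriv g \<zeta>) else 0)"


text \<open>Norms take values in \<open>[0, \<infinity>]\<close>, so that a supremum which is not finite is really infinite.\<close>

definition norm_Hinf :: "(complex \<Rightarrow> complex) \<Rightarrow> ennreal" where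
  "norm_Hinf f = (SUP z\<in>unit_disc. ennreal (cmod (f z)))"

definition Hinf :: "(complex \<Rightarrow> complex) set" where
  "Hinf = {f \<in> HD. norm_Hinf f < \<infinity>}"

definition norm_Hlog :: "(complex \<Rightarrow> complex) \<Rightarrow> ennreal" where
  "norm_Hlog f = (SUP z\<in>unit_disc. ennreal (cmod (f z) * inverse (ln (exp 1 / (1 - cmod z)))))"

definition Hlog :: "(complex \<Rightarrow> complex) set" where
  "Hlog = {f \<in> HD. norm_Hlog f < \<infinity>}"

definition Hardy1 :: "(complex \<Rightarrow> complex) set" where
  "Hardy1 = {f \<in> HD. bdd_above
     ((\<lambda>r. 1 / (2*pi) * integral {0..2*pi} (\<lambda>\<theta>. cmod (f (of_real r * cis \<theta>)))) ` {0<..<1})}"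

text \<open>Radial limits; for functions in \<open>H\<^sup>1\<close> they exist almost everywhere.\<close>

definition boundary_fun :: "(complex \<Rightarrow> complex) \<Rightarrow> real \<Rightarrow> complex" where
  "boundary_fun f \<theta> = Lim (at_left 1) (\<lambda>r. f (of_real r * cis \<theta>))"

text \<open>
  A function on the circle is given as a \<open>2\<pi>\<close>-periodic function of the angle; an arc is an
  interval of length at most \<open>2\<pi>\<close>, possibly containing a multiple of \<open>2\<pi>\<close> in its interior.
\<close>

definition bounded_mean_oscillation :: "(real \<Rightarrow> complex) \<Rightarrow> bool" where
  "bounded_mean_oscillation \<phi> \<longleftrightarrow> (\<exists>C. \<forall>a b. a < b \<and> b - a \<le> 2*pi \<longrightarrow>
     \<phi> absolutely_integrable_on {a..b} \<and>
     1 / (b - a) * integral {a..b}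
        (\<lambda>\<theta>. cmod (\<phi> \<theta> - integral {a..b} \<phi> / of_real (b - a))) \<le> C)"

definition BMOA :: "(complex \<Rightarrow> complex) set" where
  "BMOA = {f \<in> Hardy1. bounded_mean_oscillation (boundary_fun f)}"

text \<open>
  The distance of the arguments is taken on the circle, that is modulo \<open>2\<pi>\<close>; it is
  \<open>\<bar>Arg (\<zeta> / a)\<bar>\<close> because \<open>Arg\<close> takes values in \<open>(-\<pi>, \<pi>]\<close>.
\<close>

definition Carleson_square :: "complex \<Rightarrow> complex set" where
  "Carleson_square a = (if a = 0 then unit_disc else
     {\<zeta>. cmod a < cmod \<zeta> \<and> cmod \<zeta> < 1 \<and> \<bar>Arg (\<zeta> / a)\<bar> < (1 - cmod a) / 2})"

definition sqrt_ennreal :: "ennreal \<Rightarrow> ennreal" where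
  "sqrt_ennreal x = (if x = \<infinity> then \<infinity> else ennreal (sqrt (enn2real x)))"

text \<open>The factor \<open>1 / \<pi>\<close> is the normalisation of the area measure.\<close>

definition norm_BMOA :: "(complex \<Rightarrow> complex) \<Rightarrow> ennreal" where
  "norm_BMOA f = sqrt_ennreal
     ((SUP a\<in>unit_disc.
         (\<integral>\<^sup>+ z \<in> Carleson_square a.
            ennreal ((cmod (deriv f z))\<^sup>2 * (1 - (cmod z)\<^sup>2) / pi) \<partial>lborel)
         / ennreal (1 - cmod a))
      + ennreal ((cmod (f 0))\<^sup>2))"

text \<open>
  The last clause says that the inclusion of \<open>X\<close> into \<open>H(D)\<close>, with locally uniform convergence, is
  continuous; a norm on \<open>X\<close> need not have any relation to the values of the functions otherwise.
\<close>

definition banach_space_in_HD ::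
  "(complex \<Rightarrow> complex) set \<Rightarrow> ((complex \<Rightarrow> complex) \<Rightarrow> real) \<Rightarrow> bool" where
  "banach_space_in_HD X N \<longleftrightarrow>
     X \<subseteq> HD \<and> (\<lambda>_. 0) \<in> X \<and>
     (\<forall>f\<in>X. \<forall>h\<in>X. (\<lambda>z. f z + h z) \<in> X) \<and>
     (\<forall>c. \<forall>f\<in>X. (\<lambda>z. c * f z) \<in> X) \<and>
     (\<forall>f\<in>X. 0 \<le> N f \<and> (N f = 0 \<longleftrightarrow> f = (\<lambda>_. 0))) \<and>
     (\<forall>c. \<forall>f\<in>X. N (\<lambda>z. c * f z) = cmod c * N f) \<and>
     (\<forall>f\<in>X. \<forall>h\<in>X. N (\<lambda>z. f z + h z) \<le> N f + N h) \<and>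
     (\<forall>F::nat \<Rightarrow> complex \<Rightarrow> complex. (\<forall>n. F n \<in> X) \<and>
        (\<forall>e>0. \<exists>n0. \<forall>m\<ge>n0. \<forall>n\<ge>n0. N (\<lambda>z. F m z - F n z) < e) \<longrightarrow>
        (\<exists>f\<in>X. (\<lambda>n. N (\<lambda>z. F n z - f z)) \<longlonglongrightarrow> 0)) \<and>
     (\<forall>K. compact K \<and> K \<subseteq> unit_disc \<longrightarrow> (\<exists>C. \<forall>f\<in>X. \<forall>z\<in>K. cmod (f z) \<le> C * N f))"


definition bounded_to_Hinf :: "(complex \<Rightarrow> complex) set \<Rightarrow> ((complex \<Rightarrow> complex) \<Rightarrow> ennreal) \<Rightarrow>
    ((complex \<Rightarrow> complex) \<Rightarrow> complex \<Rightarrow> complex) \<Rightarrow> bool" where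
  "bounded_to_Hinf Y NY T \<longleftrightarrow> (\<forall>f\<in>Y. T f \<in> Hinf) \<and>
     (\<exists>C::real. \<forall>f\<in>Y. norm_Hinf (T f) \<le> ennreal C * NY f)"

definition compact_to_Hinf :: "(complex \<Rightarrow> complex) set \<Rightarrow> ((complex \<Rightarrow> complex) \<Rightarrow> ennreal) \<Rightarrow>
    ((complex \<Rightarrow> complex) \<Rightarrow> complex \<Rightarrow> complex) \<Rightarrow> bool" where
  "compact_to_Hinf Y NY T \<longleftrightarrow> (\<forall>f\<in>Y. T f \<in> Hinf) \<and>
     (\<forall>F::nat \<Rightarrow> complex \<Rightarrow> complex. (\<forall>n. F n \<in> Y) \<and> (\<exists>M::real. \<forall>n. NY (F n) \<le> ennreal M) \<longrightarrow>
        (\<exists>h\<in>Hinf. \<exists>k. strict_mono k \<and>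
           (\<lambda>n. norm_Hinf (\<lambda>z. T (F (k n)) z - h z)) \<longlonglongrightarrow> 0))"

definition opnorm_to_Hinf :: "(complex \<Rightarrow> complex) set \<Rightarrow> ((complex \<Rightarrow> complex) \<Rightarrow> ennreal) \<Rightarrow>
    ((complex \<Rightarrow> complex) \<Rightarrow> complex \<Rightarrow> complex) \<Rightarrow> ennreal" where
  "opnorm_to_Hinf Y NY T = (SUP f\<in>{f \<in> Y. NY f \<le> 1}. norm_Hinf (T f))"


definition nonneg_symbols :: "(complex \<Rightarrow> complex) set" where
  "nonneg_symbols = {g \<in> Hinf. \<forall>n. maclaurin_coeff g n \<in> \<real>\<^sub>\<ge>\<^sub>0}"

text \<open>For symbols in \<^const>\<open>nonneg_symbols\<close> the coefficients are real, so \<open>Re\<close> only changes the type.\<close>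

definition coeff_log_sum :: "(complex \<Rightarrow> complex) \<Rightarrow> ennreal" where
  "coeff_log_sum g = (\<Sum>n. ennreal (Re (maclaurin_coeff g (n + 1)) * ln (real n + 2)))"

definition M_inf_log_integral :: "(complex \<Rightarrow> complex) \<Rightarrow> ennreal" where
  "M_inf_log_integral g =
     (\<integral>\<^sup>+ r \<in> {0<..<1}. ennreal (M_inf r (deriv g) * ln (exp 1 / (1 - r))) \<partial>lborel)"

text \<open>\<open>a \<asymp> b\<close> with a constant that is uniform over the symbols in \<open>G\<close>.\<close>

definition comparable_on :: "'g set \<Rightarrow> ('g \<Rightarrow> ennreal) \<Rightarrow> ('g \<Rightarrow> ennreal) \<Rightarrow> bool" where
  "comparable_on G a b \<longleftrightarrow> (\<exists>C::real. C > 0 \<and>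
     (\<forall>g\<in>G. ennreal (1 / C) * b g \<le> a g \<and> a g \<le> ennreal C * b g))"

end

theory Submission
  imports Defs "HOL-Real_Asymp.Real_Asymp"
begin

text \<open>
  For nonnegative coefficients \<open>M\<^sub>\<infinity>(r, g') = g'(r)\<close>, so integrating the power series of \<open>g'\<close> against
  \<open>log (e / (1 - r))\<close> turns the integral in (v) into \<open>\<Sum> g\<^sub>n\<^sub>+\<^sub>1 (1 + H\<^sub>n\<^sub>+\<^sub>1)\<close> with harmonic numbers \<open>H\<^sub>n\<close>,
  which is comparable to (iv). The growth of functions in \<open>H\<^sup>\<infinity>\<^sub>l\<^sub>o\<^sub>g\<close> bounds \<open>T\<^sub>g\<close> by this integral, and
  testing \<open>T\<^sub>g\<close> on a multiple of \<open>1 - log (1 - z)\<close>, which lies in BMOA, and letting \<open>z\<close> tend to \<open>1\<close> gives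
  the lower bound.
  The bound carries over to BMOA and \<open>X\<close> because the norm of \<open>H\<^sup>\<infinity>\<^sub>l\<^sub>o\<^sub>g\<close> is dominated by theirs: for
  BMOA by subharmonicity of \<open>\<bar>f'\<bar>\<^sup>2\<close>, for \<open>X\<close> by uniform boundedness of the point evaluations.
\<close>

subsection \<open>Rotation averages over plane domains\<close>

text \<open>\<open>BMOA\<close> is defined by oscillation on the boundary and
  \<open>norm_BMOA\<close> by Carleson squares, and no theorem linking the two is invoked. Hence
  \<open>log_test\<close> is treated twice, once for membership and once for the norm, and the
  estimates for \<open>BMOA\<close> admit the value infinity. One test function serves all three
  spaces because it lies in the smallest of them. Area integrals are not evaluated in polar
  coordinates: an integrand is replaced by its mean over all rotations. This reduces both the
  sub-mean value property on discs and the Poisson kernel on annuli to Cauchy's formula on a circle.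
  Boundedness and compactness are each equivalent to finiteness of the integral in (v): if the image
  of the test function is bounded, the integral is finite, and a finite integral has small tails. A
  space enters these arguments only through a constant for its inclusion in \<open>Hlog\<close> and
  a multiple of \<open>log_test\<close> in its unit ball, so each equivalence is proved once for all
  three.\<close>

lemma lborel_complex_eq:
  "(lborel :: complex measure) = distr (lborel \<Otimes>\<^sub>M lborel) borel (\<lambda>(x, y). Complex x y)"
proof (rule lborel_eqI)
  have [measurable]: "(\<lambda>(x, y). Complex x y) \<in> borel_measurable (lborel \<Otimes>\<^sub>M lborel)"
    unfolding lborel_prod by (auto intro!: borel_measurable_continuous_onI continuous_intros simp: case_prod_beta)
  fix l u :: complex assume "\<And>b. b \<in> Basis \<Longrightarrow> l \<bullet> b \<le> u \<bullet> b"
  from this [of 1] this [of \<i>] have le: "Re l \<le> Re u" "Im l \<le> Im u"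
    by (auto simp: Basis_complex_def)
  have "(\<lambda>(x, y). Complex x y) -` box l u \<inter> space (lborel \<Otimes>\<^sub>M lborel)
      = {Re l<..<Re u} \<times> {Im l<..<Im u}"
    by (auto simp: box_def Basis_complex_def space_pair_measure)
  then show "emeasure (distr (lborel \<Otimes>\<^sub>M lborel) borel (\<lambda>(x, y). Complex x y)) (box l u)
      = ennreal (\<Prod>b\<in>Basis. (u - l) \<bullet> b)"
    using le by (subst emeasure_distr)
      (auto simp: lborel.emeasure_pair_measure_Times Basis_complex_def ennreal_mult)
qed simp

lemma borel_measurable_Complex [measurable (raw)]:
  "f \<in> borel_measurable M \<Longrightarrow> g \<in> borel_measurable M \<Longrightarrow> (\<lambda>x. Complex (f x) (g x)) \<in> borel_measurable M"
  by (simp add: borel_measurable_complex_iff)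

lemma nn_integral_complex:
  assumes [measurable]: "F \<in> borel_measurable (borel :: complex measure)"
  shows "(\<integral>\<^sup>+z. F z \<partial>lborel) = (\<integral>\<^sup>+x. \<integral>\<^sup>+y. F (Complex x y) \<partial>lborel \<partial>lborel)"
proof -
  have "(\<integral>\<^sup>+z. F z \<partial>lborel) = (\<integral>\<^sup>+p. F (case p of (x, y) \<Rightarrow> Complex x y) \<partial>(lborel \<Otimes>\<^sub>M lborel))"
    by (subst lborel_complex_eq, subst nn_integral_distr) (auto simp: case_prod_beta)
  also have "\<dots> = (\<integral>\<^sup>+x. \<integral>\<^sup>+y. F (Complex x y) \<partial>lborel \<partial>lborel)"
    by (subst lborel.nn_integral_fst [symmetric]) (auto simp: case_prod_beta)
  finally show ?thesis .
qed

text \<open>A rotation whose matrix has a nonzero diagonal is a composition of two maps that each move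
  only one of the real coordinates.\<close>

lemma nn_integral_rotate_aux:
  assumes [measurable]: "F \<in> borel_measurable (borel :: complex measure)"
    and c: "cmod c = 1" "Re c \<noteq> 0"
  shows "(\<integral>\<^sup>+z. F (c * z) \<partial>lborel) = (\<integral>\<^sup>+z. F z \<partial>lborel)"
proof -
  define a b where "a = Re c" and "b = Im c"
  have ab: "a\<^sup>2 + b\<^sup>2 = 1" and a: "a \<noteq> 0"
    using c cmod_power2 [of c] by (auto simp: a_def b_def)
  have "(\<integral>\<^sup>+z. F (c * z) \<partial>lborel)
      = (\<integral>\<^sup>+x. \<integral>\<^sup>+y. F (c * Complex x y) \<partial>lborel \<partial>lborel)"
    by (rule nn_integral_complex) measurable
  also have "\<dots> = (\<integral>\<^sup>+x. \<integral>\<^sup>+y. F (Complex (a * x - b * y) (b * x + a * y)) \<partial>lborel \<partial>lborel)"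
    by (intro nn_integral_cong arg_cong [of _ _ F]) (auto simp: complex_eq_iff a_def b_def)
  also have "\<dots> = (\<integral>\<^sup>+y. \<integral>\<^sup>+x. F (Complex (a * x - b * y) (b * x + a * y)) \<partial>lborel \<partial>lborel)"
    by (rule lborel_pair.Fubini') measurable
  \<comment> \<open>At fixed \<open>y\<close> the real part \<open>a * x - b * y\<close> becomes the
    new variable \<open>x\<close>, at the cost of the factor \<open>1 / a\<close> in absolute value.
    Since \<open>a^2 + b^2 = 1\<close>, the imaginary part turns into
    \<open>y / a + (b / a) * x\<close>.\<close>
  also have "\<dots> = (\<integral>\<^sup>+y. ennreal \<bar>inverse a\<bar> * (\<integral>\<^sup>+x. F (Complex x (inverse a * y + b / a * x)) \<partial>lborel) \<partial>lborel)"
  proof (intro nn_integral_cong)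
    fix y :: real
    have "b * (b / a * y + inverse a * x) + a * y = (b\<^sup>2 + a\<^sup>2) / a * y + b / a * x" for x
      using a by (simp add: field_simps power2_eq_square)
    then have eq: "b * (b / a * y + inverse a * x) + a * y = inverse a * y + b / a * x" for x
      using ab by (simp add: add.commute inverse_eq_divide)
    have eq': "a * (b / a * y + inverse a * x) - b * y = x" for x
      using a by (simp add: field_simps)
    show "(\<integral>\<^sup>+x. F (Complex (a * x - b * y) (b * x + a * y)) \<partial>lborel)
        = ennreal \<bar>inverse a\<bar> * (\<integral>\<^sup>+x. F (Complex x (inverse a * y + b / a * x)) \<partial>lborel)"
      using a by (subst nn_integral_real_affine [where c = "inverse a" and t = "b / a * y"]) (simp_all only: eq eq', simp_all)
  qed
  also have "\<dots> = (\<integral>\<^sup>+y. \<integral>\<^sup>+x. ennreal \<bar>inverse a\<bar> * F (Complex x (inverse a * y + b / a * x)) \<partial>lborel \<partial>lborel)"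
    by (intro nn_integral_cong nn_integral_cmult [symmetric]) measurable
  also have "\<dots> = (\<integral>\<^sup>+x. \<integral>\<^sup>+y. ennreal \<bar>inverse a\<bar> * F (Complex x (inverse a * y + b / a * x)) \<partial>lborel \<partial>lborel)"
    by (rule lborel_pair.Fubini') measurable
  \<comment> \<open>At fixed \<open>x\<close> the imaginary part is affine in \<open>y\<close> with
    slope \<open>1 / a\<close>, so the second substitution absorbs the factor left by the
    first.\<close>
  also have "\<dots> = (\<integral>\<^sup>+x. \<integral>\<^sup>+y. F (Complex x y) \<partial>lborel \<partial>lborel)"
  proof (rule nn_integral_cong)
    fix x :: real
    have "(\<integral>\<^sup>+y. ennreal \<bar>inverse a\<bar> * F (Complex x (inverse a * y + b / a * x)) \<partial>lborel)
        = ennreal \<bar>inverse a\<bar> * (\<integral>\<^sup>+y. F (Complex x (b / a * x + inverse a * y)) \<partial>lborel)"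
      by (subst nn_integral_cmult) (auto simp: add.commute)
    also have "\<dots> = (\<integral>\<^sup>+y. F (Complex x y) \<partial>lborel)"
      using a by (subst nn_integral_real_affine [where c = "inverse a" and t = "b / a * x", of "\<lambda>y. F (Complex x y)"]) auto
    finally show "(\<integral>\<^sup>+y. ennreal \<bar>inverse a\<bar> * F (Complex x (inverse a * y + b / a * x)) \<partial>lborel)
       = (\<integral>\<^sup>+y. F (Complex x y) \<partial>lborel)" .
  qed
  also have "\<dots> = (\<integral>\<^sup>+z. F z \<partial>lborel)"
    by (rule nn_integral_complex [symmetric]) measurable
  finally show ?thesis .
qed

text \<open>A rotation with vanishing real part is applied as two rotations by its square root
  \<open>d\<close>. There \<open>Re d\<close> is nonzero, because \<open>Re d = 0\<close> would
  force \<open>Re c = -1\<close>.\<close>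

lemma nn_integral_rotate:
  assumes [measurable]: "F \<in> borel_measurable (borel :: complex measure)"
    and c: "cmod c = 1"
  shows "(\<integral>\<^sup>+z. F (c * z) \<partial>lborel) = (\<integral>\<^sup>+z. F z \<partial>lborel)"
proof (cases "Re c = 0")
  case False
  then show ?thesis using nn_integral_rotate_aux [OF assms] by simp
next
  case True
  define d where "d = csqrt c"
  have d: "d\<^sup>2 = c" "cmod d = 1"
    using c norm_power [of d 2] by (auto simp: d_def)
  have "Re d \<noteq> 0"
  proof
    assume "Re d = 0"
    then have "Re c = - (cmod d)\<^sup>2"
      unfolding d(1) [symmetric] cmod_power2 by (simp add: Re_power2)
    then show False using True d by simp
  qed
  then have "(\<integral>\<^sup>+z. F (d * (d * z)) \<partial>lborel) = (\<integral>\<^sup>+z. F z \<partial>lborel)"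
    using nn_integral_rotate_aux [of "\<lambda>z. F (d * z)" d] nn_integral_rotate_aux [of F d] d
    by simp
  then show ?thesis using d by (simp add: power2_eq_square flip: mult.assoc)
qed

text \<open>By Tonelli the integral over the plane can be taken first, and by rotation invariance it
  does not depend on \<open>t\<close>. This plays the part of polar coordinates.\<close>

lemma nn_integral_rotation_average:
  assumes [measurable]: "F \<in> borel_measurable (borel :: complex measure)"
  shows "(\<integral>\<^sup>+z. F z \<partial>lborel) = (\<integral>\<^sup>+z. (\<integral>\<^sup>+t\<in>{0..1}. F (cis (2 * pi * t) * z) \<partial>lborel) \<partial>lborel)"
proof -
  have [measurable]: "cis \<in> borel_measurable borel"
    by (intro borel_measurable_continuous_onI continuous_intros)
  have "(\<integral>\<^sup>+z. (\<integral>\<^sup>+t\<in>{0..1}. F (cis (2 * pi * t) * z) \<partial>lborel) \<partial>lborel)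
      = (\<integral>\<^sup>+t. (\<integral>\<^sup>+z. F (cis (2 * pi * t) * z) * indicator {0..1} t \<partial>lborel) \<partial>lborel)"
    by (rule lborel_pair.Fubini') measurable
  also have "\<dots> = (\<integral>\<^sup>+t. (\<integral>\<^sup>+z. F z \<partial>lborel) * indicator {0..1::real} t \<partial>lborel)"
    by (intro nn_integral_cong) (simp add: nn_integral_multc nn_integral_rotate)
  also have "\<dots> = (\<integral>\<^sup>+z. F z \<partial>lborel)"
    by (simp add: nn_integral_cmult)
  finally show ?thesis by simp
qed

text \<open>Cauchy's formula at the centre of the unit circle, with the parametrisation of
  \<open>circlepath\<close>. Circles of other radii are reached by applying it to \<open>w\<close>
  mapped to \<open>H (w * z)\<close>.\<close>

lemma mean_value_circle:
  assumes "H holomorphic_on ball 0 R" "1 < R"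
  shows "((\<lambda>t. H (cis (2 * pi * t))) has_integral H 0) {0..1}"
proof -
  have hol: "H holomorphic_on cball 0 1"
    by (rule holomorphic_on_subset [OF assms(1)]) (use assms(2) in auto)
  have "((\<lambda>u. H u / (u - 0)) has_contour_integral 2 * of_real pi * \<i> * H 0) (circlepath 0 1)"
    by (rule Cauchy_integral_circlepath) 
      (use hol in \<open>auto intro: holomorphic_on_imp_continuous_on holomorphic_on_subset\<close>)
  then have "((\<lambda>t. H (cis (2 * pi * t)) / cis (2 * pi * t) * (2 * pi * \<i> * cis (2 * pi * t))) has_integral 2 * of_real pi * \<i> * H 0) {0..1}"
    unfolding has_contour_integral
    by (rule has_integral_eq [rotated])
      (simp add: vector_derivative_circlepath, simp add: circlepath cis_conv_exp mult_ac)
  then have "((\<lambda>t. inverse (2 * pi * \<i>) * (H (cis (2 * pi * t)) / cis (2 * pi * t) * (2 * pi * \<i> * cis (2 * pi * t))))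
      has_integral (inverse (2 * pi * \<i>) * (2 * of_real pi * \<i> * H 0))) {0..1}"
    by (rule has_integral_mult_right)
  moreover have "inverse (2 * pi * \<i>) * (h / cis s * (2 * pi * \<i> * cis s)) = h"
    "inverse (2 * pi * \<i>) * (2 * of_real pi * \<i> * h) = h" for h s
    by (simp_all add: field_simps)
  ultimately show ?thesis by (simp only:)
qed

lemma circle_average_ge:
  assumes "H holomorphic_on ball 0 R" "1 < R"
  shows "ennreal (cmod (H 0)) \<le> (\<integral>\<^sup>+t\<in>{0..1}. ennreal (cmod (H (cis (2 * pi * t)))) \<partial>lborel)"
proof -
  have cont: "continuous_on {0..1} (\<lambda>t::real. H (cis (2 * pi * t)))"
    by (rule continuous_on_compose2 [OF holomorphic_on_imp_continuous_on [OF assms(1)]])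
       (use assms(2) in \<open>auto intro!: continuous_intros\<close>)
  have I: "((\<lambda>t. cmod (H (cis (2 * pi * t)))) has_integral integral {0..1} (\<lambda>t. cmod (H (cis (2 * pi * t))))) {0..1}"
    by (intro integrable_integral integrable_continuous_interval continuous_intros cont)
  have "cmod (H 0) \<le> integral {0..1} (\<lambda>t. cmod (H (cis (2 * pi * t))))"
    unfolding integral_unique [OF mean_value_circle [OF assms], symmetric]
    using mean_value_circle [OF assms] I by (intro integral_norm_bound_integral) (auto simp: integrable_on_def)
  moreover have "(\<integral>\<^sup>+t\<in>{0..1}. ennreal (cmod (H (cis (2 * pi * t)))) \<partial>lborel) = ennreal (integral {0..1} (\<lambda>t. cmod (H (cis (2 * pi * t)))))"
    by (rule nn_integral_has_integral_lebesgue' [OF _ I]) auto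
  ultimately show ?thesis by (simp add: ennreal_leI)
qed

lemma circle_average_Re:
  assumes "H holomorphic_on ball 0 R" "1 < R" "\<And>z. z \<in> ball 0 R \<Longrightarrow> 0 \<le> Re (H z)"
  shows "(\<integral>\<^sup>+t\<in>{0..1}. ennreal (Re (H (cis (2 * pi * t)))) \<partial>lborel) = ennreal (Re (H 0))"
proof (rule nn_integral_has_integral_lebesgue')
  show "((\<lambda>t. Re (H (cis (2 * pi * t)))) has_integral Re (H 0)) {0..1}"
    by (rule has_integral_Re) (rule mean_value_circle [OF assms(1,2)])
qed (use assms in auto)

subsection \<open>Growth of functions in BMOA\<close>

lemma nn_integral_translate:
  fixes F :: "'a::euclidean_space \<Rightarrow> ennreal"
  assumes [measurable]: "F \<in> borel_measurable borel"
  shows "(\<integral>\<^sup>+z. F (a + z) \<partial>lborel) = (\<integral>\<^sup>+z. F z \<partial>lborel)"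
proof -
  have "(\<integral>\<^sup>+z. F z \<partial>lborel) = (\<integral>\<^sup>+z. F z \<partial>distr lborel borel ((+) a))"
    by (simp add: lborel_distr_plus)
  also have "\<dots> = (\<integral>\<^sup>+z. F (a + z) \<partial>lborel)"
    by (subst nn_integral_distr) auto
  finally show ?thesis by simp
qed

text \<open>For each \<open>z\<close> in the disc about 0, the value at \<open>a\<close> is bounded
  by the mean over the circle through \<open>a + z\<close> about \<open>a\<close>. Integrating over
  \<open>z\<close>, the rotation average restores the area integral.\<close>

lemma area_average_ge:
  assumes G: "G holomorphic_on ball a \<rho>" and "0 < \<rho>"
  shows "ennreal (cmod (G a) * (pi * \<rho>\<^sup>2)) \<le> (\<integral>\<^sup>+z\<in>ball a \<rho>. ennreal (cmod (G z)) \<partial>lborel)"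
proof -
  \<comment> \<open>Nothing is known about \<open>G\<close> off the ball, not even measurability, so
    its modulus is extended by zero before integrals over the plane are rotated.\<close>
  define h where "h z = indicator (ball a \<rho>) z *\<^sub>R cmod (G z)" for z
  have hm [measurable]: "h \<in> borel_measurable borel"
    unfolding h_def
    by (intro borel_measurable_continuous_on_indicator continuous_intros holomorphic_on_imp_continuous_on G) auto
  have "ennreal (cmod (G a) * (pi * \<rho>\<^sup>2)) = (\<integral>\<^sup>+z. ennreal (cmod (G a)) * indicator (ball (0::complex) \<rho>) z \<partial>lborel)"
    using \<open>0 < \<rho>\<close> by (simp add: nn_integral_cmult_indicator emeasure_ball ennreal_mult unit_ball_vol_2)
  also have "\<dots> \<le> (\<integral>\<^sup>+z. (\<integral>\<^sup>+t\<in>{0..1}. ennreal (h (a + cis (2 * pi * t) * z)) \<partial>lborel) \<partial>lborel)"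
  proof (rule nn_integral_mono)
    fix z :: complex
    show "ennreal (cmod (G a)) * indicator (ball 0 \<rho>) z \<le> (\<integral>\<^sup>+t\<in>{0..1}. ennreal (h (a + cis (2 * pi * t) * z)) \<partial>lborel)"
    proof (cases "z \<in> ball 0 \<rho>")
      case True
      \<comment> \<open>\<open>R\<close> is such that \<open>a + w * z\<close> stays in the ball for
        all \<open>w\<close> of modulus below \<open>R\<close>. It exceeds 1 because
        \<open>z\<close> lies in the open ball; for \<open>z = 0\<close> any number above 1 would
        do.\<close>
      define R where "R = (if z = 0 then 2 else \<rho> / cmod z)"
      have R: "1 < R" "R * cmod z \<le> \<rho>"
        using True \<open>0 < \<rho>\<close> by (auto simp: R_def field_simps)
      have in_ball: "a + w * z \<in> ball a \<rho>" if "w \<in> ball 0 R" for w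
      proof (cases "z = 0")
        case False
        then have "cmod (w * z) < R * cmod z"
          using that by (simp add: norm_mult)
        then show ?thesis using R by (simp add: dist_norm)
      qed (use \<open>0 < \<rho>\<close> in auto)
      have "(\<lambda>w. G (a + w * z)) holomorphic_on ball 0 R"
        by (rule holomorphic_on_compose_gen [OF _ G, of "\<lambda>w. a + w * z", unfolded o_def])
          (use in_ball in \<open>auto intro!: holomorphic_intros\<close>)
      from circle_average_ge [OF this R(1)]
      have "ennreal (cmod (G a)) \<le> (\<integral>\<^sup>+t\<in>{0..1}. ennreal (cmod (G (a + cis (2 * pi * t) * z))) \<partial>lborel)"
        by simp
      also have "\<dots> = (\<integral>\<^sup>+t\<in>{0..1}. ennreal (h (a + cis (2 * pi * t) * z)) \<partial>lborel)"
      proof (rule nn_integral_cong)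
        fix t :: real
        have "a + cis (2 * pi * t) * z \<in> ball a \<rho>"
          by (rule in_ball) (use R in auto)
        then show "ennreal (cmod (G (a + cis (2 * pi * t) * z))) * indicator {0..1} t
            = ennreal (h (a + cis (2 * pi * t) * z)) * indicator {0..1} t"
          by (simp add: h_def)
      qed
      finally show ?thesis using True by simp
    qed simp
  qed
  also have "\<dots> = (\<integral>\<^sup>+z. ennreal (h (a + z)) \<partial>lborel)"
    by (rule nn_integral_rotation_average [symmetric]) measurable
  also have "\<dots> = (\<integral>\<^sup>+z. ennreal (h z) \<partial>lborel)"
    by (rule nn_integral_translate [of "\<lambda>z. ennreal (h z)"]) measurable
  also have "\<dots> = (\<integral>\<^sup>+z\<in>ball a \<rho>. ennreal (cmod (G z)) \<partial>lborel)"
    by (intro nn_integral_cong) (auto simp: h_def indicator_def)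
  finally show ?thesis .
qed

section \<open>Discs inside Carleson squares\<close>

lemma abs_Arg_le:
  assumes "cmod (w - 1) < e" "e \<le> 1/4"
  shows "\<bar>Arg w\<bar> < 2 * e"
proof -
  have re: "Re w > 3/4" and im: "\<bar>Im w\<bar> < e"
    using abs_Re_le_cmod [of "w - 1"] abs_Im_le_cmod [of "w - 1"] assms by auto
  have "\<bar>Arg w\<bar> = \<bar>arctan (Im w / Re w)\<bar>"
    using re by (simp add: arg_conv_arctan)
  also have "\<dots> \<le> \<bar>Im w / Re w\<bar>"
    by (metis abs_arctan arctan_le_self abs_ge_zero)
  also have "\<dots> < 2 * e"
  proof -
    have "\<bar>Im w\<bar> < e * 1" using im by simp
    also have "\<dots> \<le> e * (2 * Re w)" using re im by (intro mult_left_mono) auto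
    finally show ?thesis using re by (simp add: field_simps)
  qed
  finally show ?thesis .
qed

text \<open>A Carleson square contains only points of larger modulus than its base point, so
  \<open>b\<close> has to lie closer to the origin than \<open>a\<close>, though not by more than a
  constant factor in the distance to the circle. For small \<open>a\<close> the square of 0, which
  is the whole disc, is used.\<close>

lemma ball_subset_Carleson_square:
  assumes "cmod a < 1"
  obtains b where "cmod b < 1" "1 - cmod b \<le> 2 * (1 - cmod a)"
    "ball a ((1 - cmod a) / 4) \<subseteq> Carleson_square b"
proof (cases "cmod a \<le> 1/2")
  case True
  have "cmod z < 1" if "z \<in> ball a ((1 - cmod a) / 4)" for z
    using that norm_triangle_ineq2 [of z a] assms by (auto simp: dist_norm norm_minus_commute)
  then show ?thesis
    using True by (intro that [of 0]) (auto simp: Carleson_square_def)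
next
  case False
  define d where "d = 1 - cmod a"
  have d: "0 < d" "d < 1/2" "cmod a = 1 - d" "a \<noteq> 0" using assms False by (auto simp: d_def)
  \<comment> \<open>On the ray of \<open>a\<close>, at twice its distance \<open>d\<close> from the
    circle; the angular half-width of the square is then exactly \<open>d\<close>. Since
    \<open>cmod a\<close> is at least 1/2, the quotient \<open>z / a\<close> is within
    \<open>d / 2\<close> of 1.\<close>
  define b where "b = of_real ((1 - 2 * d) / cmod a) * a"
  have b: "cmod b = 1 - 2 * d"
    unfolding b_def norm_mult norm_of_real using d(1,2,4) by simp
  then have "b \<noteq> 0" using d by auto
  have "z \<in> Carleson_square b" if "z \<in> ball a (d / 4)" for z
  proof -
    have z: "cmod (z - a) < d / 4" using that by (simp add: dist_norm norm_minus_commute)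
    have "cmod z < 1" "cmod b < cmod z"
      using z norm_triangle_ineq2 [of z a] norm_triangle_ineq2 [of a z] b d
      by (auto simp: norm_minus_commute)
    moreover have "\<bar>Arg (z / b)\<bar> < d"
    proof -
      have "z / a - 1 = (z - a) / a" using d(4) by (simp add: field_simps)
      then have "cmod (z / a - 1) = cmod (z - a) / cmod a"
        by (simp only: norm_divide)
      also have "\<dots> < d / 2"
      proof -
        have "cmod (z - a) < d / 2 * (1 / 2)" using z by simp
        also have "\<dots> \<le> d / 2 * cmod a" using d by (intro mult_left_mono) auto
        finally show ?thesis by (subst pos_divide_less_eq) (use d(4) in simp_all)
      qed
      finally have "\<bar>Arg (z / a)\<bar> < d" using abs_Arg_le [of "z / a" "d / 2"] d by simp
      moreover have "z / b = of_real (cmod a / (1 - 2 * d)) * (z / a)"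
        using d by (simp add: b_def)
      moreover have "Arg (of_real (cmod a / (1 - 2 * d)) * (z / a)) = Arg (z / a)"
        by (rule Arg_times_of_real) (use d in auto)
      ultimately show ?thesis by simp
    qed
    ultimately show ?thesis using b d \<open>b \<noteq> 0\<close> by (simp add: Carleson_square_def)
  qed
  then show ?thesis
    using b d(1) by (intro that [of b]) (simp_all add: d_def subset_iff)
qed

lemma Carleson_integral_le_norm_BMOA:
  assumes "norm_BMOA f < \<infinity>" "cmod a < 1"
  shows "(\<integral>\<^sup>+z\<in>Carleson_square a. ennreal ((cmod (deriv f z))\<^sup>2 * (1 - (cmod z)\<^sup>2) / pi) \<partial>lborel)
      \<le> ennreal ((enn2real (norm_BMOA f))\<^sup>2 * (1 - cmod a))" (is "?I a \<le> _")
    and "cmod (f 0) \<le> enn2real (norm_BMOA f)"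
proof -
  define Q where "Q = (SUP a\<in>unit_disc. ?I a / ennreal (1 - cmod a)) + ennreal ((cmod (f 0))\<^sup>2)"
  have nb: "norm_BMOA f = sqrt_ennreal Q" by (simp add: norm_BMOA_def Q_def)
  have Q: "Q < \<infinity>" using assms(1) unfolding nb sqrt_ennreal_def by (auto split: if_splits simp: less_top)
  then have B: "(enn2real (norm_BMOA f))\<^sup>2 = enn2real Q"
    unfolding nb sqrt_ennreal_def by auto
  have "?I a / ennreal (1 - cmod a) \<le> (SUP a\<in>unit_disc. ?I a / ennreal (1 - cmod a))"
    by (rule SUP_upper) (use assms in auto)
  also have "\<dots> \<le> Q" unfolding Q_def by simp
  finally have "?I a / ennreal (1 - cmod a) * ennreal (1 - cmod a) \<le> Q * ennreal (1 - cmod a)"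
    by (rule mult_right_mono) simp
  then have "?I a \<le> Q * ennreal (1 - cmod a)"
    using assms(2) by (simp add: ennreal_divide_times)
  then show "?I a \<le> ennreal ((enn2real (norm_BMOA f))\<^sup>2 * (1 - cmod a))"
    using Q assms(2) unfolding B by (simp add: ennreal_mult ennreal_enn2real)
  have "ennreal ((cmod (f 0))\<^sup>2) \<le> Q" unfolding Q_def by simp
  then have "(cmod (f 0))\<^sup>2 \<le> enn2real Q"
    using Q by (metis enn2real_mono enn2real_ennreal zero_le_power2 infinity_ennreal_def)
  then show "cmod (f 0) \<le> enn2real (norm_BMOA f)"
    unfolding B [symmetric] by (rule power2_le_imp_le) simp
qed

text \<open>The square of \<open>deriv f\<close> satisfies the sub-mean value inequality on the disc
  of radius \<open>d / 4\<close> about \<open>a\<close>, where \<open>d = 1 - cmod a\<close>. There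
  \<open>1 - |z|^2\<close> is at least \<open>3/4 * d\<close>, and the disc lies in a Carleson
  square of size at most \<open>2 * d\<close>.\<close>

lemma norm_BMOA_deriv_bound:
  assumes f: "f holomorphic_on unit_disc" and fin: "norm_BMOA f < \<infinity>" and a: "cmod a < 1"
  shows "cmod (deriv f a) \<le> 7 * enn2real (norm_BMOA f) / (1 - cmod a)"
proof -
  define d B where "d = 1 - cmod a" and "B = enn2real (norm_BMOA f)"
  obtain b where b: "cmod b < 1" "1 - cmod b \<le> 2 * d" "ball a (d / 4) \<subseteq> Carleson_square b"
    using ball_subset_Carleson_square [OF a] unfolding d_def by blast
  have d: "0 < d" and B: "0 \<le> B" using a by (auto simp: d_def B_def)
  have lt: "cmod z \<le> 1 - 3/4 * d" if "z \<in> ball a (d / 4)" for z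
  proof -
    have "cmod (z - a) < d / 4" using that by (simp add: dist_norm norm_minus_commute)
    then show ?thesis using norm_triangle_ineq2 [of z a] unfolding d_def by argo
  qed
  have "(deriv f) holomorphic_on unit_disc"
    using f by (intro holomorphic_deriv) auto
  then have hol: "(deriv f) holomorphic_on ball a (d / 4)"
    using lt d by (force elim!: holomorphic_on_subset)
  then have "(\<lambda>z. (deriv f z)\<^sup>2) holomorphic_on ball a (d / 4)"
    by (rule holomorphic_on_power)
  from area_average_ge [OF this] have
    "ennreal ((cmod (deriv f a))\<^sup>2 * (pi * (d / 4)\<^sup>2)) \<le> (\<integral>\<^sup>+z\<in>ball a (d / 4). ennreal ((cmod (deriv f z))\<^sup>2) \<partial>lborel)"
    using d by (simp add: norm_power)
  also have "\<dots> \<le> (\<integral>\<^sup>+z. ennreal (4 * pi / (3 * d)) * (ennreal ((cmod (deriv f z))\<^sup>2 * (1 - (cmod z)\<^sup>2) / pi) * indicator (ball a (d / 4)) z) \<partial>lborel)"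
  proof (rule nn_integral_mono)
    fix z
    have "(cmod (deriv f z))\<^sup>2 \<le> 4 * pi / (3 * d) * ((cmod (deriv f z))\<^sup>2 * (1 - (cmod z)\<^sup>2) / pi)"
      if z: "z \<in> ball a (d / 4)"
    proof -
      have "(cmod z)\<^sup>2 \<le> cmod z * 1"
        unfolding power2_eq_square using lt [OF z] d by (intro mult_left_mono) auto
      then have "3/4 * d \<le> 1 - (cmod z)\<^sup>2" using lt [OF z] by simp
      then have "(cmod (deriv f z))\<^sup>2 * (3/4 * d) \<le> (cmod (deriv f z))\<^sup>2 * (1 - (cmod z)\<^sup>2)"
        by (intro mult_left_mono) auto
      then have "(cmod (deriv f z))\<^sup>2 \<le> ((cmod (deriv f z))\<^sup>2 * (1 - (cmod z)\<^sup>2)) / (3/4 * d)"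
        using d by (simp add: pos_le_divide_eq)
      also have "\<dots> = 4 * pi / (3 * d) * ((cmod (deriv f z))\<^sup>2 * (1 - (cmod z)\<^sup>2) / pi)"
        by simp
      finally show ?thesis .
    qed
    then show "ennreal ((cmod (deriv f z))\<^sup>2) * indicator (ball a (d / 4)) z
      \<le> ennreal (4 * pi / (3 * d)) * (ennreal ((cmod (deriv f z))\<^sup>2 * (1 - (cmod z)\<^sup>2) / pi) * indicator (ball a (d / 4)) z)"
      using d by (auto simp: indicator_def ennreal_mult' [symmetric] intro!: ennreal_leI)
  qed
  also have "\<dots> = ennreal (4 * pi / (3 * d)) * (\<integral>\<^sup>+z\<in>ball a (d / 4). ennreal ((cmod (deriv f z))\<^sup>2 * (1 - (cmod z)\<^sup>2) / pi) \<partial>lborel)"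
  proof (rule nn_integral_cmult)
    have [measurable]: "(\<lambda>z. indicator (ball a (d / 4)) z *\<^sub>R ((cmod (deriv f z))\<^sup>2 * (1 - (cmod z)\<^sup>2) / pi)) \<in> borel_measurable borel"
      by (intro borel_measurable_continuous_on_indicator continuous_intros holomorphic_on_imp_continuous_on hol) auto
    have "(\<lambda>z. ennreal (indicator (ball a (d / 4)) z *\<^sub>R ((cmod (deriv f z))\<^sup>2 * (1 - (cmod z)\<^sup>2) / pi))) \<in> borel_measurable lborel"
      by measurable
    also have "(\<lambda>z. ennreal (indicator (ball a (d / 4)) z *\<^sub>R ((cmod (deriv f z))\<^sup>2 * (1 - (cmod z)\<^sup>2) / pi)))
        = (\<lambda>z. ennreal ((cmod (deriv f z))\<^sup>2 * (1 - (cmod z)\<^sup>2) / pi) * indicator (ball a (d / 4)) z)"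
      by (auto simp: indicator_def)
    finally show "\<dots> \<in> borel_measurable lborel" .
  qed
  also have "\<dots> \<le> ennreal (4 * pi / (3 * d)) * (\<integral>\<^sup>+z\<in>Carleson_square b. ennreal ((cmod (deriv f z))\<^sup>2 * (1 - (cmod z)\<^sup>2) / pi) \<partial>lborel)"
    using b(3) by (intro nn_integral_mono mult_left_mono) (auto simp: indicator_def)
  also have "\<dots> \<le> ennreal (4 * pi / (3 * d)) * ennreal (B\<^sup>2 * (1 - cmod b))"
    unfolding B_def by (intro mult_left_mono Carleson_integral_le_norm_BMOA fin b) auto
  also have "\<dots> = ennreal (4 * pi / (3 * d) * (B\<^sup>2 * (1 - cmod b)))"
    by (rule ennreal_mult' [symmetric]) (use d in auto)
  finally have "(cmod (deriv f a))\<^sup>2 * (pi * (d / 4)\<^sup>2) \<le> 4 * pi / (3 * d) * (B\<^sup>2 * (1 - cmod b))"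
    using d b by (subst (asm) ennreal_le_iff) auto
  also have "\<dots> \<le> 4 * pi / (3 * d) * (B\<^sup>2 * (2 * d))"
    using d b by (intro mult_left_mono) auto
  also have "\<dots> = 8 / 3 * pi * B\<^sup>2"
    using d by (simp add: field_simps)
  \<comment> \<open>The radius \<open>d / 4\<close> contributes 16, and 16 times 8/3 is 128/3, which
    is below 49: hence the constant 7.\<close>
  finally have "pi * (cmod (deriv f a) * d)\<^sup>2 \<le> pi * (128 / 3 * B\<^sup>2)"
    by (simp add: field_simps)
  then have "(cmod (deriv f a) * d)\<^sup>2 \<le> 128 / 3 * B\<^sup>2" by simp
  also have "\<dots> \<le> (7 * B)\<^sup>2" by (simp add: power2_eq_square)
  finally have "cmod (deriv f a) * d \<le> 7 * B"
    by (rule power2_le_imp_le) (use B in simp)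
  then show ?thesis using d by (simp add: field_simps d_def B_def)
qed

text \<open>The bound \<open>7 * B / (1 - |z|)\<close> for the derivative is integrated along the
  radius. The value at 0 is at most \<open>B\<close> and is absorbed by the summand 1 next to the
  logarithm.\<close>

lemma norm_BMOA_growth:
  assumes f: "f holomorphic_on unit_disc" and fin: "norm_BMOA f < \<infinity>" and z: "cmod z < 1"
  shows "cmod (f z) \<le> 7 * enn2real (norm_BMOA f) * (1 - ln (1 - cmod z))"
proof -
  define B where "B = enn2real (norm_BMOA f)"
  have B: "0 \<le> B" by (simp add: B_def)
  have tz: "t * cmod z < 1" if "t \<in> {0..1}" for t
    using that z mult_right_mono [of t 1 "cmod z"] by auto
  have 1: "((\<lambda>t. deriv f (of_real t * z) * z) has_integral (f z - f 0)) {0..1}"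
  proof -
    have "((\<lambda>t. deriv f (of_real t * z) * z) has_integral (f (of_real 1 * z) - f (of_real 0 * z))) {0..1}"
    proof (rule fundamental_theorem_of_calculus)
      fix t :: real assume t: "t \<in> {0..1}"
      have "of_real t * z \<in> unit_disc" using tz [OF t] t by (simp add: norm_mult)
      then have "(f has_field_derivative deriv f (of_real t * z)) (at (of_real t * z))"
        using f by (simp add: holomorphic_derivI)
      moreover have "((\<lambda>t. of_real t * z) has_vector_derivative z) (at t within {0..1})"
        by (auto intro!: derivative_eq_intros simp: has_vector_derivative_def scaleR_conv_of_real)
      ultimately show "((\<lambda>t. f (of_real t * z)) has_vector_derivative deriv f (of_real t * z) * z) (at t within {0..1})"
        using field_vector_diff_chain_within [of "\<lambda>t. of_real t * z" z t "{0..1}" f "deriv f (of_real t * z)"]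
        by (simp add: o_def has_field_derivative_at_within mult.commute)
    qed simp
    then show ?thesis by simp
  qed
  have 2: "((\<lambda>t. 7 * B * (cmod z / (1 - t * cmod z))) has_integral 7 * B * (- ln (1 - cmod z))) {0..1}"
  proof -
    have "((\<lambda>t. cmod z / (1 - t * cmod z)) has_integral (- ln (1 - 1 * cmod z)) - (- ln (1 - 0 * cmod z))) {0..1}"
      by (rule fundamental_theorem_of_calculus)
        (use tz in \<open>auto intro!: derivative_eq_intros simp: has_real_derivative_iff_has_vector_derivative [symmetric]\<close>)
    from has_integral_mult_right [OF this, of "7 * B"] show ?thesis by simp
  qed
  have "cmod (f z - f 0) \<le> 7 * B * (- ln (1 - cmod z))"
    unfolding integral_unique [OF 1, symmetric] integral_unique [OF 2, symmetric]
  proof (rule integral_norm_bound_integral)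
    fix t :: real assume t: "t \<in> {0..1}"
    have "cmod (deriv f (of_real t * z)) * cmod z \<le> 7 * B / (1 - cmod (of_real t * z)) * cmod z"
      unfolding B_def using tz [OF t] t f fin
      by (intro mult_right_mono norm_BMOA_deriv_bound) (auto simp: norm_mult)
    then show "norm (deriv f (of_real t * z) * z) \<le> 7 * B * (cmod z / (1 - t * cmod z))"
      using t by (simp add: norm_mult)
  qed (use 1 2 in \<open>auto simp: integrable_on_def\<close>)
  moreover have "cmod (f 0) \<le> B" 
    using Carleson_integral_le_norm_BMOA(2) [OF fin, of 0] by (simp add: B_def)
  moreover have "cmod (f z) \<le> cmod (f z - f 0) + cmod (f 0)"
    by (metis diff_add_cancel norm_triangle_ineq)
  ultimately show ?thesis
    unfolding B_def [symmetric] using B by (simp add: algebra_simps)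
qed

lemma norm_Hlog_le:
  assumes "\<And>z. cmod z < 1 \<Longrightarrow> ennreal (cmod (f z)) \<le> C * ennreal (1 - ln (1 - cmod z))"
  shows "norm_Hlog f \<le> C"
  unfolding norm_Hlog_def
proof (rule SUP_least)
  fix z assume "z \<in> unit_disc"
  then have z: "cmod z < 1" by simp
  have L: "ln (exp 1 / (1 - cmod z)) = 1 - ln (1 - cmod z)" "1 \<le> 1 - ln (1 - cmod z)"
    using z by (simp_all add: ln_div)
  have "ennreal (cmod (f z) * inverse (1 - ln (1 - cmod z))) = ennreal (cmod (f z)) * ennreal (inverse (1 - ln (1 - cmod z)))"
    using L by (simp add: ennreal_mult)
  also have "\<dots> \<le> C * ennreal (1 - ln (1 - cmod z)) * ennreal (inverse (1 - ln (1 - cmod z)))"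
    by (intro mult_right_mono assms z) auto
  also have "\<dots> = C"
    using L by (simp add: mult.assoc ennreal_mult [symmetric])
  finally show "ennreal (cmod (f z) * inverse (ln (exp 1 / (1 - cmod z)))) \<le> C"
    unfolding L .
qed

lemma norm_Hlog_le_norm_BMOA:
  assumes "f \<in> HD"
  shows "norm_Hlog f \<le> ennreal 7 * norm_BMOA f"
proof (cases "norm_BMOA f < \<infinity>")
  case True
  then have eq: "norm_BMOA f = ennreal (enn2real (norm_BMOA f))" by simp
  show ?thesis
  proof (rule norm_Hlog_le)
    fix z :: complex assume z: "cmod z < 1"
    have "cmod (f z) \<le> 7 * enn2real (norm_BMOA f) * (1 - ln (1 - cmod z))"
      using norm_BMOA_growth [OF _ True z] assms by (simp add: HD_def)
    moreover have L: "0 \<le> 1 - ln (1 - cmod z)"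
      using ln_le_minus_one [of "1 - cmod z"] norm_ge_zero [of z] z by linarith
    ultimately have "ennreal (cmod (f z)) \<le> ennreal (7 * enn2real (norm_BMOA f) * (1 - ln (1 - cmod z)))"
      by (simp add: ennreal_leI)
    also have "\<dots> = ennreal 7 * norm_BMOA f * ennreal (1 - ln (1 - cmod z))"
      using L by (subst (2) eq) (simp add: ennreal_mult)
    finally show "ennreal (cmod (f z)) \<le> ennreal 7 * norm_BMOA f * ennreal (1 - ln (1 - cmod z))" .
  qed
next
  case False
  then have "norm_BMOA f = \<infinity>" by (metis infinity_ennreal_def top.not_eq_extremum)
  then show ?thesis by (simp add: ennreal_mult_top)
qed

subsection \<open>Carleson norm of the logarithm\<close>

text \<open>The summand 1 makes the value at a radius \<open>r\<close> exactly half of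
  \<open>ln (exp 1 / (1 - r))\<close>, the weight in (v). The factor 1/2 brings
  \<open>norm_BMOA\<close> below 1.\<close>

definition log_test :: "complex \<Rightarrow> complex" where
  "log_test z = (if z \<in> unit_disc then (1 - Ln (1 - z)) / 2 else 0)"

lemma Re_one_minus_pos: "cmod z < 1 \<Longrightarrow> 0 < Re (1 - z)"
  using complex_Re_le_cmod [of z] by simp

lemma log_test_deriv:
  assumes "cmod z < 1"
  shows "(log_test has_field_derivative 1 / (2 * (1 - z))) (at z)"
proof (rule has_field_derivative_transform_within_open [where S = unit_disc])
  have "1 - z \<notin> \<real>\<^sub>\<le>\<^sub>0" "1 - z \<noteq> 0"
    using Re_one_minus_pos [OF assms] by (auto simp: complex_nonpos_Reals_iff)
  then show "((\<lambda>z. (1 - Ln (1 - z)) / 2) has_field_derivative 1 / (2 * (1 - z))) (at z)"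
    by (auto intro!: derivative_eq_intros simp: field_simps)
qed (use assms in \<open>auto simp: log_test_def\<close>)

lemma log_test_in_HD: "log_test \<in> HD"
  unfolding HD_def holomorphic_on_open [OF open_ball]
  by (auto intro!: exI log_test_deriv simp: log_test_def)

lemma log_test_of_real:
  assumes "0 \<le> r" "r < 1"
  shows "log_test (of_real r) = of_real ((1 - ln (1 - r)) / 2)"
  using assms Ln_of_real [of "1 - r"] by (simp add: log_test_def)

text \<open>For \<^const>\<open>log_test\<close> the integrand in \<^const>\<open>norm_BMOA\<close> is a multiple of the Poisson kernel.\<close>

lemma poisson_kernel_circle_average:
  assumes "cmod z < 1"
  shows "(\<integral>\<^sup>+t\<in>{0..1}. ennreal ((1 - (cmod (cis (2 * pi * t) * z))\<^sup>2) / (cmod (1 - cis (2 * pi * t) * z))\<^sup>2) \<partial>lborel) = 1"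
proof -
  define R where "R = (if z = 0 then 2 else 1 / cmod z)"
  have R: "1 < R" "R * cmod z \<le> 1"
    using assms by (auto simp: R_def)
  have wz: "cmod (w * z) < 1" if "w \<in> ball 0 R" for w
  proof (cases "z = 0")
    case False
    then have "cmod (w * z) < R * cmod z"
      using that by (simp add: norm_mult)
    then show ?thesis using R by simp
  qed auto
  \<comment> \<open>The kernel is the real part of \<open>(1 + u) / (1 - u)\<close>, which is
    holomorphic in the disc, so its mean over a circle is the value 1 at the centre.\<close>
  have kernel: "Re ((1 + u) / (1 - u)) = (1 - (cmod u)\<^sup>2) / (cmod (1 - u))\<^sup>2" for u
    unfolding Re_complex_div_eq_0 by (simp add: Re_divide cmod_power2) (simp add: power2_eq_square algebra_simps)
  have "(\<integral>\<^sup>+t\<in>{0..1}. ennreal (Re ((1 + cis (2 * pi * t) * z) / (1 - cis (2 * pi * t) * z))) \<partial>lborel)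
      = ennreal (Re ((1 + 0 * z) / (1 - 0 * z)))"
  proof (rule circle_average_Re [OF _ R(1)])
    show "(\<lambda>w. (1 + w * z) / (1 - w * z)) holomorphic_on ball 0 R"
      by (intro holomorphic_intros) (use wz in fastforce)
    show "0 \<le> Re ((1 + w * z) / (1 - w * z))" if "w \<in> ball 0 R" for w
      unfolding kernel using wz [OF that] by (simp add: power_le_one)
  qed
  then show ?thesis by (simp add: kernel)
qed

text \<open>The annulus is invariant under rotations and the circular means of the kernel are 1. The
  integral is therefore the area \<open>pi * (1 - s^2)\<close> of the annulus, and
  \<open>1 + s\<close> is at most 2.\<close>

lemma nn_integral_poisson_annulus_le:
  assumes "0 \<le> s" "s < 1"
  shows "(\<integral>\<^sup>+z\<in>{z. s \<le> cmod z \<and> cmod z < 1}. ennreal ((1 - (cmod z)\<^sup>2) / (cmod (1 - z))\<^sup>2) \<partial>lborel) \<le> ennreal (2 * pi * (1 - s))"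
proof -
  define A where "A = {z. s \<le> cmod z \<and> cmod z < 1}"
  have [measurable]: "A \<in> sets borel" unfolding A_def by measurable
  have "(\<integral>\<^sup>+z\<in>A. ennreal ((1 - (cmod z)\<^sup>2) / (cmod (1 - z))\<^sup>2) \<partial>lborel)
     = (\<integral>\<^sup>+z. (\<integral>\<^sup>+t\<in>{0..1}. (ennreal ((1 - (cmod (cis (2 * pi * t) * z))\<^sup>2) / (cmod (1 - cis (2 * pi * t) * z))\<^sup>2)
           * indicator A (cis (2 * pi * t) * z)) \<partial>lborel) \<partial>lborel)"
    by (rule nn_integral_rotation_average) measurable
  also have "\<dots> = (\<integral>\<^sup>+z. indicator A z \<partial>lborel)"
  proof (rule nn_integral_cong)
    fix z
    have iA: "indicator A (cis (2 * pi * t) * z) = (indicator A z :: ennreal)" for t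
      by (auto simp: A_def norm_mult indicator_def)
    show "(\<integral>\<^sup>+t\<in>{0..1}. (ennreal ((1 - (cmod (cis (2 * pi * t) * z))\<^sup>2) / (cmod (1 - cis (2 * pi * t) * z))\<^sup>2)
           * indicator A (cis (2 * pi * t) * z)) \<partial>lborel) = indicator A z"
      unfolding iA using poisson_kernel_circle_average [of z] by (cases "z \<in> A") (auto simp: A_def)
  qed
  also have "\<dots> = emeasure lborel A" by simp
  also have "\<dots> = emeasure lborel (ball (0::complex) 1 - ball 0 s)"
    by (rule arg_cong [of _ _ "emeasure lborel"]) (auto simp: A_def)
  also have "emeasure lborel (ball (0::complex) 1 - ball 0 s) = emeasure lborel (ball (0::complex) 1) - emeasure lborel (ball (0::complex) s)"
    by (rule emeasure_Diff) (use assms in \<open>auto simp: emeasure_ball\<close>)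
  also have "\<dots> = ennreal (pi - pi * s\<^sup>2)"
    using assms by (simp add: emeasure_ball unit_ball_vol_2 ennreal_minus)
  also have "\<dots> \<le> ennreal (2 * pi * (1 - s))"
  proof (rule ennreal_leI)
    have "pi * (1 - s) * (1 + s) \<le> pi * (1 - s) * 2"
      using assms by (intro mult_left_mono) auto
    then show "pi - pi * s\<^sup>2 \<le> 2 * pi * (1 - s)"
      by (simp add: algebra_simps power2_eq_square)
  qed
  finally show ?thesis unfolding A_def .
qed

lemma sqrt_ennreal_le_1: "x \<le> 1 \<Longrightarrow> sqrt_ennreal x \<le> 1"
  by (cases x) (auto simp: sqrt_ennreal_def top_unique simp flip: ennreal_1)

text \<open>As the derivative is \<open>1 / (2 * (1 - z))\<close>, the integrand is
  \<open>1 / (4 * pi)\<close> times the Poisson kernel. Enlarging a Carleson square to the full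
  annulus \<open>|a| \<le> |z| < 1\<close> still leaves a bound linear in \<open>1 - |a|\<close>.
  The supremum is at most 1/2, the value at 0 contributes 1/4.\<close>

lemma norm_BMOA_log_test: "norm_BMOA log_test \<le> 1"
proof -
  have "(SUP a\<in>unit_disc.
         (\<integral>\<^sup>+ z \<in> Carleson_square a. ennreal ((cmod (deriv log_test z))\<^sup>2 * (1 - (cmod z)\<^sup>2) / pi) \<partial>lborel)
         / ennreal (1 - cmod a)) \<le> ennreal (1/2)"
  proof (rule SUP_least)
    fix a :: complex assume "a \<in> unit_disc"
    then have a: "cmod a < 1" by simp
    define A where "A = {z. cmod a \<le> cmod z \<and> cmod z < 1}"
    have sub: "Carleson_square a \<subseteq> A"
      by (auto simp: Carleson_square_def A_def split: if_splits)
    have "(\<integral>\<^sup>+ z \<in> Carleson_square a. ennreal ((cmod (deriv log_test z))\<^sup>2 * (1 - (cmod z)\<^sup>2) / pi) \<partial>lborel)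
        \<le> (\<integral>\<^sup>+ z. ennreal (1 / (4 * pi)) * (ennreal ((1 - (cmod z)\<^sup>2) / (cmod (1 - z))\<^sup>2) * indicator A z) \<partial>lborel)"
    proof (rule nn_integral_mono)
      fix z
      have "(cmod (deriv log_test z))\<^sup>2 * (1 - (cmod z)\<^sup>2) / pi = 1 / (4 * pi) * ((1 - (cmod z)\<^sup>2) / (cmod (1 - z))\<^sup>2)" if "z \<in> A"
      proof -
        have "cmod (deriv log_test z) = 1 / (2 * cmod (1 - z))"
          using that DERIV_imp_deriv [OF log_test_deriv, of z]
          by (simp only: A_def mem_Collect_eq norm_divide norm_mult norm_one norm_numeral)
        then show ?thesis by (simp add: power_divide power_mult_distrib)
      qed
      then show "ennreal ((cmod (deriv log_test z))\<^sup>2 * (1 - (cmod z)\<^sup>2) / pi) * indicator (Carleson_square a) z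
          \<le> ennreal (1 / (4 * pi)) * (ennreal ((1 - (cmod z)\<^sup>2) / (cmod (1 - z))\<^sup>2) * indicator A z)"
        using sub by (auto simp: indicator_def ennreal_mult'[symmetric])
    qed
    also have "\<dots> = ennreal (1 / (4 * pi)) * (\<integral>\<^sup>+ z\<in>A. ennreal ((1 - (cmod z)\<^sup>2) / (cmod (1 - z))\<^sup>2) \<partial>lborel)"
      unfolding A_def by (rule nn_integral_cmult) measurable
    also have "\<dots> \<le> ennreal (1 / (4 * pi)) * ennreal (2 * pi * (1 - cmod a))"
      unfolding A_def by (intro mult_left_mono nn_integral_poisson_annulus_le) (use a in auto)
    also have "\<dots> = ennreal (1 / (4 * pi) * (2 * pi * (1 - cmod a)))"
      by (rule ennreal_mult' [symmetric]) auto
    also have "\<dots> = ennreal (1 - cmod a) * ennreal (1/2)"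
      by (subst ennreal_mult'' [symmetric]) (auto simp: diff_divide_distrib right_diff_distrib)
    finally show "(\<integral>\<^sup>+ z \<in> Carleson_square a. ennreal ((cmod (deriv log_test z))\<^sup>2 * (1 - (cmod z)\<^sup>2) / pi) \<partial>lborel)
         / ennreal (1 - cmod a) \<le> ennreal (1/2)"
      using a by (intro divide_le_posI_ennreal) auto
  qed
  moreover have "(cmod (log_test 0))\<^sup>2 = 1/4"
    by (simp add: log_test_def norm_divide power_divide)
  ultimately have "(SUP a\<in>unit_disc.
         (\<integral>\<^sup>+ z \<in> Carleson_square a. ennreal ((cmod (deriv log_test z))\<^sup>2 * (1 - (cmod z)\<^sup>2) / pi) \<partial>lborel)
         / ennreal (1 - cmod a)) + ennreal ((cmod (log_test 0))\<^sup>2) \<le> ennreal (1/2) + ennreal (1/4)" (is "?x \<le> _")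
    by (intro add_mono) simp_all
  also have "\<dots> = ennreal (3/4)"
    by (subst ennreal_plus [symmetric]) auto
  also have "ennreal (3/4) \<le> 1" by (simp flip: ennreal_1)
  finally show ?thesis
    unfolding norm_BMOA_def by (rule sqrt_ennreal_le_1)
qed

subsection \<open>Bounded mean oscillation of the logarithm\<close>

text \<open>The centre \<open>c\<close> is arbitrary instead of being the mean over the interval, so
  that sums and multiples can be handled by combining centres. The return to the mean costs a factor
  2.\<close>

definition mean_osc_le :: "(real \<Rightarrow> complex) \<Rightarrow> real \<Rightarrow> real \<Rightarrow> real \<Rightarrow> bool" where
  "mean_osc_le \<phi> C a b \<longleftrightarrow> \<phi> absolutely_integrable_on {a..b} \<and>
     (\<exists>c. integral {a..b} (\<lambda>\<theta>. cmod (\<phi> \<theta> - c)) \<le> C * (b - a))"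

lemma abs_integrable_diff_const:
  fixes \<phi> :: "real \<Rightarrow> complex"
  assumes "\<phi> absolutely_integrable_on {a..b}"
  shows "(\<lambda>\<theta>. \<phi> \<theta> - c) absolutely_integrable_on {a..b}"
    and "(\<lambda>\<theta>. cmod (\<phi> \<theta> - c)) integrable_on {a..b}"
proof -
  show *: "(\<lambda>\<theta>. \<phi> \<theta> - c) absolutely_integrable_on {a..b}"
    by (rule set_integral_diff(1) [OF assms]) (intro absolutely_integrable_continuous_real continuous_intros)
  then show "(\<lambda>\<theta>. cmod (\<phi> \<theta> - c)) integrable_on {a..b}"
    by (simp add: absolutely_integrable_on_def)
qed

lemma mean_osc_le_add:
  assumes "mean_osc_le \<phi> C a b" "mean_osc_le \<psi> D a b"
  shows "mean_osc_le (\<lambda>\<theta>. \<phi> \<theta> + \<psi> \<theta>) (C + D) a b"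
proof -
  from assms obtain c d where
    \<phi>: "\<phi> absolutely_integrable_on {a..b}" "integral {a..b} (\<lambda>\<theta>. cmod (\<phi> \<theta> - c)) \<le> C * (b - a)" and
    \<psi>: "\<psi> absolutely_integrable_on {a..b}" "integral {a..b} (\<lambda>\<theta>. cmod (\<psi> \<theta> - d)) \<le> D * (b - a)"
    by (auto simp: mean_osc_le_def)
  have sum: "(\<lambda>\<theta>. \<phi> \<theta> + \<psi> \<theta>) absolutely_integrable_on {a..b}"
    by (rule set_integral_add(1) [OF \<phi>(1) \<psi>(1)])
  have "integral {a..b} (\<lambda>\<theta>. cmod (\<phi> \<theta> + \<psi> \<theta> - (c + d)))
      \<le> integral {a..b} (\<lambda>\<theta>. cmod (\<phi> \<theta> - c) + cmod (\<psi> \<theta> - d))"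
    by (intro integral_le integrable_add abs_integrable_diff_const sum \<phi>(1) \<psi>(1))
      (metis add_diff_add norm_triangle_ineq)
  also have "\<dots> \<le> (C + D) * (b - a)"
    using \<phi>(2) \<psi>(2) abs_integrable_diff_const(2) [OF \<phi>(1)] abs_integrable_diff_const(2) [OF \<psi>(1)]
    by (simp add: integral_add algebra_simps)
  finally show ?thesis using sum by (auto simp: mean_osc_le_def)
qed

lemma mean_osc_le_cmult:
  assumes "mean_osc_le \<phi> C a b"
  shows "mean_osc_le (\<lambda>\<theta>. k * \<phi> \<theta>) (cmod k * C) a b"
proof -
  from assms obtain c where
    \<phi>: "\<phi> absolutely_integrable_on {a..b}" "integral {a..b} (\<lambda>\<theta>. cmod (\<phi> \<theta> - c)) \<le> C * (b - a)"
    by (auto simp: mean_osc_le_def)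
  have "integral {a..b} (\<lambda>\<theta>. cmod (k * \<phi> \<theta> - k * c)) = cmod k * integral {a..b} (\<lambda>\<theta>. cmod (\<phi> \<theta> - c))"
    by (simp add: norm_mult flip: right_diff_distrib)
  also have "\<dots> \<le> cmod k * C * (b - a)"
    using mult_left_mono [OF \<phi>(2), of "cmod k"] by (simp add: mult.assoc)
  finally show ?thesis
    using \<phi>(1) by (auto simp: mean_osc_le_def)
qed

lemma mean_osc_le_bounded:
  assumes [measurable]: "\<phi> \<in> borel_measurable borel" and bd: "\<And>\<theta>. \<theta> \<in> {a..b} \<Longrightarrow> cmod (\<phi> \<theta>) \<le> C" and "a \<le> b"
  shows "mean_osc_le \<phi> C a b"
proof -
  have *: "\<phi> absolutely_integrable_on {a..b}"
  proof (rule measurable_bounded_by_integrable_imp_absolutely_integrable [where g = "\<lambda>_. C"])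
    show "\<phi> \<in> borel_measurable (lebesgue_on {a..b})"
      by (rule measurable_restrict_space1, rule measurable_completion) measurable
  qed (use bd in auto)
  have "integral {a..b} (\<lambda>\<theta>. cmod (\<phi> \<theta> - 0)) \<le> integral {a..b} (\<lambda>_. C)"
    by (intro integral_le abs_integrable_diff_const *) (use bd in auto)
  also have "\<dots> = C * (b - a)" using \<open>a \<le> b\<close> by simp
  finally show ?thesis
    using * unfolding mean_osc_le_def by (intro conjI exI [of _ 0])
qed

lemma mean_osc_le_const: "a \<le> b \<Longrightarrow> mean_osc_le (\<lambda>_. c) 0 a b"
  unfolding mean_osc_le_def
  by (auto intro!: exI [of _ c] absolutely_integrable_continuous_real)

text \<open>Used to discard the singularities of logarithms, where HOL assigns default
  values.\<close>

lemma mean_osc_le_cong: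
  assumes "mean_osc_le \<phi> C a b" "countable S" "\<And>\<theta>. \<theta> \<in> {a..b} - S \<Longrightarrow> \<psi> \<theta> = \<phi> \<theta>"
  shows "mean_osc_le \<psi> C a b"
proof -
  have neg: "negligible S"
    using assms(2) by (simp add: countable_imp_null_set_lborel negligible_iff_null_sets null_sets_completionI)
  from assms obtain c where
    \<phi>: "\<phi> absolutely_integrable_on {a..b}" "integral {a..b} (\<lambda>\<theta>. cmod (\<phi> \<theta> - c)) \<le> C * (b - a)"
    by (auto simp: mean_osc_le_def)
  have "\<psi> absolutely_integrable_on {a..b}"
    by (rule absolutely_integrable_spike [OF \<phi>(1) neg]) (use assms(3) in auto)
  moreover have "integral {a..b} (\<lambda>\<theta>. cmod (\<psi> \<theta> - c)) = integral {a..b} (\<lambda>\<theta>. cmod (\<phi> \<theta> - c))"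
    by (rule integral_spike [OF neg]) (use assms(3) in auto)
  ultimately show ?thesis
    using \<phi>(2) unfolding mean_osc_le_def by (intro conjI exI [of _ c]) simp_all
qed

text \<open>The distance of the mean from \<open>c\<close> is at most the oscillation about
  \<open>c\<close>, so replacing \<open>c\<close> by the mean at most doubles the bound.\<close>

lemma mean_osc_le_average:
  assumes "mean_osc_le \<phi> C a b" "a < b"
  shows "1 / (b - a) * integral {a..b} (\<lambda>\<theta>. cmod (\<phi> \<theta> - integral {a..b} \<phi> / of_real (b - a))) \<le> 2 * C"
proof -
  from assms obtain c where
    \<phi>: "\<phi> absolutely_integrable_on {a..b}" "integral {a..b} (\<lambda>\<theta>. cmod (\<phi> \<theta> - c)) \<le> C * (b - a)"
    by (auto simp: mean_osc_le_def)
  define m where "m = integral {a..b} \<phi> / of_real (b - a)"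
  have \<phi>i: "\<phi> integrable_on {a..b}" using \<phi>(1) by (rule set_lebesgue_integral_eq_integral(1))
  have ba: "complex_of_real (b - a) \<noteq> 0" using assms(2) by (simp only: of_real_eq_0_iff)
  have "integral {a..b} (\<lambda>\<theta>. \<phi> \<theta> - c) = integral {a..b} \<phi> - of_real (b - a) * c"
    using assms(2) by (subst integral_diff [OF \<phi>i]) (auto simp: scaleR_conv_of_real)
  also have "\<dots> = of_real (b - a) * (m - c)"
    using ba by (simp add: m_def right_diff_distrib del: of_real_diff)
  finally have "(b - a) * cmod (m - c) = cmod (integral {a..b} (\<lambda>\<theta>. \<phi> \<theta> - c))"
    using assms(2) by (simp add: norm_mult del: of_real_diff)
  also have "\<dots> \<le> integral {a..b} (\<lambda>\<theta>. cmod (\<phi> \<theta> - c))"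
    by (rule integral_norm_bound_integral)
      (use abs_integrable_diff_const [OF \<phi>(1)] set_lebesgue_integral_eq_integral(1) in auto)
  finally have mc: "(b - a) * cmod (m - c) \<le> C * (b - a)" using \<phi>(2) by linarith
  have "integral {a..b} (\<lambda>\<theta>. cmod (\<phi> \<theta> - m)) \<le> integral {a..b} (\<lambda>\<theta>. cmod (\<phi> \<theta> - c) + cmod (m - c))"
    by (intro integral_le integrable_add abs_integrable_diff_const \<phi>(1))
      (auto, metis add_diff_eq diff_add_cancel norm_minus_commute norm_triangle_ineq)
  also have "\<dots> = integral {a..b} (\<lambda>\<theta>. cmod (\<phi> \<theta> - c)) + (b - a) * cmod (m - c)"
    using assms(2) by (subst integral_add) (auto intro: abs_integrable_diff_const \<phi>(1))
  also have "\<dots> \<le> 2 * C * (b - a)" using \<phi>(2) mc by simp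
  finally show ?thesis unfolding m_def using assms(2) by (simp add: pos_divide_le_eq)
qed

text \<open>With \<open>c = ln (max \<bar>a\<bar> \<bar>b\<bar>)\<close> the integrand \<open>c - ln \<bar>\<theta>\<bar>\<close> is nonnegative on \<open>[a, b]\<close>.\<close>

lemma mean_osc_le_ln_aux:
  fixes a b :: real
  assumes "a < b"
  defines "m \<equiv> max \<bar>a\<bar> \<bar>b\<bar>"
  shows "(b - a) * ln m - ((b * ln \<bar>b\<bar> - b) - (a * ln \<bar>a\<bar> - a)) \<le> 2 * (b - a)"
proof -
  have m: "0 < m" using assms by (auto simp: m_def)
  have *: "x * ln m - x * ln \<bar>x\<bar> \<le> (if 0 < x then m - x else 0)" if "\<bar>x\<bar> \<le> m" for x
  proof (cases "x > 0")
    case True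
    then have "x * (ln m - ln x) \<le> x * (m / x - 1)"
      using m ln_le_minus_one [of "m / x"] by (intro mult_left_mono) (auto simp: ln_div)
    also have "\<dots> = m - x" using True by (simp add: right_diff_distrib)
    finally show ?thesis using True by (simp add: right_diff_distrib)
  next
    case False
    then show ?thesis
      using that m mult_left_mono_neg [of "ln \<bar>x\<bar>" "ln m" x] by (cases "x = 0") auto
  qed
  \<comment> \<open>The left-hand side of the claim is \<open>b - a\<close> plus the expression in
    \<open>*\<close> at \<open>x = b\<close> and at \<open>x = - a\<close>. These are the
    contributions of the two sides of the singularity at 0.\<close>
  have "\<bar>b\<bar> \<le> m" "\<bar>- a\<bar> \<le> m" by (auto simp: m_def)
  note P = * [OF this(1)] * [OF this(2)]
  have "m \<le> b - a" if "a < 0" "0 < b" using that by (auto simp: m_def)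
  moreover have "m = b" if "0 \<le> a" using that assms(1) by (auto simp: m_def)
  moreover have "m = - a" if "b \<le> 0" using that assms(1) by (auto simp: m_def)
  ultimately show ?thesis
    using P assms(1) by (auto simp: algebra_simps split: if_splits)
qed

text \<open>The primitives of logarithms below contain this term. Its continuity at 0 lets the
  fundamental theorem of calculus pass through the singularity.\<close>

lemma continuous_on_mult_ln_abs: "continuous_on UNIV (\<lambda>x::real. x * ln \<bar>x\<bar>)"
proof -
  have "((\<lambda>x::real. x * ln \<bar>x\<bar>) \<longlongrightarrow> 0) (at 0)"
    by (intro filterlim_split_at; real_asymp)
  then have "isCont (\<lambda>x::real. x * ln \<bar>x\<bar>) 0"
    by (simp add: isCont_def)
  then have "isCont (\<lambda>x::real. x * ln \<bar>x\<bar>) x" for x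
    by (cases "x = 0") (auto intro!: continuous_intros)
  then show ?thesis
    by (simp add: continuous_at_imp_continuous_on)
qed

text \<open>Subtracted from its maximum \<open>ln m\<close> on the interval, the logarithm becomes
  nonnegative, so its absolute integral is read off from a primitive. The constant 2 depends neither
  on the interval nor on \<open>p\<close>, as it must since rescaling only adds a constant to the
  logarithm.\<close>

lemma mean_osc_le_ln:
  fixes p :: real
  assumes "a < b"
  shows "mean_osc_le (\<lambda>\<theta>. of_real (ln \<bar>\<theta> - p\<bar>)) 2 a b"
proof -
  define m where "m = max \<bar>a - p\<bar> \<bar>b - p\<bar>"
  have m: "0 < m" using assms by (auto simp: m_def)
  define F where "F \<theta> = (\<theta> - p) * ln \<bar>\<theta> - p\<bar> - (\<theta> - p)" for \<theta>
  from continuous_on_compose2 [OF continuous_on_mult_ln_abs, of "{a..b}" "\<lambda>\<theta>. \<theta> - p"]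
  have "continuous_on {a..b} (\<lambda>\<theta>. (\<theta> - p) * ln \<bar>\<theta> - p\<bar>)"
    by (simp add: continuous_on_diff)
  then have cont: "continuous_on {a..b} F"
    unfolding F_def by (rule continuous_on_diff) (intro continuous_intros)
  have int: "((\<lambda>\<theta>. ln \<bar>\<theta> - p\<bar>) has_integral (F b - F a)) {a..b}"
  proof (rule fundamental_theorem_of_calculus_interior_strong [where S = "{p}"])
    fix x assume "x \<in> {a<..<b} - {p}"
    then have "x \<noteq> p" by simp
    then consider "x < p" | "p < x" by linarith
    then have "(F has_real_derivative ln \<bar>x - p\<bar>) (at x)"
    proof cases
      case 1
      have "((\<lambda>\<theta>. (\<theta> - p) * ln (p - \<theta>) - (\<theta> - p)) has_real_derivative ln \<bar>x - p\<bar>) (at x)"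
      proof -
        have "((\<lambda>\<theta>. (\<theta> - p) * ln (p - \<theta>) - (\<theta> - p)) has_real_derivative (x - p) * ((0 - 1) / (p - x)) + 1 * ln (p - x) - 1) (at x)"
          using 1 by (auto intro!: derivative_eq_intros)
        moreover have "(x - p) * ((0 - 1) / (p - x)) = 1" using 1 by (simp add: divide_simps)
        ultimately show ?thesis using 1 by simp
      qed
      then show ?thesis
        by (rule has_field_derivative_transform_within_open [where S = "{..<p}"]) (use 1 in \<open>simp_all add: F_def\<close>)
    next
      case 2
      have "((\<lambda>\<theta>. (\<theta> - p) * ln (\<theta> - p) - (\<theta> - p)) has_real_derivative ln \<bar>x - p\<bar>) (at x)"
        using 2 by (auto intro!: derivative_eq_intros)
      then show ?thesis
        by (rule has_field_derivative_transform_within_open [where S = "{p<..}"]) (use 2 in \<open>simp_all add: F_def\<close>)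
    qed
    then show "(F has_vector_derivative ln \<bar>x - p\<bar>) (at x)"
      by (rule has_real_derivative_iff_has_vector_derivative [THEN iffD1])
  qed (use assms cont in auto)
  \<comment> \<open>The value at \<open>p\<close> is set by hand, because the default value of
    \<open>ln\<close> at 0 need not leave the difference nonnegative.\<close>
  define \<psi> where "\<psi> \<theta> = (if \<theta> = p then 0 else ln m - ln \<bar>\<theta> - p\<bar>)" for \<theta>
  have "((\<lambda>\<theta>. ln m - ln \<bar>\<theta> - p\<bar>) has_integral ((b - a) * ln m - (F b - F a))) {a..b}"
    using has_integral_diff [OF has_integral_const_real [of "ln m" a b] int] assms by simp
  then have \<psi>I: "(\<psi> has_integral ((b - a) * ln m - (F b - F a))) {a..b}"
    by (rule has_integral_spike_finite [of "{p}", rotated 2]) (auto simp: \<psi>_def)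
  have nonneg: "0 \<le> \<psi> \<theta>" if "\<theta> \<in> {a..b}" for \<theta>
    using that m by (auto simp: \<psi>_def m_def)
  have \<psi>a: "\<psi> absolutely_integrable_on {a..b}"
    by (rule nonnegative_absolutely_integrable_1) (use \<psi>I nonneg in auto)
  then have "(\<lambda>\<theta>. complex_of_real (\<psi> \<theta>)) absolutely_integrable_on {a..b}"
    using absolutely_integrable_linear [OF \<psi>a bounded_linear_of_real] by (simp add: o_def)
  moreover have "integral {a..b} (\<lambda>\<theta>. cmod (complex_of_real (\<psi> \<theta>) - 0)) = integral {a..b} \<psi>"
    by (intro integral_cong) (use nonneg in auto)
  moreover have "integral {a..b} \<psi> \<le> 2 * (b - a)"
    using mean_osc_le_ln_aux [of "a - p" "b - p"] assms
    by (simp add: integral_unique [OF \<psi>I] F_def m_def)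
  ultimately have "mean_osc_le (\<lambda>\<theta>. complex_of_real (\<psi> \<theta>)) 2 a b"
    unfolding mean_osc_le_def by (intro conjI exI [of _ 0]) (simp_all only:)
  from mean_osc_le_add [OF mean_osc_le_cmult [OF this, of "-1"] mean_osc_le_const [of a b "complex_of_real (ln m)"]]
  have "mean_osc_le (\<lambda>\<theta>. - 1 * complex_of_real (\<psi> \<theta>) + of_real (ln m)) 2 a b"
    using assms by simp
  then show ?thesis
    by (rule mean_osc_le_cong [of _ _ _ _ "{p}"]) (auto simp: \<psi>_def)
qed

text \<open>A weak form of Jordan's inequality. Up to \<open>pi / 3\<close> the derivative of the
  sine is at least 1/2, which exceeds \<open>1 / pi\<close>; beyond that the sine is at least 1/2,
  which bounds \<open>x / pi\<close>.\<close>

lemma sin_ge_div_pi: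
  assumes "0 \<le> x" "x \<le> pi / 2"
  shows "x / pi \<le> sin x"
proof (cases "x \<le> pi / 3")
  case True
  have "x * (1 / pi) \<le> x * (1 / 2)"
    using assms pi_ge_two by (intro mult_left_mono) (auto simp: field_simps)
  also have "\<dots> \<le> sin x"
  proof (cases "x = 0")
    case False
    then obtain \<xi> where \<xi>: "0 < \<xi>" "\<xi> < x" "sin x - sin 0 = (x - 0) * cos \<xi>"
      using MVT2 [of 0 x sin cos] assms by (auto intro: DERIV_sin)
    have "cos (pi / 3) \<le> cos \<xi>"
      using \<xi> True by (intro cos_monotone_0_pi_le) auto
    then show ?thesis
      using \<xi> assms mult_left_mono [of "1/2" "cos \<xi>" x] by (simp add: cos_60)
  qed simp
  finally show ?thesis by simp
next
  case False
  have "sin (pi / 6) \<le> sin x"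
    using False assms by (intro sin_monotone_2pi_le) auto
  moreover have "x / pi \<le> 1 / 2" using assms by (simp add: field_simps)
  ultimately show ?thesis unfolding sin_30 by linarith
qed

lemma cmod_one_minus_cis: "cmod (1 - cis u) = 2 * \<bar>sin (u / 2)\<bar>"
  using dist_exp_i_1 [of u] by (simp add: cis_conv_exp norm_minus_commute)

text \<open>On one period, \<open>1 - cis u\<close> is comparable to the polynomial with the same zeros.\<close>

lemma ln_cmod_one_minus_cis:
  assumes "0 < u" "u < 2 * pi"
  shows "\<bar>ln (cmod (1 - cis u)) - ln u - ln (2 * pi - u) - ln (u + 2 * pi)\<bar> \<le> 3 * ln (2 * pi)"
proof -
  \<comment> \<open>The distance from \<open>u\<close> to the nearer of the zeros 0 and
    \<open>2 * pi\<close>. Both \<open>cmod (1 - cis u)\<close> and \<open>u * (2 * pi - u)\<close>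
    are symmetric about \<open>pi\<close> and hence functions of \<open>v\<close>.\<close>
  define v where "v = min u (2 * pi - u)"
  have v: "0 < v" "v \<le> pi" using assms by (auto simp: v_def)
  have uv: "u * (2 * pi - u) = v * (2 * pi - v)" by (auto simp: v_def min_def)
  have s: "cmod (1 - cis u) = 2 * sin (v / 2)"
  proof (cases "u \<le> pi")
    case True
    then show ?thesis using assms sin_ge_zero [of "u/2"] by (simp add: cmod_one_minus_cis v_def min_def)
  next
    case False
    have "sin (u / 2) = sin (pi - u / 2)" by (simp only: sin_pi_minus)
    moreover have "v / 2 = pi - u / 2" using False by (simp add: v_def min_def field_simps)
    ultimately show ?thesis using assms sin_ge_zero [of "u/2"] by (simp only: cmod_one_minus_cis) simp
  qed
  have up: "cmod (1 - cis u) \<le> v" 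
    using sin_x_le_x [of "v/2"] v by (simp add: s)
  have lo: "v / pi \<le> cmod (1 - cis u)" 
    using sin_ge_div_pi [of "v/2"] v by (simp add: s)
  then have pos: "0 < cmod (1 - cis u)" using v by (smt (verit) divide_pos_pos pi_gt_zero)
  \<comment> \<open>What remains of the polynomial after the factor \<open>v\<close>; on the period
    it lies between fixed constants. The two errors are at most \<open>ln pi\<close> and
    \<open>ln (8 * pi^2)\<close>, whose sum is \<open>3 * ln (2 * pi)\<close>.\<close>
  define Q where "Q = (2 * pi - v) * (u + 2 * pi)"
  have Q: "pi * (2 * pi) \<le> Q" "Q \<le> 2 * pi * (4 * pi)"
    unfolding Q_def by (rule mult_mono; use v assms in simp)+
  have Qpos: "0 < Q" using Q(1) pi_gt_zero by (smt (verit) mult_pos_pos)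
  have "ln u + ln (2 * pi - u) = ln v + ln (2 * pi - v)"
    using assms v by (simp add: uv flip: ln_mult_pos)
  then have lnQ: "ln u + ln (2 * pi - u) + ln (u + 2 * pi) = ln v + ln Q"
    using assms v by (simp add: Q_def ln_mult_pos)
  have "ln (v / pi) \<le> ln (cmod (1 - cis u))" "ln (cmod (1 - cis u)) \<le> ln v"
    using lo up pos v by (subst ln_le_cancel_iff; simp)+
  moreover have "ln Q \<le> ln (2 * pi * (4 * pi))" "0 \<le> ln Q"
    using Q Qpos pi_ge_two mult_mono [of 1 pi 1 "2 * pi"] by (auto simp: ln_ge_zero)
  moreover have "ln (v / pi) = ln v - ln pi" "ln (2 * pi * (4 * pi)) = 3 * ln 2 + 2 * ln pi" "ln (2 * pi) = ln 2 + ln pi"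
    using v ln_realpow [of 2 3] by (simp_all add: ln_div ln_mult_pos)
  moreover have "0 \<le> ln pi" using pi_ge_two by simp
  ultimately show ?thesis using lnQ by (simp add: abs_le_iff)
qed


section \<open>Boundary values of the test function and their oscillation\<close>

lemma boundary_fun_log_test:
  assumes "cis \<theta> \<noteq> 1"
  shows "boundary_fun log_test \<theta> = (1 - Ln (1 - cis \<theta>)) / 2"
  unfolding boundary_fun_def
proof (rule tendsto_Lim)
  have "0 < Re (1 - cis \<theta>)"
  proof -
    have "cos \<theta> \<noteq> 1"
      using assms cos_one_sin_zero [of \<theta>] by (auto simp: complex_eq_iff)
    then show ?thesis by (simp add: less_le)
  qed
  then have "1 - cis \<theta> \<notin> \<real>\<^sub>\<le>\<^sub>0" by (auto simp: complex_nonpos_Reals_iff)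
  then have "((\<lambda>r. (1 - Ln (1 - of_real r * cis \<theta>)) / 2) \<longlongrightarrow> (1 - Ln (1 - of_real 1 * cis \<theta>)) / 2) (at_left (1::real))"
    by (intro tendsto_intros) auto
  moreover have "\<forall>\<^sub>F r in at_left (1::real). (1 - Ln (1 - of_real r * cis \<theta>)) / 2 = log_test (of_real r * cis \<theta>)"
    by (rule eventually_mono [OF eventually_at_left_real [of 0 1]]) (auto simp: log_test_def norm_mult)
  ultimately show "((\<lambda>r. log_test (of_real r * cis \<theta>)) \<longlongrightarrow> (1 - Ln (1 - cis \<theta>)) / 2) (at_left 1)"
    by (auto elim: Lim_transform_eventually)
qed simp

lemma countable_cis_eq_1: "countable {\<theta>. cis \<theta> = 1}"
proof (rule countable_subset)
  show "{\<theta>. cis \<theta> = 1} \<subseteq> range (\<lambda>n::int. of_int n * (2 * pi))"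
  proof
    fix \<theta> assume "\<theta> \<in> {\<theta>. cis \<theta> = 1}"
    then have "cos \<theta> = 1" by (simp add: complex_eq_iff)
    then obtain n :: int where "\<theta> = of_int n * 2 * pi"
      by (auto simp: cos_one_2pi_int)
    then show "\<theta> \<in> range (\<lambda>n::int. of_int n * (2 * pi))" by auto
  qed
qed simp

text \<open>An interval of length at most \<open>2 * pi\<close> meets no zeros of
  \<open>1 - cis\<close> other than three consecutive ones. Their logarithms contribute 2 each, and
  the remainder is bounded by \<open>3 * ln (2 * pi)\<close>.\<close>

lemma mean_osc_le_ln_cis:
  assumes "a < b" "b - a \<le> 2 * pi"
  shows "mean_osc_le (\<lambda>\<theta>. of_real (ln (cmod (1 - cis \<theta>)))) (6 + 3 * ln (2 * pi)) a b"
proof -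
  \<comment> \<open>\<open>q\<close> is the multiple of \<open>2 * pi\<close> nearest to the
    midpoint, hence within \<open>pi\<close> of it. As half the length is also at most
    \<open>pi\<close>, the interval stays within \<open>2 * pi\<close> of \<open>q\<close>.\<close>
  define k :: int where "k = round ((a + b) / (4 * pi))"
  define q where "q = of_int k * (2 * pi)"
  have "q - (a + b) / 2 = 2 * pi * (of_int k - (a + b) / (4 * pi))"
    by (simp add: q_def field_simps)
  then have "\<bar>q - (a + b) / 2\<bar> = 2 * pi * \<bar>of_int k - (a + b) / (4 * pi)\<bar>"
    by (simp add: abs_mult)
  also have "\<dots> \<le> 2 * pi * (1 / 2)"
    unfolding k_def by (intro mult_left_mono of_int_round_abs_le) auto
  finally have q: "q - 2 * pi \<le> a" "b \<le> q + 2 * pi"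
    using assms by (simp_all add: abs_le_iff field_simps)
  have cis_q: "cis (\<theta> - q) = cis \<theta>" for \<theta>
  proof -
    have "cis (\<theta> - q) = cis \<theta> * cis (- q)" by (simp add: cis_mult)
    also have "cis (- q) = 1"
      using cis_multiple_2pi [of "- of_int k"] by (simp add: q_def mult.commute)
    finally show ?thesis by simp
  qed
  define h where "h \<theta> = ln (cmod (1 - cis \<theta>)) - ln \<bar>\<theta> - q\<bar> - ln \<bar>\<theta> - (q + 2 * pi)\<bar> - ln \<bar>\<theta> - (q - 2 * pi)\<bar>" for \<theta>
  define S where "S = {q - 2 * pi, q, q + 2 * pi}"
  have [measurable]: "cis \<in> borel_measurable borel"
    by (intro borel_measurable_continuous_onI continuous_intros)
  have [measurable]: "h \<in> borel_measurable borel"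
    unfolding h_def by measurable
  have bound: "\<bar>h \<theta>\<bar> \<le> 3 * ln (2 * pi)" if \<theta>: "\<theta> \<in> {a..b}" "\<theta> \<notin> S" for \<theta>
  proof (cases "q < \<theta>")
    case True
    have "\<theta> - q < 2 * pi" using \<theta> q by (auto simp: S_def)
    moreover have "\<bar>\<theta> - (q + 2 * pi)\<bar> = 2 * pi - (\<theta> - q)" "\<bar>\<theta> - (q - 2 * pi)\<bar> = (\<theta> - q) + 2 * pi" "\<bar>\<theta> - q\<bar> = \<theta> - q"
      using calculation True by auto
    ultimately show ?thesis
      using ln_cmod_one_minus_cis [of "\<theta> - q"] True by (simp only: h_def cis_q)
  next
    case False
    have "q - \<theta> < 2 * pi" "0 < q - \<theta>" using \<theta> q False by (auto simp: S_def)
    moreover have "\<bar>\<theta> - (q + 2 * pi)\<bar> = (q - \<theta>) + 2 * pi" "\<bar>\<theta> - (q - 2 * pi)\<bar> = 2 * pi - (q - \<theta>)" "\<bar>\<theta> - q\<bar> = q - \<theta>"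
      using calculation by auto
    moreover have "cmod (1 - cis (q - \<theta>)) = cmod (1 - cis \<theta>)"
    proof -
      have "1 - cis (q - \<theta>) = cnj (1 - cis (\<theta> - q))" by (simp add: cis_cnj)
      then show ?thesis by (simp only: complex_mod_cnj cis_q)
    qed
    ultimately have "h \<theta> = ln (cmod (1 - cis (q - \<theta>))) - ln (q - \<theta>) - ln (2 * pi - (q - \<theta>)) - ln (q - \<theta> + 2 * pi)"
      by (simp only: h_def)
    then show ?thesis
      using ln_cmod_one_minus_cis [of "q - \<theta>"] \<open>q - \<theta> < 2 * pi\<close> \<open>0 < q - \<theta>\<close> by simp
  qed
  \<comment> \<open>The estimate \<open>bound\<close> is for points outside \<open>S\<close>;
    setting the function to 0 on this finite set leaves all integrals unchanged.\<close>
  have "mean_osc_le (\<lambda>\<theta>. of_real (if \<theta> \<in> S then 0 else h \<theta>)) (3 * ln (2 * pi)) a b"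
  proof (rule mean_osc_le_bounded)
    have [measurable]: "S \<in> sets borel" by (auto simp: S_def)
    show "(\<lambda>\<theta>. complex_of_real (if \<theta> \<in> S then 0 else h \<theta>)) \<in> borel_measurable borel" by measurable
    have "0 \<le> ln (2 * pi)" using pi_ge_two by simp
    then show "cmod (complex_of_real (if \<theta> \<in> S then 0 else h \<theta>)) \<le> 3 * ln (2 * pi)" if "\<theta> \<in> {a..b}" for \<theta>
      using bound [OF that] by auto
  qed (use assms in auto)
  from mean_osc_le_add [OF mean_osc_le_add [OF mean_osc_le_add [OF this mean_osc_le_ln [OF assms(1), of q]]
      mean_osc_le_ln [OF assms(1), of "q + 2 * pi"]] mean_osc_le_ln [OF assms(1), of "q - 2 * pi"]]
  have "mean_osc_le (\<lambda>\<theta>. of_real (ln (cmod (1 - cis \<theta>)))) (3 * ln (2 * pi) + 2 + 2 + 2) a b"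
    by (rule mean_osc_le_cong [where S = S]) (auto simp: S_def h_def)
  then show ?thesis by (simp add: add.commute)
qed

text \<open>The imaginary part of \<open>Ln\<close> is bounded by \<open>pi\<close>, so it has
  bounded oscillation at once. Only the real part, the logarithm of the modulus, is
  unbounded.\<close>

lemma bounded_mean_oscillation_log_test: "bounded_mean_oscillation (boundary_fun log_test)"
proof -
  define C where "C = 1 / 2 * (6 + 3 * ln (2 * pi)) + (1 + pi)"
  have osc: "mean_osc_le (boundary_fun log_test) C a b" if ab: "a < b" "b - a \<le> 2 * pi" for a b
  proof -
    define \<psi> where "\<psi> \<theta> = (if cis \<theta> = 1 then 0 else (1 - \<i> * of_real (Im (Ln (1 - cis \<theta>)))) / 2)" for \<theta>
    have cism [measurable]: "cis \<in> borel_measurable borel"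
      by (intro borel_measurable_continuous_onI continuous_intros)
    have "mean_osc_le \<psi> (1 + pi) a b"
    proof (rule mean_osc_le_bounded)
      show "\<psi> \<in> borel_measurable borel" unfolding \<psi>_def by measurable
      show "cmod (\<psi> \<theta>) \<le> 1 + pi" for \<theta>
      proof (cases "cis \<theta> = 1")
        case False
        then have "\<bar>Im (Ln (1 - cis \<theta>))\<bar> \<le> pi"
          using mpi_less_Im_Ln [of "1 - cis \<theta>"] Im_Ln_le_pi [of "1 - cis \<theta>"] by (auto simp: abs_le_iff)
        then have "cmod (1 - \<i> * of_real (Im (Ln (1 - cis \<theta>)))) \<le> 1 + pi"
          by (intro order_trans [OF norm_triangle_ineq4]) (simp add: norm_mult)
        moreover have "cmod (\<psi> \<theta>) = cmod (1 - \<i> * of_real (Im (Ln (1 - cis \<theta>)))) / 2"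
          using False by (simp add: \<psi>_def norm_divide)
        ultimately show ?thesis using pi_gt_zero by linarith
      qed (simp add: \<psi>_def add_nonneg_nonneg)
    qed (use ab in auto)
    from mean_osc_le_add [OF mean_osc_le_cmult [OF mean_osc_le_ln_cis [OF ab], of "-1/2"] this]
    have "mean_osc_le (\<lambda>\<theta>. - 1 / 2 * of_real (ln (cmod (1 - cis \<theta>))) + \<psi> \<theta>) C a b"
      by (simp add: C_def norm_divide)
    then show ?thesis
    proof (rule mean_osc_le_cong [OF _ countable_cis_eq_1])
      fix \<theta> assume "\<theta> \<in> {a..b} - {\<theta>. cis \<theta> = 1}"
      then have ne: "cis \<theta> \<noteq> 1" "1 - cis \<theta> \<noteq> 0" by auto
      have split: "z = x + \<i> * y \<Longrightarrow> (1 - z) / 2 = - 1 / 2 * x + (1 - \<i> * y) / 2" for x y z :: complex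
        by (simp add: field_simps)
      have "Ln (1 - cis \<theta>) = of_real (ln (cmod (1 - cis \<theta>))) + \<i> * of_real (Im (Ln (1 - cis \<theta>)))"
        using ne by (simp add: complex_eq_iff)
      then show "boundary_fun log_test \<theta> = - 1 / 2 * of_real (ln (cmod (1 - cis \<theta>))) + \<psi> \<theta>"
        unfolding boundary_fun_log_test [OF ne(1)]
        using split [OF \<open>Ln (1 - cis \<theta>) = _\<close>] ne by (simp add: \<psi>_def)
    qed
  qed
  have "boundary_fun log_test absolutely_integrable_on {a..b} \<and>
     1 / (b - a) * integral {a..b} (\<lambda>\<theta>. cmod (boundary_fun log_test \<theta> - integral {a..b} (boundary_fun log_test) / of_real (b - a))) \<le> 2 * C"
    if ab: "a < b" "b - a \<le> 2 * pi" for a b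
    using osc [OF ab] mean_osc_le_average [OF osc [OF ab] ab(1)] unfolding mean_osc_le_def by (intro conjI) auto
  then show ?thesis
    unfolding bounded_mean_oscillation_def by blast
qed

text \<open>The functions on circles of radius \<open>r\<close> are dominated, uniformly in
  \<open>r\<close>, by an integrable function built from the boundary logarithm.\<close>

lemma log_test_in_Hardy1: "log_test \<in> Hardy1"
proof -
  define G where "G \<theta> = 3 + pi + \<bar>ln (cmod (1 - cis \<theta>))\<bar>" for \<theta>
  have "(\<lambda>\<theta>. of_real (ln (cmod (1 - cis \<theta>))) :: complex) absolutely_integrable_on {0..2 * pi}"
    using mean_osc_le_ln_cis [of 0 "2 * pi"] by (simp add: mean_osc_le_def)
  then have "(\<lambda>\<theta>. \<bar>ln (cmod (1 - cis \<theta>))\<bar>) integrable_on {0..2 * pi}"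
    by (simp add: absolutely_integrable_on_def)
  then have Gi: "G integrable_on {0..2 * pi}"
    unfolding G_def by (intro integrable_add) auto
  have "1 / (2 * pi) * integral {0..2 * pi} (\<lambda>\<theta>. cmod (log_test (of_real r * cis \<theta>))) \<le> 1 / (2 * pi) * integral {0..2 * pi} G"
    if r: "0 < r" "r < 1" for r
  proof (rule mult_left_mono)
    \<comment> \<open>Where \<open>cis \<theta> = 1\<close>, the default value of \<open>ln\<close>
      at 0 makes \<open>G\<close> a fixed number while \<open>log_test\<close> grows without bound
      as \<open>r\<close> tends to 1. Domination is therefore arranged by a change on a null
      set.\<close>
    define G' where "G' \<theta> = (if cis \<theta> = 1 then cmod (log_test (of_real r * cis \<theta>)) else G \<theta>)" for \<theta>
    have neg: "negligible {\<theta>. cis \<theta> = 1}"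
      using countable_cis_eq_1 by (simp add: countable_imp_null_set_lborel negligible_iff_null_sets null_sets_completionI)
    have "continuous_on unit_disc log_test"
      using log_test_in_HD by (auto simp: HD_def holomorphic_on_imp_continuous_on)
    then have "continuous_on {0..2 * pi} (\<lambda>\<theta>. log_test (of_real r * cis \<theta>))"
      by (rule continuous_on_compose2) (use r in \<open>auto intro!: continuous_intros simp: norm_mult\<close>)
    then have "(\<lambda>\<theta>. cmod (log_test (of_real r * cis \<theta>))) integrable_on {0..2 * pi}"
      by (intro integrable_continuous_interval continuous_intros)
    moreover have "G' integrable_on {0..2 * pi}"
      by (rule integrable_spike [OF Gi neg]) (auto simp: G'_def)
    moreover have "cmod (log_test (of_real r * cis \<theta>)) \<le> G' \<theta>" for \<theta>
    proof (cases "cis \<theta> = 1")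
      case False
      define w where "w = 1 - of_real r * cis \<theta>"
      have w0: "w \<noteq> 0"
      proof
        assume "w = 0"
        then have "cmod (of_real r * cis \<theta>) = 1" by (simp add: w_def)
        then show False using r by (simp add: norm_mult)
      qed
      have up: "cmod w \<le> 2"
        unfolding w_def by (rule order_trans [OF norm_triangle_ineq4]) (use r in \<open>simp add: norm_mult\<close>)
      \<comment> \<open>Both the distance \<open>1 - r\<close> from \<open>r * cis \<theta>\<close>
        to the circle and the modulus of \<open>w\<close> enter the triangle inequality, and the
        former is at most the latter: moving inwards at most halves the distance to 1.\<close>
      have "cmod (1 - cis \<theta>) \<le> cmod w + cmod (of_real (1 - r) * cis \<theta>)"
        unfolding w_def by (rule order_trans [OF _ norm_triangle_ineq4]) (simp add: algebra_simps)
      also have "cmod (of_real (1 - r) * cis \<theta>) = 1 - r"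
        using r by (simp only: norm_mult norm_cis norm_of_real) simp
      also have "1 - r \<le> cmod w"
        unfolding w_def by (rule order_trans [OF _ norm_triangle_ineq2]) (use r in \<open>simp add: norm_mult\<close>)
      finally have lo: "cmod (1 - cis \<theta>) / 2 \<le> cmod w" by simp
      have "ln (cmod (1 - cis \<theta>) / 2) \<le> ln (cmod w)" "ln (cmod w) \<le> ln 2"
        using lo up w0 False by (subst ln_le_cancel_iff; simp)+
      moreover have "ln 2 \<le> (1::real)" using ln_le_minus_one [of 2] by simp
      moreover have "ln (cmod (1 - cis \<theta>) / 2) = ln (cmod (1 - cis \<theta>)) - ln 2"
        using False by (simp add: ln_div)
      ultimately have "\<bar>Re (Ln w)\<bar> \<le> 1 + \<bar>ln (cmod (1 - cis \<theta>))\<bar>"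
        unfolding Re_Ln [OF w0] by linarith
      moreover have "\<bar>Im (Ln w)\<bar> \<le> pi"
        using mpi_less_Im_Ln [OF w0] Im_Ln_le_pi [OF w0] by (auto simp: abs_le_iff)
      ultimately have "cmod (1 - Ln w) \<le> G \<theta>"
        using norm_triangle_ineq4 [of 1 "Ln w"] cmod_le [of "Ln w"] by (simp add: G_def)
      moreover have "0 \<le> G \<theta>" using pi_ge_zero by (simp add: G_def)
      ultimately show ?thesis
        using False r by (simp add: G'_def log_test_def w_def norm_mult norm_divide)
    qed (simp add: G'_def)
    ultimately have "integral {0..2 * pi} (\<lambda>\<theta>. cmod (log_test (of_real r * cis \<theta>))) \<le> integral {0..2 * pi} G'"
      by (intro integral_le) auto
    also have "\<dots> = integral {0..2 * pi} G"
      by (rule integral_spike [OF neg]) (auto simp: G'_def)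
    finally show "integral {0..2 * pi} (\<lambda>\<theta>. cmod (log_test (of_real r * cis \<theta>))) \<le> integral {0..2 * pi} G" .
  qed simp
  then show ?thesis
    unfolding Hardy1_def using log_test_in_HD by (auto intro!: bdd_aboveI2)
qed

lemma log_test_in_BMOA: "log_test \<in> BMOA"
  unfolding BMOA_def using log_test_in_Hardy1 bounded_mean_oscillation_log_test by simp

subsection \<open>Symbols with nonnegative coefficients\<close>

definition coeff :: "(complex \<Rightarrow> complex) \<Rightarrow> nat \<Rightarrow> real" where
  "coeff g n = Re (maclaurin_coeff g n)"

definition weight :: "(complex \<Rightarrow> complex) \<Rightarrow> real \<Rightarrow> real" where
  "weight g r = M_inf r (deriv g) * (1 - ln (1 - r))"

lemma one_le_one_minus_ln: "0 \<le> r \<Longrightarrow> r < 1 \<Longrightarrow> 1 \<le> 1 - ln (1 - r)" for r :: real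
  using ln_le_minus_one [of "1 - r"] by simp

lemma nonneg_symbols_holomorphic: "g \<in> nonneg_symbols \<Longrightarrow> g holomorphic_on unit_disc"
  by (simp add: nonneg_symbols_def Hinf_def HD_def)

lemma coeff_nonneg: "g \<in> nonneg_symbols \<Longrightarrow> 0 \<le> coeff g n"
  by (auto simp: nonneg_symbols_def coeff_def complex_nonneg_Reals_iff)

lemma maclaurin_coeff_eq: "g \<in> nonneg_symbols \<Longrightarrow> maclaurin_coeff g n = of_real (coeff g n)"
  by (auto simp: nonneg_symbols_def coeff_def complex_nonneg_Reals_iff complex_eq_iff)

section \<open>The Taylor series of \<open>deriv g\<close> and its maximum modulus\<close>

lemma deriv_sums:
  assumes g: "g \<in> nonneg_symbols" and z: "cmod z < 1"
  shows "(\<lambda>n. of_real (real (n + 1) * coeff g (n + 1)) * z ^ n) sums deriv g z"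
proof -
  have "(\<lambda>n. (deriv ^^ n) (deriv g) 0 / fact n * (z - 0) ^ n) sums deriv g z"
    by (rule holomorphic_power_series [where r = 1])
      (use z in \<open>auto intro: holomorphic_deriv nonneg_symbols_holomorphic [OF g]\<close>)
  moreover have "(deriv ^^ n) (deriv g) 0 / fact n = of_real (real (n + 1) * coeff g (n + 1))" for n
  proof -
    have "of_real (coeff g (n + 1)) = (deriv ^^ Suc n) g 0 / fact (Suc n)"
      by (simp add: maclaurin_coeff_eq [OF g, symmetric] maclaurin_coeff_def fps_expansion_def)
    then have "of_real (real (n + 1) * coeff g (n + 1)) = of_real (real (n + 1)) * ((deriv ^^ Suc n) g 0 / fact (Suc n))"
      by (simp only: of_real_mult)
    also have "\<dots> = (deriv ^^ n) (deriv g) 0 / fact n"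
      by (simp add: funpow_swap1 fact_Suc divide_simps del: of_nat_Suc)
    finally show ?thesis by simp
  qed
  ultimately show ?thesis by simp
qed

lemma deriv_of_real_sums:
  assumes g: "g \<in> nonneg_symbols" and r: "0 \<le> r" "r < 1"
  shows "(\<lambda>n. real (n + 1) * coeff g (n + 1) * r ^ n) sums Re (deriv g (of_real r))"
    and "deriv g (of_real r) = of_real (Re (deriv g (of_real r)))"
proof -
  have *: "(\<lambda>n. of_real (real (n + 1) * coeff g (n + 1) * r ^ n)) sums deriv g (of_real r)"
    using deriv_sums [OF g, of "of_real r"] r by simp
  show "(\<lambda>n. real (n + 1) * coeff g (n + 1) * r ^ n) sums Re (deriv g (of_real r))"
    using sums_Re [OF *] by (simp only: Re_complex_of_real)
  have "(\<lambda>n. 0) sums Im (deriv g (of_real r))"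
    using sums_Im [OF *] by (simp only: Im_complex_of_real)
  then have "Im (deriv g (of_real r)) = 0" by (simp add: sums_iff)
  then show "deriv g (of_real r) = of_real (Re (deriv g (of_real r)))"
    by (simp add: complex_eq_iff)
qed

lemma norm_deriv_le:
  assumes g: "g \<in> nonneg_symbols" and z: "cmod z < 1"
  shows "cmod (deriv g z) \<le> Re (deriv g (of_real (cmod z)))"
proof -
  have eq: "(\<lambda>n. cmod (of_real (real (n + 1) * coeff g (n + 1)) * z ^ n)) = (\<lambda>n. real (n + 1) * coeff g (n + 1) * cmod z ^ n)"
    using coeff_nonneg [OF g] by (auto simp: norm_mult norm_power simp del: of_real_mult)
  have S: "(\<lambda>n. real (n + 1) * coeff g (n + 1) * cmod z ^ n) sums Re (deriv g (of_real (cmod z)))"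
    by (rule deriv_of_real_sums) (use g z in auto)
  have "cmod (\<Sum>n. of_real (real (n + 1) * coeff g (n + 1)) * z ^ n) \<le> (\<Sum>n. cmod (of_real (real (n + 1) * coeff g (n + 1)) * z ^ n))"
    by (rule summable_norm) (use S eq in \<open>auto simp: sums_iff\<close>)
  then show ?thesis
    unfolding eq using S deriv_sums [OF g z] by (simp only: sums_iff)
qed

lemma M_inf_deriv:
  assumes g: "g \<in> nonneg_symbols" and r: "0 \<le> r" "r < 1"
  shows "M_inf r (deriv g) = Re (deriv g (of_real r))"
  unfolding M_inf_def
proof (rule antisym)
  have le: "cmod (deriv g (of_real r * cis \<theta>)) \<le> Re (deriv g (of_real r))" for \<theta>
    using norm_deriv_le [OF g, of "of_real r * cis \<theta>"] r by (simp add: norm_mult)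
  show "(SUP \<theta>\<in>{0..2 * pi}. cmod (deriv g (of_real r * cis \<theta>))) \<le> Re (deriv g (of_real r))"
    by (rule cSUP_least) (use le in auto)
  have "Re (deriv g (of_real r)) \<le> cmod (deriv g (of_real r * cis 0))"
    using complex_Re_le_cmod by simp
  also have "\<dots> \<le> (SUP \<theta>\<in>{0..2 * pi}. cmod (deriv g (of_real r * cis \<theta>)))"
    by (rule cSUP_upper) (auto intro!: bdd_aboveI2 le)
  finally show "Re (deriv g (of_real r)) \<le> (SUP \<theta>\<in>{0..2 * pi}. cmod (deriv g (of_real r * cis \<theta>)))" .
qed

lemma norm_deriv_le_M_inf:
  assumes "g \<in> nonneg_symbols" "cmod z < 1"
  shows "cmod (deriv g z) \<le> M_inf (cmod z) (deriv g)"
  using norm_deriv_le [OF assms] M_inf_deriv [OF assms(1), of "cmod z"] assms(2) by simp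

lemma weight_nonneg:
  assumes "g \<in> nonneg_symbols" "0 \<le> r" "r < 1"
  shows "0 \<le> weight g r"
proof -
  have "0 \<le> M_inf r (deriv g)"
    using order_trans [OF norm_ge_zero norm_deriv_le_M_inf [OF assms(1), of "of_real r"]] assms(2,3) by simp
  moreover have "0 \<le> 1 - ln (1 - r)" using one_le_one_minus_ln [OF assms(2,3)] by linarith
  ultimately show ?thesis unfolding weight_def by (rule mult_nonneg_nonneg)
qed

lemma continuous_on_weight:
  assumes g: "g \<in> nonneg_symbols"
  shows "continuous_on {0..<1} (weight g)"
proof -
  have "continuous_on unit_disc (deriv g)"
    using nonneg_symbols_holomorphic [OF g] by (auto intro!: holomorphic_on_imp_continuous_on holomorphic_deriv)
  then have "continuous_on {0..<1} (\<lambda>r. deriv g (of_real r))"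
    by (rule continuous_on_compose2) (auto intro!: continuous_intros)
  then have "continuous_on {0..<1} (\<lambda>r. Re (deriv g (of_real r)) * (1 - ln (1 - r)))"
    by (intro continuous_intros) auto
  then show ?thesis
    by (rule continuous_on_cong [THEN iffD1, rotated 2]) (auto simp: weight_def M_inf_deriv g)
qed

lemma M_inf_log_integral_weight:
  "M_inf_log_integral g = (\<integral>\<^sup>+r\<in>{0<..<1}. ennreal (weight g r) \<partial>lborel)"
  unfolding M_inf_log_integral_def
  by (intro nn_integral_cong) (auto simp: indicator_def weight_def ln_div)

text \<open>The primitive below arises from integration by parts, with \<open>r ^ Suc n - 1\<close> as primitive of
  \<open>Suc n * r ^ n\<close> so that the boundary term at \<open>1\<close> vanishes.\<close>

lemma has_integral_power_log:
  "((\<lambda>r. real (Suc n) * r ^ n * (1 - ln \<bar>1 - r\<bar>)) has_integral (1 + harm (Suc n))) {0..1}"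
proof -
  \<comment> \<open>The middle term is \<open>(1 - r ^ Suc n) * ln (1 - r)\<close> with
    \<open>1 - r\<close> split off by the geometric sum, so that it is visibly continuous at 1. The
    last sum integrates the geometric sum and yields the harmonic number at
    \<open>r = 1\<close>.\<close>
  define A where "A r = r ^ Suc n + (\<Sum>k\<le>n. r ^ k) * ((1 - r) * ln \<bar>1 - r\<bar>) + (\<Sum>k\<le>n. r ^ Suc k / real (Suc k))" for r :: real
  have geo: "(1 - r) * (\<Sum>k\<le>n. r ^ k) = 1 - r ^ Suc n" for r :: real
    using one_diff_power_eq [of r "Suc n"] by (simp add: lessThan_Suc_atMost)
  have "((\<lambda>r. real (Suc n) * r ^ n * (1 - ln \<bar>1 - r\<bar>)) has_integral (A 1 - A 0)) {0..1}"
  proof (rule fundamental_theorem_of_calculus_interior)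
    have "continuous_on {0..1::real} (\<lambda>r. (1 - r) * ln \<bar>1 - r\<bar>)"
      by (rule continuous_on_compose2 [OF continuous_on_mult_ln_abs, of _ "\<lambda>r. 1 - r"]) (auto intro!: continuous_intros)
    then show "continuous_on {0..1} A"
      unfolding A_def by (intro continuous_on_add continuous_on_mult [of _ "\<lambda>r. \<Sum>k\<le>n. r ^ k"]) (auto intro!: continuous_intros)
    fix r :: real assume r: "r \<in> {0<..<1}"
    have "((\<lambda>r. r ^ Suc n + (1 - r ^ Suc n) * ln (1 - r) + (\<Sum>k\<le>n. r ^ Suc k / real (Suc k))) has_real_derivative
        real (Suc n) * r ^ n + ((1 - r ^ Suc n) * (- 1 / (1 - r)) + (0 - real (Suc n) * r ^ n) * ln (1 - r)) + (\<Sum>k\<le>n. r ^ k)) (at r)"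
      using r by (auto intro!: derivative_eq_intros simp del: power_Suc of_nat_Suc)
    moreover have *: "(1 - r ^ Suc n) * (- 1 / (1 - r)) = - (\<Sum>k\<le>n. r ^ k)"
      unfolding geo [symmetric] using r by simp
    have "real (Suc n) * r ^ n + ((1 - r ^ Suc n) * (- 1 / (1 - r)) + (0 - real (Suc n) * r ^ n) * ln (1 - r)) + (\<Sum>k\<le>n. r ^ k)
        = real (Suc n) * r ^ n * (1 - ln \<bar>1 - r\<bar>)"
      unfolding * using r by (simp add: right_diff_distrib)
    ultimately have "((\<lambda>r. r ^ Suc n + (1 - r ^ Suc n) * ln (1 - r) + (\<Sum>k\<le>n. r ^ Suc k / real (Suc k))) has_real_derivative
        real (Suc n) * r ^ n * (1 - ln \<bar>1 - r\<bar>)) (at r)"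
      by (simp only:)
    then have "(A has_real_derivative real (Suc n) * r ^ n * (1 - ln \<bar>1 - r\<bar>)) (at r)"
      by (rule has_field_derivative_transform_within_open [where S = "{0<..<1}"])
        (use r in \<open>auto simp: A_def geo [symmetric] simp del: power_Suc\<close>)
    then show "(A has_vector_derivative real (Suc n) * r ^ n * (1 - ln \<bar>1 - r\<bar>)) (at r)"
      by (rule has_real_derivative_iff_has_vector_derivative [THEN iffD1])
  qed simp
  moreover have "A 1 - A 0 = 1 + harm (Suc n)"
  proof -
    have "(\<Sum>k\<le>n. inverse (real (Suc k))) = harm (Suc n)"
      by (simp add: harm_def sum.atLeast1_atMost_eq del: of_nat_Suc flip: lessThan_Suc_atMost)
    then show ?thesis by (simp add: A_def divide_inverse del: of_nat_Suc)
  qed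
  ultimately show ?thesis by simp
qed

lemma harm_Suc_le: "harm (Suc n) \<le> 1 + ln (real (Suc n))"
proof (induction n)
  case (Suc n)
  have "ln (real (Suc n) / real (Suc (Suc n))) \<le> real (Suc n) / real (Suc (Suc n)) - 1"
    by (rule ln_le_minus_one) simp
  also have "\<dots> = - inverse (real (Suc (Suc n)))" by (simp add: field_simps)
  finally show ?case
    using Suc.IH by (simp add: harm_Suc [of "Suc n"] ln_div del: of_nat_Suc)
qed (simp add: harm_Suc harm_expand)

text \<open>The factor 4 arises from \<open>1 + harm (Suc n) \<le> 2 + ln (n + 2)\<close>, where 2
  is at most three times \<open>ln 2\<close> because \<open>ln 2 \<ge> 2/3\<close>.\<close>

lemma harm_bounds:
  "ln (real n + 2) \<le> 1 + harm (Suc n)" "1 + harm (Suc n) \<le> 4 * ln (real n + 2)"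
proof -
  have "ln (real (Suc n) + 1) \<le> harm (Suc n)" by (rule ln_le_harm)
  then show "ln (real n + 2) \<le> 1 + harm (Suc n)" by (simp add: add.commute)
  have "ln 2 \<le> ln (real n + 2)" "ln (real (Suc n)) \<le> ln (real n + 2)" by simp_all
  then show "1 + harm (Suc n) \<le> 4 * ln (real n + 2)"
    using harm_Suc_le [of n] ln2_ge_two_thirds by linarith
qed

text \<open>All terms are nonnegative, so the series may be integrated term by term even when the
  result is infinite.\<close>

lemma M_inf_log_integral_eq:
  assumes g: "g \<in> nonneg_symbols"
  shows "M_inf_log_integral g = (\<Sum>n. ennreal (coeff g (n + 1) * (1 + harm (Suc n))))"
proof -
  define u where "u n r = indicator {0<..<1::real} r * (real (Suc n) * r ^ n * (1 - ln \<bar>1 - r\<bar>))" for n r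
  have [measurable]: "u n \<in> borel_measurable borel" for n unfolding u_def by measurable
  have u_nonneg: "0 \<le> u n r" for n r
  proof (cases "r \<in> {0<..<1}")
    case True
    then have "0 \<le> 1 - ln \<bar>1 - r\<bar>" using order_trans [OF zero_le_one one_le_one_minus_ln [of r]] by simp
    then show ?thesis using True by (simp add: u_def)
  qed (simp add: u_def)
  have "ennreal (weight g r) * indicator {0<..<1} r = (\<Sum>n. ennreal (coeff g (n + 1)) * ennreal (u n r))" for r
  proof (cases "r \<in> {0<..<1}")
    case True
    then have "(\<lambda>n. real (n + 1) * coeff g (n + 1) * r ^ n * (1 - ln (1 - r))) sums weight g r"
      unfolding weight_def using M_inf_deriv [OF g, of r] deriv_of_real_sums(1) [OF g, of r]
      by (intro sums_mult2) auto
    then have "(\<lambda>n. coeff g (n + 1) * u n r) sums weight g r"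
      using True by (simp add: u_def mult_ac)
    then have "(\<Sum>n. ennreal (coeff g (n + 1) * u n r)) = ennreal (weight g r)"
      by (intro suminf_ennreal_eq) (auto intro: mult_nonneg_nonneg coeff_nonneg [OF g] u_nonneg)
    then show ?thesis
      using True by (simp add: ennreal_mult coeff_nonneg [OF g] u_nonneg)
  qed (simp add: u_def)
  then have "M_inf_log_integral g = (\<integral>\<^sup>+r. (\<Sum>n. ennreal (coeff g (n + 1)) * ennreal (u n r)) \<partial>lborel)"
    unfolding M_inf_log_integral_weight by simp
  also have "\<dots> = (\<Sum>n. \<integral>\<^sup>+r. ennreal (coeff g (n + 1)) * ennreal (u n r) \<partial>lborel)"
    by (rule nn_integral_suminf) measurable
  also have "\<dots> = (\<Sum>n. ennreal (coeff g (n + 1)) * (\<integral>\<^sup>+r. ennreal (u n r) \<partial>lborel))"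
    by (intro suminf_cong nn_integral_cmult) measurable
  finally have "M_inf_log_integral g = (\<Sum>n. ennreal (coeff g (n + 1)) * (\<integral>\<^sup>+r. ennreal (u n r) \<partial>lborel))" .
  moreover have "(\<integral>\<^sup>+r. ennreal (u n r) \<partial>lborel) = ennreal (1 + harm (Suc n))" for n
  proof -
    have "0 \<le> real (Suc n) * r ^ n * (1 - ln \<bar>1 - r\<bar>)" if "r \<in> {0<..<1}" for r :: real
      using u_nonneg [of n r] that by (simp add: u_def)
    then have "(\<integral>\<^sup>+r\<in>{0<..<1}. ennreal (real (Suc n) * r ^ n * (1 - ln \<bar>1 - r\<bar>)) \<partial>lborel) = ennreal (1 + harm (Suc n))"
      by (rule nn_integral_has_integral_lebesgue' [OF _ has_integral_power_log [unfolded has_integral_Icc_iff_Ioo]])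
    then show ?thesis
      by (simp add: u_def indicator_mult_ennreal mult.commute del: of_nat_Suc)
  qed
  moreover have "ennreal (coeff g (n + 1)) * ennreal (1 + harm (Suc n)) = ennreal (coeff g (n + 1) * (1 + harm (Suc n)))" for n
    by (rule ennreal_mult [symmetric]) (auto simp: coeff_nonneg [OF g] harm_nonneg add_nonneg_nonneg)
  ultimately show ?thesis by (simp only:)
qed

lemma coeff_log_sum_le_integral:
  assumes g: "g \<in> nonneg_symbols"
  shows "coeff_log_sum g \<le> M_inf_log_integral g"
  unfolding coeff_log_sum_def M_inf_log_integral_eq [OF g]
  by (intro suminf_le summableI ennreal_leI) 
    (auto simp: coeff_def [symmetric] intro!: mult_left_mono harm_bounds coeff_nonneg [OF g])

lemma integral_le_coeff_log_sum:
  assumes g: "g \<in> nonneg_symbols"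
  shows "M_inf_log_integral g \<le> ennreal 4 * coeff_log_sum g"
proof -
  have "M_inf_log_integral g \<le> (\<Sum>n. ennreal 4 * ennreal (Re (maclaurin_coeff g (n + 1)) * ln (real n + 2)))"
    unfolding M_inf_log_integral_eq [OF g]
  proof (intro suminf_le summableI)
    fix n
    have "coeff g (n + 1) * (1 + harm (Suc n)) \<le> coeff g (n + 1) * (4 * ln (real n + 2))"
      by (intro mult_left_mono harm_bounds coeff_nonneg [OF g])
    then show "ennreal (coeff g (n + 1) * (1 + harm (Suc n))) \<le> ennreal 4 * ennreal (Re (maclaurin_coeff g (n + 1)) * ln (real n + 2))"
      by (subst ennreal_mult' [symmetric]) (auto intro!: ennreal_leI simp: coeff_def mult_ac)
  qed
  then show ?thesis
    by (simp add: coeff_log_sum_def ennreal_suminf_cmult)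
qed

subsection \<open>Bounds for the integral operator\<close>

text \<open>Nothing is lost on the radius: \<open>deriv g\<close> is nonnegative there and
  \<open>log_test\<close> is half the logarithmic weight, so the value at \<open>s\<close> equals
  half the integral of \<open>weight g\<close> up to \<open>s\<close>. Monotone convergence lets
  \<open>s\<close> tend to 1.\<close>

lemma T_op_lower_bound:
  assumes g: "g \<in> nonneg_symbols"
  shows "ennreal (1/2) * M_inf_log_integral g \<le> norm_Hinf (T_op g log_test)"
proof -
  define w where "w r = indicator {0..<1} r *\<^sub>R weight g r" for r
  have [measurable]: "w \<in> borel_measurable borel"
    unfolding w_def by (intro borel_measurable_continuous_on_indicator continuous_on_weight g) auto
  have "M_inf_log_integral g = (\<integral>\<^sup>+r. (SUP n. ennreal (w r) * indicator {0..1 - 1 / real (n + 2)} r) \<partial>lborel)"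
    unfolding M_inf_log_integral_weight
  proof (rule nn_integral_cong_AE)
    have "AE r in lborel. r \<noteq> (0::real)" by (rule AE_lborel_singleton)
    then show "AE r in lborel. ennreal (weight g r) * indicator {0<..<1} r = (SUP n. ennreal (w r) * indicator {0..1 - 1 / real (n + 2)} r)"
    proof eventually_elim
      case (elim r)
      show ?case
      proof (cases "r \<in> {0<..<1}")
        case True
        obtain m where m: "inverse (real (Suc m)) < 1 - r" using reals_Archimedean [of "1 - r"] True by auto
        have "1 / real (m + 2) \<le> inverse (real (Suc m))" by (simp add: field_simps)
        then have "r \<in> {0..1 - 1 / real (m + 2)}" using m True by simp
        then have "ennreal (w r) \<le> (SUP n. ennreal (w r) * indicator {0..1 - 1 / real (n + 2)} r)"
          by (intro SUP_upper2 [of m]) auto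
        moreover have "(SUP n. ennreal (w r) * indicator {0..1 - 1 / real (n + 2)} r) \<le> ennreal (w r)"
          by (intro SUP_least) (auto simp: indicator_def)
        ultimately show ?thesis using True by (simp add: w_def)
      next
        case False
        then have "w r = 0" using elim by (auto simp: w_def)
        then show ?thesis using False by simp
      qed
    qed
  qed
  also have "\<dots> = (SUP n. \<integral>\<^sup>+r\<in>{0..1 - 1 / real (n + 2)}. ennreal (w r) \<partial>lborel)"
  proof (rule nn_integral_monotone_convergence_SUP)
    show "incseq (\<lambda>n r. ennreal (w r) * indicator {0..1 - 1 / real (n + 2)} r)"
    proof (intro monoI le_funI mult_left_mono)
      fix m n :: nat and r :: real assume "m \<le> n"
      then have "1 / real (n + 2) \<le> 1 / real (m + 2)" by (simp add: field_simps)
      then show "indicator {0..1 - 1 / real (m + 2)} r \<le> (indicator {0..1 - 1 / real (n + 2)} r :: ennreal)"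
        by (auto simp: indicator_def)
    qed simp
  qed measurable
  also have "ennreal (1/2) * \<dots> = (SUP n. ennreal (1/2) * (\<integral>\<^sup>+r\<in>{0..1 - 1 / real (n + 2)}. ennreal (w r) \<partial>lborel))"
    by (rule SUP_mult_left_ennreal)
  also have "\<dots> \<le> norm_Hinf (T_op g log_test)"
  proof (rule SUP_least)
    fix n
    define s where "s = 1 - 1 / real (n + 2)"
    have s: "0 < s" "s < 1" by (auto simp: s_def)
    have cont: "continuous_on {0..s} (weight g)"
      by (rule continuous_on_subset [OF continuous_on_weight [OF g]]) (use s in auto)
    then have int: "(weight g has_integral integral {0..s} (weight g)) {0..s}"
      by (intro integrable_integral integrable_continuous_interval)
    have nonneg: "0 \<le> integral {0..s} (weight g)"
      by (rule integral_nonneg) (use int s weight_nonneg [OF g] in \<open>auto simp: integrable_on_def\<close>)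
    have "((\<lambda>r. complex_of_real (1/2 * weight g r)) has_integral of_real (1/2 * integral {0..s} (weight g))) {0..s}"
      by (intro has_integral_of_real has_integral_mult_right int)
    then have "((\<lambda>r. log_test (of_real r) * deriv g (of_real r)) has_integral of_real (1/2 * integral {0..s} (weight g))) {0..s}"
    proof (rule has_integral_eq [rotated])
      fix r assume "r \<in> {0..s}"
      then have r: "0 \<le> r" "r < 1" using s by auto
      show "complex_of_real (1/2 * weight g r) = log_test (of_real r) * deriv g (of_real r)"
        by (subst deriv_of_real_sums(2) [OF g r]) (simp add: log_test_of_real r weight_def M_inf_deriv [OF g r])
    qed
    then have "((\<lambda>\<zeta>. log_test \<zeta> * deriv g \<zeta>) has_contour_integral of_real (1/2 * integral {0..s} (weight g))) (linepath 0 (of_real s))"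
      using s by (subst has_contour_integral_linepath_Reals_iff) auto
    then have "T_op g log_test (of_real s) = of_real (1/2 * integral {0..s} (weight g))"
      using s by (simp add: T_op_def contour_integral_unique)
    then have "ennreal (1/2 * integral {0..s} (weight g)) = ennreal (cmod (T_op g log_test (of_real s)))"
      using nonneg by (simp only: norm_of_real) simp
    also have "\<dots> \<le> norm_Hinf (T_op g log_test)"
      unfolding norm_Hinf_def by (rule SUP_upper) (use s in auto)
    finally have "ennreal (1/2 * integral {0..s} (weight g)) \<le> norm_Hinf (T_op g log_test)" .
    moreover have "(\<integral>\<^sup>+r\<in>{0..s}. ennreal (w r) \<partial>lborel) = ennreal (integral {0..s} (weight g))"
    proof -
      have "(\<integral>\<^sup>+r\<in>{0..s}. ennreal (w r) \<partial>lborel) = (\<integral>\<^sup>+r\<in>{0..s}. ennreal (weight g r) \<partial>lborel)"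
        by (intro nn_integral_cong) (use s in \<open>auto simp: w_def indicator_def\<close>)
      also have "\<dots> = ennreal (integral {0..s} (weight g))"
        by (rule nn_integral_has_integral_lebesgue' [OF _ int]) (use s weight_nonneg [OF g] in auto)
      finally show ?thesis .
    qed
    ultimately show "ennreal (1/2) * (\<integral>\<^sup>+r\<in>{0..1 - 1 / real (n + 2)}. ennreal (w r) \<partial>lborel) \<le> norm_Hinf (T_op g log_test)"
      unfolding s_def [symmetric] by (simp only: ennreal_mult' [symmetric] divide_nonneg_nonneg zero_le_one zero_le_numeral)
  qed
  finally show ?thesis .
qed

lemma continuous_on_segment_integrand:
  assumes "g holomorphic_on unit_disc" "H holomorphic_on unit_disc" "cmod z < 1"
  shows "continuous_on (closed_segment 0 z) (\<lambda>\<zeta>. H \<zeta> * deriv g \<zeta>)"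
proof -
  have "closed_segment 0 z \<subseteq> unit_disc"
    using assms(3) by (intro closed_segment_subset) auto
  moreover have "(\<lambda>\<zeta>. H \<zeta> * deriv g \<zeta>) holomorphic_on unit_disc"
    using assms by (intro holomorphic_intros) auto
  ultimately show ?thesis
    using continuous_on_subset holomorphic_on_imp_continuous_on by blast
qed

lemma T_op_in_HD:
  assumes "g holomorphic_on unit_disc" "H holomorphic_on unit_disc"
  shows "T_op g H \<in> HD"
proof -
  have "(\<lambda>\<zeta>. H \<zeta> * deriv g \<zeta>) holomorphic_on unit_disc"
    using assms by (intro holomorphic_intros) auto
  from holomorphic_convex_primitive' [OF convex_ball open_ball this]
  obtain P where P: "\<And>z. z \<in> unit_disc \<Longrightarrow> (P has_field_derivative H z * deriv g z) (at z within unit_disc)"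
    by metis
  have "T_op g H z = P z - P 0" if z: "z \<in> unit_disc" for z
  proof -
    have "closed_segment 0 z \<subseteq> unit_disc"
      using z by (intro closed_segment_subset) auto
    then have "((\<lambda>\<zeta>. H \<zeta> * deriv g \<zeta>) has_contour_integral (P (pathfinish (linepath 0 z)) - P (pathstart (linepath 0 z)))) (linepath 0 z)"
      by (intro contour_integral_primitive [where S = unit_disc] P valid_path_linepath) (simp_all only: path_image_linepath)
    then show ?thesis using z by (simp add: T_op_def contour_integral_unique)
  qed
  moreover have "(\<lambda>z. P z - P 0) holomorphic_on unit_disc"
    unfolding holomorphic_on_def field_differentiable_def
    by (intro ballI exI) (rule DERIV_diff [OF P DERIV_const])
  ultimately have "T_op g H holomorphic_on unit_disc"
    by (metis (no_types, lifting) holomorphic_cong)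
  then show ?thesis by (simp add: HD_def T_op_def)
qed

text \<open>The radial profile \<open>k\<close> allows two uses: constant, it gives the norm
  estimate; as a step function, small inside a disc and bounded outside, it gives
  compactness.\<close>

lemma T_op_upper_bound:
  assumes g: "g \<in> nonneg_symbols" and H: "H holomorphic_on unit_disc"
    and k [measurable]: "k \<in> borel_measurable borel" and k_nonneg: "\<And>r. 0 \<le> k r"
    and bd: "\<And>z. cmod z < 1 \<Longrightarrow> cmod (H z) \<le> k (cmod z) * (1 - ln (1 - cmod z))"
  shows "norm_Hinf (T_op g H) \<le> (\<integral>\<^sup>+r\<in>{0<..<1}. ennreal (k r * weight g r) \<partial>lborel)"
  unfolding norm_Hinf_def
proof (rule SUP_least)
  fix z assume "z \<in> unit_disc"
  then have z: "cmod z < 1" by simp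
  define r where "r = cmod z"
  define w where "w s = indicator {0..<1} s *\<^sub>R weight g s" for s
  have [measurable]: "w \<in> borel_measurable borel"
    unfolding w_def by (intro borel_measurable_continuous_on_indicator continuous_on_weight g) auto
  define \<phi> where "\<phi> t = H (of_real t * z) * deriv g (of_real t * z) * z" for t :: real
  show "ennreal (cmod (T_op g H z)) \<le> (\<integral>\<^sup>+r\<in>{0<..<1}. ennreal (k r * weight g r) \<partial>lborel)"
  proof (cases "z = 0")
    case True
    then show ?thesis by (simp add: T_op_def)
  next
    case False
    then have r: "0 < r" "r < 1" using z by (auto simp: r_def)
    have "continuous_on (closed_segment 0 z) (\<lambda>\<zeta>. H \<zeta> * deriv g \<zeta>)"
      by (rule continuous_on_segment_integrand [OF nonneg_symbols_holomorphic [OF g] H z])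
    then have "continuous_on {0..1} (\<lambda>t. H (linepath 0 z t) * deriv g (linepath 0 z t))"
      by (rule continuous_on_compose2 [OF _ continuous_on_linepath]) (simp only: linepath_image_01 order_refl)
    then have cont: "continuous_on {0..1} \<phi>"
      unfolding \<phi>_def by (intro continuous_on_mult [OF _ continuous_on_const]) (simp add: linepath_def scaleR_conv_of_real)
    have "T_op g H z = integral {0..1} \<phi>"
      using z by (simp add: T_op_def contour_integral_integral \<phi>_def [abs_def] linepath_def scaleR_conv_of_real)
    then have "cmod (T_op g H z) \<le> integral {0..1} (\<lambda>t. cmod (\<phi> t))"
      by (simp, intro integral_norm_bound_integral integrable_continuous_interval continuous_intros cont) auto
    then have "ennreal (cmod (T_op g H z)) \<le> ennreal (integral {0..1} (\<lambda>t. cmod (\<phi> t)))"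
      by (rule ennreal_leI)
    also have "\<dots> = (\<integral>\<^sup>+t\<in>{0..1}. ennreal (cmod (\<phi> t)) \<partial>lborel)"
      by (rule nn_integral_has_integral_lebesgue' [symmetric])
        (auto intro!: integrable_integral integrable_continuous_interval continuous_intros cont)
    \<comment> \<open>The integrand is put into the shape required by the affine substitution
      \<open>s = 0 + r * t\<close>, which turns the parameter of the segment into the
      modulus.\<close>
    also have "\<dots> \<le> (\<integral>\<^sup>+t. ennreal r * (ennreal (k (0 + r * t) * w (0 + r * t)) * indicator {0..r} (0 + r * t)) \<partial>lborel)"
    proof (rule nn_integral_mono)
      fix t
      have "cmod (\<phi> t) \<le> r * (k (r * t) * w (r * t))" if t: "t \<in> {0..1}"
      proof -
        have tz: "cmod (of_real t * z) = r * t" using t by (simp add: norm_mult r_def)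
        have "r * t \<le> r" using t r by (simp add: mult_left_le)
        then have "r * t < 1" using r(2) by (rule le_less_trans)
        moreover have "0 \<le> r * t" using r t by simp
        ultimately have rt: "0 \<le> r * t" "r * t < 1" by simp_all
        have "cmod (\<phi> t) = cmod (H (of_real t * z)) * cmod (deriv g (of_real t * z)) * r"
          by (simp add: \<phi>_def norm_mult r_def)
        also have "\<dots> \<le> (k (r * t) * (1 - ln (1 - r * t))) * M_inf (r * t) (deriv g) * r"
          using bd [of "of_real t * z"] norm_deriv_le_M_inf [OF g, of "of_real t * z"] rt r k_nonneg [of "r * t"]
            order_trans [OF zero_le_one one_le_one_minus_ln [OF rt]]
          unfolding tz by (intro mult_right_mono mult_mono mult_nonneg_nonneg) auto
        finally show ?thesis using rt by (simp add: w_def weight_def mult_ac)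
      qed
      moreover have "t \<in> {0..1} \<Longrightarrow> 0 + r * t \<in> {0..r}" using r by (auto simp: mult_left_le)
      ultimately show "ennreal (cmod (\<phi> t)) * indicator {0..1} t \<le> ennreal r * (ennreal (k (0 + r * t) * w (0 + r * t)) * indicator {0..r} (0 + r * t))"
        using r by (auto simp: indicator_def ennreal_mult' [symmetric] intro!: ennreal_leI)
    qed
    also have "\<dots> = ennreal \<bar>r\<bar> * (\<integral>\<^sup>+t. (ennreal (k (0 + r * t) * w (0 + r * t)) * indicator {0..r} (0 + r * t)) \<partial>lborel)"
      using r by (subst nn_integral_cmult) auto
    also have "\<dots> = (\<integral>\<^sup>+s. (ennreal (k s * w s) * indicator {0..r} s) \<partial>lborel)"
      by (rule nn_integral_real_affine [symmetric]) (use r in auto)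
    also have "\<dots> \<le> (\<integral>\<^sup>+s\<in>{0<..<1}. ennreal (k s * weight g s) \<partial>lborel)"
    proof (rule nn_integral_mono_AE)
      have "AE s in lborel. s \<noteq> (0::real)" by (rule AE_lborel_singleton)
      then show "AE s in lborel. ennreal (k s * w s) * indicator {0..r} s \<le> ennreal (k s * weight g s) * indicator {0<..<1} s"
        by eventually_elim (use r in \<open>auto simp: indicator_def w_def\<close>)
    qed
    finally show ?thesis .
  qed
qed

lemma borel_measurable_weight:
  assumes "g \<in> nonneg_symbols" "A \<in> sets borel" "A \<subseteq> {0..<1}"
  shows "(\<lambda>r. ennreal (weight g r) * indicator A r) \<in> borel_measurable lborel"
proof -
  have "(\<lambda>r. ennreal (indicator A r *\<^sub>R weight g r)) \<in> borel_measurable lborel"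
    unfolding measurable_lborel2
    by (intro measurable_compose [OF _ measurable_ennreal] borel_measurable_continuous_on_indicator
        continuous_on_subset [OF continuous_on_weight [OF assms(1)]] assms)
  also have "(\<lambda>r. ennreal (indicator A r *\<^sub>R weight g r)) = (\<lambda>r. ennreal (weight g r) * indicator A r)"
    by (auto simp: indicator_def)
  finally show ?thesis .
qed

lemma Hlog_bound:
  assumes "norm_Hlog f \<le> ennreal M" "0 \<le> M" "cmod z < 1"
  shows "cmod (f z) \<le> M * (1 - ln (1 - cmod z))"
proof -
  have L: "ln (exp 1 / (1 - cmod z)) = 1 - ln (1 - cmod z)" "1 \<le> 1 - ln (1 - cmod z)"
    using assms(3) one_le_one_minus_ln [of "cmod z"] by (simp_all add: ln_div)
  have "ennreal (cmod (f z) * inverse (ln (exp 1 / (1 - cmod z)))) \<le> norm_Hlog f"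
    unfolding norm_Hlog_def by (rule SUP_upper) (use assms in auto)
  also note assms(1)
  finally have "cmod (f z) * inverse (1 - ln (1 - cmod z)) \<le> M"
    using assms(2) unfolding L by simp
  then show ?thesis using L(2) by (simp add: field_simps)
qed

lemma norm_T_op_le:
  assumes g: "g \<in> nonneg_symbols" and f: "f \<in> HD" and fin: "norm_Hlog f < \<infinity>"
  shows "norm_Hinf (T_op g f) \<le> norm_Hlog f * M_inf_log_integral g"
proof -
  define M where "M = enn2real (norm_Hlog f)"
  have M: "norm_Hlog f = ennreal M" "0 \<le> M" using fin by (auto simp: M_def)
  have "norm_Hinf (T_op g f) \<le> (\<integral>\<^sup>+r\<in>{0<..<1}. ennreal (M * weight g r) \<partial>lborel)"
    using f M by (intro T_op_upper_bound [OF g]) (auto simp: HD_def intro!: Hlog_bound)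
  also have "\<dots> = (\<integral>\<^sup>+r. ennreal M * (ennreal (weight g r) * indicator {0<..<1} r) \<partial>lborel)"
    using M by (intro nn_integral_cong) (auto simp: ennreal_mult' mult.assoc)
  also have "\<dots> = ennreal M * M_inf_log_integral g"
    unfolding M_inf_log_integral_weight
    by (intro nn_integral_cmult borel_measurable_weight g) auto
  finally show ?thesis by (simp add: M)
qed

subsection \<open>Banach spaces of analytic functions\<close>

text \<open>The two vectors on the right differ by \<open>2 * y\<close>, so they cannot both be
  shorter than \<open>y\<close>. This decides the sign of each step in the uniform boundedness
  argument.\<close>

lemma norm_le_norm_add_or_diff:
  fixes x y :: complex
  shows "cmod y \<le> cmod (x + y) \<or> cmod y \<le> cmod (x - y)"
proof (rule ccontr)
  assume "\<not> ?thesis"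
  then have "cmod ((x + y) - (x - y)) < 2 * cmod y"
    using norm_triangle_ineq4 [of "x + y" "x - y"] by linarith
  then show False by (simp add: norm_mult flip: mult_2)
qed

locale banach_in_HD =
  fixes X :: "(complex \<Rightarrow> complex) set" and N :: "(complex \<Rightarrow> complex) \<Rightarrow> real"
  assumes banach: "banach_space_in_HD X N"
begin

lemmas banach_conjs = banach [unfolded banach_space_in_HD_def]

lemmas zero_in = banach_conjs [THEN conjunct2, THEN conjunct1]
lemmas add_in = banach_conjs [THEN conjunct2, THEN conjunct2, THEN conjunct1, rule_format]
lemmas scale_in = banach_conjs [THEN conjunct2, THEN conjunct2, THEN conjunct2, THEN conjunct1, rule_format]
lemmas N_nonneg_eq = banach_conjs [THEN conjunct2, THEN conjunct2, THEN conjunct2, THEN conjunct2, THEN conjunct1, rule_format]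
lemmas N_scale = banach_conjs [THEN conjunct2, THEN conjunct2, THEN conjunct2, THEN conjunct2, THEN conjunct2, THEN conjunct1, rule_format]
lemmas N_add = banach_conjs [THEN conjunct2, THEN conjunct2, THEN conjunct2, THEN conjunct2, THEN conjunct2, THEN conjunct2, THEN conjunct1, rule_format]
lemmas complete = banach_conjs [THEN conjunct2, THEN conjunct2, THEN conjunct2, THEN conjunct2, THEN conjunct2, THEN conjunct2, THEN conjunct2, THEN conjunct1, rule_format]
lemmas eval_bound = banach_conjs [THEN conjunct2, THEN conjunct2, THEN conjunct2, THEN conjunct2, THEN conjunct2, THEN conjunct2, THEN conjunct2, THEN conjunct2, rule_format]

lemma N_nonneg: "f \<in> X \<Longrightarrow> 0 \<le> N f"
  and N_eq_0: "f \<in> X \<Longrightarrow> N f = 0 \<longleftrightarrow> f = (\<lambda>_. 0)"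
  by (simp_all add: N_nonneg_eq)

lemma diff_in:
  assumes "f \<in> X" "h \<in> X" shows "(\<lambda>z. f z - h z) \<in> X"
  using add_in [OF assms(1) scale_in [OF assms(2), of "-1"]] by simp

lemma N_diff_commute:
  assumes "f \<in> X" "h \<in> X" shows "N (\<lambda>z. f z - h z) = N (\<lambda>z. h z - f z)"
  using N_scale [OF diff_in [OF assms], of "-1"] by simp

lemma N_diff_triangle:
  assumes "f \<in> X" "h \<in> X" "k \<in> X" shows "N (\<lambda>z. f z - k z) \<le> N (\<lambda>z. f z - h z) + N (\<lambda>z. h z - k z)"
  using N_add [OF diff_in [OF assms(1,2)] diff_in [OF assms(2,3)]] by simp

text \<open>The uniform boundedness principle, by Sokal's argument: a sequence of steps of size \<open>3\<^sup>-\<^sup>n\<close>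
  with suitably chosen signs converges to a point at which the functionals are unbounded.\<close>

lemma uniform_boundedness:
  fixes L :: "complex \<Rightarrow> real"
  assumes L: "\<And>z. z \<in> unit_disc \<Longrightarrow> 0 < L z"
    and pw: "\<And>f. f \<in> X \<Longrightarrow> \<exists>M. \<forall>z\<in>unit_disc. cmod (f z) \<le> M * L z"
  shows "\<exists>C\<ge>0. \<forall>f\<in>X. \<forall>z\<in>unit_disc. cmod (f z) \<le> C * N f * L z"
proof (rule ccontr)
  assume no: "\<not> ?thesis"
  \<comment> \<open>\<open>S z\<close> is the norm of the functional that sends \<open>f\<close> to
    \<open>f z / L z\<close>; it is finite by the continuity of point evaluations on
    \<open>X\<close>.\<close>
  define P where "P z = {cmod (f z) / L z | f. f \<in> X \<and> N f \<le> 1}" for z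
  define S where "S z = Sup (P z)" for z
  have bdd: "bdd_above (P z)" if z: "z \<in> unit_disc" for z
  proof -
    obtain C where C: "\<And>f. f \<in> X \<Longrightarrow> cmod (f z) \<le> C * N f"
      using eval_bound [of "{z}"] z by auto
    have "cmod (f z) / L z \<le> \<bar>C\<bar> / L z" if "f \<in> X" "N f \<le> 1" for f
    proof (rule divide_right_mono)
      have "C * N f \<le> \<bar>C\<bar> * 1" using that N_nonneg by (intro mult_mono) auto
      then show "cmod (f z) \<le> \<bar>C\<bar>" using C [OF that(1)] by linarith
    qed (use L [OF z] in simp)
    then show ?thesis unfolding P_def by (intro bdd_aboveI [of _ "\<bar>C\<bar> / L z"]) blast
  qed
  have N0: "N (\<lambda>_. 0) = 0" using N_eq_0 [OF zero_in] by simp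
  have P_ne: "0 \<in> P z" for z
    unfolding P_def using zero_in N0 by force
  have S_nonneg: "0 \<le> S z" if "z \<in> unit_disc" for z
    unfolding S_def by (rule cSup_upper [OF P_ne bdd [OF that]])
  have S_bound: "cmod (f z) \<le> S z * N f * L z" if "f \<in> X" "z \<in> unit_disc" for f z
  proof (cases "N f = 0")
    case True
    then show ?thesis using N_eq_0 [OF that(1)] by simp
  next
    case False
    then have Nf: "0 < N f" using N_nonneg [OF that(1)] by simp
    define h where "h z = of_real (1 / N f) * f z" for z
    have "h \<in> X" "N h = 1"
      using scale_in [OF that(1), of "of_real (1 / N f)"] N_scale [OF that(1), of "of_real (1 / N f)"] Nf
      unfolding h_def by (auto simp: norm_divide)
    then have "cmod (h z) / L z \<in> P z" unfolding P_def by auto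
    then have "cmod (h z) / L z \<le> S z" unfolding S_def by (rule cSup_upper [OF _ bdd [OF that(2)]])
    moreover have "cmod (h z) = cmod (f z) / N f"
      using Nf by (simp add: h_def norm_mult norm_divide)
    ultimately show ?thesis using Nf L [OF that(2)] by (simp add: field_simps)
  qed
  \<comment> \<open>If the claim fails for the constant \<open>4 ^ n\<close>, some evaluation has
    norm above it, and an element of the unit ball attains that norm up to the factor 2/3.\<close>
  have "\<exists>z\<in>unit_disc. \<exists>u\<in>X. N u \<le> 1 \<and> 4 ^ n \<le> S z \<and> 2/3 * S z * L z \<le> cmod (u z)" for n :: nat
  proof -
    obtain z where z: "z \<in> unit_disc" "4 ^ n < S z"
    proof -
      have "\<exists>f\<in>X. \<exists>z\<in>unit_disc. \<not> cmod (f z) \<le> 4 ^ n * N f * L z"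
        using no by (metis zero_le_numeral zero_le_power)
      then obtain f z where fz: "f \<in> X" "z \<in> unit_disc" "4 ^ n * (N f * L z) < cmod (f z)"
        by (auto simp: not_le mult.assoc)
      have "cmod (f z) \<le> S z * (N f * L z)" using S_bound [OF fz(1,2)] by (simp add: mult.assoc)
      with fz(3) have "4 ^ n * (N f * L z) < S z * (N f * L z)" by (rule less_le_trans)
      moreover have "0 \<le> N f * L z" using N_nonneg [OF fz(1)] L [OF fz(2)] by simp
      ultimately have "4 ^ n < S z" by (rule mult_right_less_imp_less)
      then show ?thesis using that fz(2) by blast
    qed
    have Spos: "0 < S z" using z(2) by (rule less_trans [rotated]) simp
    then have "2/3 * S z < Sup (P z)" by (simp add: S_def)
    then obtain y where "y \<in> P z" "2/3 * S z < y"
      using less_cSup_iff [of "P z"] P_ne [of z] bdd [OF z(1)] by (metis empty_iff)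
    then obtain u where "u \<in> X" "N u \<le> 1" "2/3 * S z < cmod (u z) / L z" by (auto simp: P_def)
    then show ?thesis using z L [OF z(1)] by (intro bexI [of _ z] bexI [of _ u]) (auto simp: field_simps)
  qed
  then obtain zz u where zz: "\<And>n. zz n \<in> unit_disc" and u: "\<And>n. u n \<in> X" "\<And>n. N (u n) \<le> 1"
    and S4: "\<And>n::nat. 4 ^ n \<le> S (zz n)" and near: "\<And>n. 2/3 * S (zz n) * L (zz n) \<le> cmod (u n (zz n))"
    by metis
  \<comment> \<open>The sign is chosen so that the new point is at least as large at
    \<open>zz n\<close> as the step itself, whatever has been accumulated before.\<close>
  define x where "x = rec_nat (\<lambda>_. 0) (\<lambda>n v. let y = (\<lambda>z. of_real ((1/3) ^ n) * u n z) in
    if cmod (y (zz n)) \<le> cmod (v (zz n) + y (zz n)) then (\<lambda>z. v z + y z) else (\<lambda>z. v z - y z))"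
  have step_cases: "(x (Suc n) = (\<lambda>z. x n z + of_real ((1/3) ^ n) * u n z) \<or> x (Suc n) = (\<lambda>z. x n z - of_real ((1/3) ^ n) * u n z))
      \<and> cmod (of_real ((1/3) ^ n) * u n (zz n)) \<le> cmod (x (Suc n) (zz n))" for n
    using norm_le_norm_add_or_diff [of "of_real ((1/3) ^ n) * u n (zz n)" "x n (zz n)"]
    by (auto simp: x_def Let_def)
  have yX: "(\<lambda>z. of_real ((1/3) ^ n) * u n z) \<in> X" for n by (rule scale_in [OF u(1)])
  have xX: "x n \<in> X" for n
  proof (induction n)
    case 0 show ?case by (simp add: x_def zero_in)
  next
    case (Suc n)
    then show ?case
      using step_cases [of n] add_in [OF Suc yX [of n]] diff_in [OF Suc yX [of n]] by auto
  qed
  have Ny: "N (\<lambda>z. of_real ((1/3) ^ n) * u n z) \<le> (1/3) ^ n" for n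
    using N_scale [OF u(1), of "of_real ((1/3) ^ n)" n] u(2) [of n]
    by (simp add: norm_power mult_left_le del: of_real_power)
  have step: "N (\<lambda>z. x (Suc n) z - x n z) \<le> (1/3) ^ n" for n
    using step_cases [of n] Ny [of n] N_scale [OF yX [of n], of "-1"] by (auto simp: fun_eq_iff)
  \<comment> \<open>The bound is the exact value of the geometric sum of the step sizes from
    \<open>n\<close> to \<open>n + k - 1\<close>.\<close>
  have dist: "N (\<lambda>z. x (n + k) z - x n z) \<le> 3/2 * (1/3) ^ n - 3/2 * (1/3) ^ (n + k)" for n k
  proof (induction k)
    case 0 show ?case by (simp add: N0)
  next
    case (Suc k)
    have "N (\<lambda>z. x (n + Suc k) z - x n z) \<le> N (\<lambda>z. x (Suc (n + k)) z - x (n + k) z) + N (\<lambda>z. x (n + k) z - x n z)"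
      using N_diff_triangle [OF xX xX xX] by simp
    then show ?case using step [of "n + k"] Suc by simp
  qed
  have dist': "N (\<lambda>z. x m z - x n z) \<le> 3/2 * (1/3) ^ n" if "n \<le> m" for m n
  proof -
    have "N (\<lambda>z. x m z - x n z) \<le> 3/2 * (1/3) ^ n - 3/2 * (1/3) ^ m"
      using dist [of n "m - n"] that by simp
    moreover have "0 \<le> (1/3::real) ^ m" by simp
    ultimately show ?thesis by linarith
  qed
  obtain f where f: "f \<in> X" "(\<lambda>n. N (\<lambda>z. x n z - f z)) \<longlonglongrightarrow> 0"
  proof -
    have "\<exists>n0. \<forall>m\<ge>n0. \<forall>n\<ge>n0. N (\<lambda>z. x m z - x n z) < e" if e: "0 < e" for e
    proof -
      obtain n0 where n0: "(1/3) ^ n0 < e / 3"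
        using real_arch_pow_inv [of "e / 3" "1/3"] e by auto
      have "N (\<lambda>z. x m z - x n z) < e" if "n0 \<le> m" "n0 \<le> n" for m n
        using N_diff_triangle [OF xX [of m] xX [of n0] xX [of n]] N_diff_commute [OF xX [of n] xX [of n0]]
          dist' [OF that(1)] dist' [OF that(2)] n0 by simp
      then show ?thesis by blast
    qed
    then show ?thesis using complete [of x] xX that by blast
  qed
  \<comment> \<open>The tail after step \<open>n\<close> sums to \<open>3/2 * (1/3) ^ Suc n\<close>,
    which is only half of the step size \<open>(1/3) ^ n\<close>.\<close>
  have lim: "N (\<lambda>z. x (Suc n) z - f z) \<le> 1/2 * (1/3) ^ n" for n
  proof (rule LIMSEQ_le_const)
    show "(\<lambda>m. 3/2 * (1/3) ^ Suc n + N (\<lambda>z. x m z - f z)) \<longlonglongrightarrow> 1/2 * (1/3) ^ n"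
      using tendsto_add [OF tendsto_const f(2), of "3/2 * (1/3) ^ Suc n"] by simp
    show "\<exists>n0. \<forall>m\<ge>n0. N (\<lambda>z. x (Suc n) z - f z) \<le> 3/2 * (1/3) ^ Suc n + N (\<lambda>z. x m z - f z)"
    proof (intro exI [of _ "Suc n"] allI impI)
      fix m assume "Suc n \<le> m"
      then show "N (\<lambda>z. x (Suc n) z - f z) \<le> 3/2 * (1/3) ^ Suc n + N (\<lambda>z. x m z - f z)"
        using N_diff_triangle [OF xX [of "Suc n"] xX [of m] f(1)] N_diff_commute [OF xX xX] dist' [of "Suc n" m] by simp
    qed
  qed
  obtain M where M: "\<And>z. z \<in> unit_disc \<Longrightarrow> cmod (f z) \<le> M * L z"
    using pw [OF f(1)] by blast
  \<comment> \<open>At \<open>zz n\<close> the step contributes at least 2/3 and later steps take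
    away at most 1/2 of \<open>S (zz n) * (1/3) ^ n\<close>. The difference 1/6 remains, and
    \<open>4 ^ n * (1/3) ^ n\<close> is unbounded.\<close>
  have M_ge: "1/6 * (4/3) ^ n \<le> M" for n
  proof -
    define z s where "z = zz n" and "s = S z * (1/3) ^ n"
    have z: "z \<in> unit_disc" and Lz: "0 < L z" using zz L by (auto simp: z_def)
    have "2/3 * s * L z \<le> (1/3) ^ n * cmod (u n z)"
      using mult_left_mono [OF near [of n], of "(1/3) ^ n"] by (simp add: z_def s_def mult_ac)
    also have "\<dots> \<le> cmod (x (Suc n) z)"
      using step_cases [of n] by (simp add: z_def norm_mult norm_power)
    also have "\<dots> \<le> cmod (x (Suc n) z - f z) + cmod (f z)"
      by (metis diff_add_cancel norm_triangle_ineq)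
    also have "cmod (x (Suc n) z - f z) \<le> S z * N (\<lambda>z. x (Suc n) z - f z) * L z"
      by (rule S_bound [OF diff_in [OF xX f(1)] z])
    also have "\<dots> \<le> S z * (1/2 * (1/3) ^ n) * L z"
      using S_nonneg [OF z] Lz by (intro mult_right_mono mult_left_mono lim) auto
    also have "\<dots> = 1/2 * s * L z" by (simp add: s_def)
    finally have "2/3 * s * L z \<le> 1/2 * s * L z + M * L z" using M [OF z] by linarith
    then have "(1/6 * s) * L z \<le> M * L z" by (simp add: algebra_simps)
    then have "1/6 * s \<le> M" using Lz by (simp only: mult_le_cancel_right_pos)
    moreover have "(4/3) ^ n \<le> s"
      using mult_right_mono [OF S4 [of n], of "(1/3) ^ n"] by (simp add: s_def z_def power_divide)
    ultimately show ?thesis by simp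
  qed
  obtain n where "6 * M < (4/3::real) ^ n"
    using real_arch_pow [of "4/3" "6 * M"] by auto
  then show False using M_ge [of n] by simp
qed

text \<open>An inclusion of sets is upgraded to a norm inequality: each \<open>f\<close> in
  \<open>X\<close> is bounded by a multiple of the logarithmic weight, and uniform boundedness makes
  the multiple proportional to \<open>N f\<close>.\<close>

lemma norm_Hlog_le_N:
  assumes "X \<subseteq> Hlog"
  shows "\<exists>C\<ge>0. \<forall>f\<in>X. norm_Hlog f \<le> ennreal C * ennreal (N f)"
proof -
  have "\<exists>C\<ge>0. \<forall>f\<in>X. \<forall>z\<in>unit_disc. cmod (f z) \<le> C * N f * (1 - ln (1 - cmod z))"
  proof (rule uniform_boundedness)
    show "0 < 1 - ln (1 - cmod z)" if "z \<in> unit_disc" for z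
      using less_le_trans [OF zero_less_one one_le_one_minus_ln [of "cmod z"]] that by simp
    fix f assume "f \<in> X"
    then have "norm_Hlog f < \<infinity>" using assms by (auto simp: Hlog_def)
    then have "norm_Hlog f \<le> ennreal (enn2real (norm_Hlog f))" by simp
    then show "\<exists>M. \<forall>z\<in>unit_disc. cmod (f z) \<le> M * (1 - ln (1 - cmod z))"
      using Hlog_bound by (intro exI [of _ "enn2real (norm_Hlog f)"]) auto
  qed
  then obtain C where C: "0 \<le> C" "\<And>f z. f \<in> X \<Longrightarrow> z \<in> unit_disc \<Longrightarrow> cmod (f z) \<le> C * N f * (1 - ln (1 - cmod z))"
    by blast
  have "norm_Hlog f \<le> ennreal C * ennreal (N f)" if "f \<in> X" for f
  proof (rule norm_Hlog_le)
    fix z :: complex assume z: "cmod z < 1"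
    have "ennreal (cmod (f z)) \<le> ennreal (C * N f * (1 - ln (1 - cmod z)))"
      using C(2) [OF that, of z] z by (intro ennreal_leI) auto
    also have "\<dots> = ennreal C * ennreal (N f) * ennreal (1 - ln (1 - cmod z))"
      using C(1) N_nonneg [OF that] order_trans [OF zero_le_one one_le_one_minus_ln [OF norm_ge_zero z]]
      by (simp add: ennreal_mult)
    finally show "ennreal (cmod (f z)) \<le> ennreal C * ennreal (N f) * ennreal (1 - ln (1 - cmod z))" .
  qed
  then show ?thesis using C(1) by blast
qed

end

subsection \<open>Compactness and comparison\<close>

text \<open>Dominated convergence with the whole integrand as majorant; this is how finiteness of
  the integral leads to compactness.\<close>

lemma weight_tail:
  assumes g: "g \<in> nonneg_symbols" and fin: "M_inf_log_integral g < \<infinity>" and "0 < e"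
  obtains \<rho> where "0 < \<rho>" "\<rho> < 1" "(\<integral>\<^sup>+r\<in>{\<rho><..<1}. ennreal (weight g r) \<partial>lborel) \<le> ennreal e"
proof -
  define w where "w s = indicator {0<..<1} s *\<^sub>R weight g s" for s
  have [measurable]: "w \<in> borel_measurable borel"
    unfolding w_def by (intro borel_measurable_continuous_on_indicator continuous_on_subset [OF continuous_on_weight [OF g]]) auto
  have int: "(\<integral>\<^sup>+r. ennreal (w r) \<partial>lborel) = M_inf_log_integral g"
    unfolding M_inf_log_integral_weight by (intro nn_integral_cong) (auto simp: w_def indicator_def)
  define \<rho> where "\<rho> n = 1 - 1 / real (n + 2)" for n :: nat
  have "(\<lambda>n. \<integral>\<^sup>+r. ennreal (w r) * indicator {\<rho> n<..<1} r \<partial>lborel) \<longlonglongrightarrow> (\<integral>\<^sup>+r. 0 \<partial>(lborel :: real measure))"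
  proof (rule nn_integral_dominated_convergence [where w = "\<lambda>r. ennreal (w r)"])
    show "AE r in lborel. (\<lambda>n. ennreal (w r) * indicator {\<rho> n<..<1} r) \<longlonglongrightarrow> 0"
    proof (rule AE_I2)
      fix r :: real
      have "\<rho> \<longlonglongrightarrow> 1 - 0"
        unfolding \<rho>_def by (intro tendsto_intros LIMSEQ_ignore_initial_segment lim_1_over_n)
      then have "\<forall>\<^sub>F n in sequentially. \<not> (\<rho> n < r \<and> r < 1)"
        by (cases "r < 1") (auto dest!: order_tendstoD(1) [of _ _ _ r] elim: eventually_mono)
      then have "\<forall>\<^sub>F n in sequentially. ennreal (w r) * indicator {\<rho> n<..<1} r = 0"
        by eventually_elim auto
      then show "(\<lambda>n. ennreal (w r) * indicator {\<rho> n<..<1} r) \<longlonglongrightarrow> 0"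
        by (rule tendsto_eventually)
    qed
    show "AE r in lborel. ennreal (w r) * indicator {\<rho> n<..<1} r \<le> ennreal (w r)" for n
      by (auto simp: indicator_def)
    show "(\<integral>\<^sup>+r. ennreal (w r) \<partial>lborel) < \<infinity>" using fin int by simp
  qed measurable
  then have "\<forall>\<^sub>F n in sequentially. (\<integral>\<^sup>+r. ennreal (w r) * indicator {\<rho> n<..<1} r \<partial>lborel) < ennreal e"
    using \<open>0 < e\<close> by (intro order_tendstoD(2)) auto
  then obtain n where n: "(\<integral>\<^sup>+r. ennreal (w r) * indicator {\<rho> n<..<1} r \<partial>lborel) < ennreal e"
    by (auto simp: eventually_sequentially)
  have \<rho>: "0 < \<rho> n" "\<rho> n < 1" by (auto simp: \<rho>_def)
  have "(\<integral>\<^sup>+r\<in>{\<rho> n<..<1}. ennreal (weight g r) \<partial>lborel) = (\<integral>\<^sup>+r. ennreal (w r) * indicator {\<rho> n<..<1} r \<partial>lborel)"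
    by (intro nn_integral_cong) (use \<rho> in \<open>auto simp: w_def indicator_def\<close>)
  then show ?thesis using that [OF \<rho>] n by simp
qed

lemma T_op_diff:
  assumes "g holomorphic_on unit_disc" "f \<in> HD" "h \<in> HD"
  shows "T_op g f z - T_op g h z = T_op g (\<lambda>z. f z - h z) z"
proof (cases "cmod z < 1")
  case True
  then show ?thesis
    using assms contour_integral_diff [OF contour_integrable_continuous_linepath contour_integrable_continuous_linepath,
        OF continuous_on_segment_integrand [OF assms(1) _ True] continuous_on_segment_integrand [OF assms(1) _ True], of f h]
    by (simp add: T_op_def HD_def left_diff_distrib)
qed (simp add: T_op_def)

text \<open>Near the boundary the tail of the weighted integral is small uniformly on bounded sets of
  \<^const>\<open>Hlog\<close>; on a smaller disc, locally uniform convergence suffices.\<close>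

lemma T_op_compact:
  assumes g: "g \<in> nonneg_symbols" and fin: "M_inf_log_integral g < \<infinity>"
    and F: "\<And>n. F n \<in> HD" and M: "\<And>n. norm_Hlog (F n) \<le> ennreal M"
  shows "\<exists>h\<in>Hinf. \<exists>k. strict_mono (k :: nat \<Rightarrow> nat) \<and> (\<lambda>n. norm_Hinf (\<lambda>z. T_op g (F (k n)) z - h z)) \<longlonglongrightarrow> 0"
proof -
  \<comment> \<open>\<open>M\<close> may be negative, in which case \<open>ennreal M\<close> is 0;
    real estimates need a nonnegative constant.\<close>
  define M' where "M' = max M 0"
  have M': "0 \<le> M'" "norm_Hlog (F n) \<le> ennreal M'" for n
  proof -
    have "M \<le> M'" by (simp add: M'_def)
    then show "norm_Hlog (F n) \<le> ennreal M'" using order_trans [OF M ennreal_leI] by blast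
  qed (simp add: M'_def)
  have gh: "g holomorphic_on unit_disc" by (rule nonneg_symbols_holomorphic [OF g])
  have Fb: "cmod (F n z) \<le> M' * (1 - ln (1 - cmod z))" if "cmod z < 1" for n z
    by (rule Hlog_bound [OF M'(2,1) that])
  \<comment> \<open>The logarithmic growth bound is continuous on the disc, hence bounded on compact
    sets, so the sequence is a normal family.\<close>
  obtain f0 k where f0: "f0 holomorphic_on unit_disc" and k: "strict_mono (k :: nat \<Rightarrow> nat)"
    and pw: "\<And>z. z \<in> unit_disc \<Longrightarrow> (\<lambda>n. F (k n) z) \<longlonglongrightarrow> f0 z"
    and unif: "\<And>K. compact K \<Longrightarrow> K \<subseteq> unit_disc \<Longrightarrow> uniform_limit K (F \<circ> k) f0 sequentially"
  proof (rule Montel [of unit_disc "range F" F])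
    show "h holomorphic_on unit_disc" if "h \<in> range F" for h
      using that F by (auto simp: HD_def)
    show "\<exists>B. \<forall>h\<in>range F. \<forall>z\<in>K. cmod (h z) \<le> B" if K: "compact K" "K \<subseteq> unit_disc" for K
    proof -
      have "continuous_on K (\<lambda>z. M' * (1 - ln (1 - cmod z)))"
        using K(2) by (intro continuous_intros) auto
      then have "bounded ((\<lambda>z. M' * (1 - ln (1 - cmod z))) ` K)"
        using K(1) compact_continuous_image compact_imp_bounded by blast
      then obtain B where B: "\<And>z. z \<in> K \<Longrightarrow> \<bar>M' * (1 - ln (1 - cmod z))\<bar> \<le> B"
        by (auto simp: bounded_iff)
      have "cmod (F n z) \<le> B" if "z \<in> K" for n z
        using Fb [of z n] B [OF that] K(2) that by force
      then show ?thesis by blast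
    qed
  qed auto
  define f where "f z = (if z \<in> unit_disc then f0 z else 0)" for z
  have f: "f \<in> HD"
    using holomorphic_transform [OF f0, of f] by (simp add: HD_def f_def)
  have fb: "cmod (f z) \<le> M' * (1 - ln (1 - cmod z))" if "cmod z < 1" for z
  proof -
    have "(\<lambda>n. cmod (F (k n) z)) \<longlonglongrightarrow> cmod (f z)"
      using pw [of z] that by (auto simp: f_def intro: tendsto_norm)
    then show ?thesis by (rule LIMSEQ_le_const2) (use Fb [OF that] in auto)
  qed
  have "norm_Hlog f \<le> ennreal M'"
  proof (rule norm_Hlog_le)
    fix z :: complex assume z: "cmod z < 1"
    have "ennreal (cmod (f z)) \<le> ennreal (M' * (1 - ln (1 - cmod z)))"
      by (intro ennreal_leI fb z)
    then show "ennreal (cmod (f z)) \<le> ennreal M' * ennreal (1 - ln (1 - cmod z))"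
      using M'(1) by (simp add: ennreal_mult')
  qed
  then have f_fin: "norm_Hlog f < \<infinity>" by (simp add: le_less_trans)
  then have "norm_Hinf (T_op g f) < \<infinity>"
    using norm_T_op_le [OF g f f_fin] fin by (auto simp: ennreal_mult_less_top intro: le_less_trans)
  moreover have "T_op g f \<in> HD" using T_op_in_HD [OF gh] f by (simp add: HD_def)
  ultimately have Tf: "T_op g f \<in> Hinf" by (simp add: Hinf_def)
  define I where "I = enn2real (M_inf_log_integral g)"
  have I: "M_inf_log_integral g = ennreal I" "0 \<le> I" using fin by (auto simp: I_def)
  have key: "\<forall>\<^sub>F n in sequentially. norm_Hinf (\<lambda>z. T_op g (F (k n)) z - T_op g f z) \<le> ennreal ((I + 2 * M') * e)"
    if e: "0 < e" for e
  proof -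
    obtain \<rho> where \<rho>: "0 < \<rho>" "\<rho> < 1" and tail: "(\<integral>\<^sup>+r\<in>{\<rho><..<1}. ennreal (weight g r) \<partial>lborel) \<le> ennreal e"
      using weight_tail [OF g fin e] by blast
    have "uniform_limit (cball 0 \<rho>) (F \<circ> k) f0 sequentially"
      by (rule unif) (use \<rho> in auto)
    then have "\<forall>\<^sub>F n in sequentially. \<forall>z\<in>cball 0 \<rho>. dist ((F \<circ> k) n z) (f0 z) < e"
      using e by (rule uniform_limitD)
    then show ?thesis
    proof eventually_elim
      case (elim n)
      \<comment> \<open>On the disc of radius \<open>\<rho>\<close> the difference is at most
        \<open>e\<close> by uniform convergence. Outside, only the sum of the two growth bounds is
        available, but there the weight has integral at most \<open>e\<close>.\<close>
      define \<kappa> where "\<kappa> r = (if r \<le> \<rho> then e else 2 * M')" for r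
      define H where "H z = F (k n) z - f z" for z
      have [measurable]: "\<kappa> \<in> borel_measurable borel" unfolding \<kappa>_def by measurable
      have \<kappa>: "0 \<le> \<kappa> r" for r using e M'(1) by (simp add: \<kappa>_def)
      have "norm_Hinf (T_op g H) \<le> (\<integral>\<^sup>+r\<in>{0<..<1}. ennreal (\<kappa> r * weight g r) \<partial>lborel)"
      proof (rule T_op_upper_bound [OF g _ _ \<kappa>])
        show "H holomorphic_on unit_disc"
          unfolding H_def using F f by (intro holomorphic_intros) (auto simp: HD_def)
        fix z :: complex assume z: "cmod z < 1"
        show "cmod (H z) \<le> \<kappa> (cmod z) * (1 - ln (1 - cmod z))"
        proof (cases "cmod z \<le> \<rho>")
          case True
          then have "cmod (H z) \<le> e"
            using elim z by (auto simp: H_def f_def dist_norm intro: less_imp_le)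
          also have "\<dots> \<le> e * (1 - ln (1 - cmod z))"
            using e one_le_one_minus_ln [OF norm_ge_zero z] by (intro mult_le_cancel_left1 [THEN iffD2]) auto
          finally show ?thesis using True by (simp add: \<kappa>_def)
        next
          case False
          have "cmod (H z) \<le> cmod (F (k n) z) + cmod (f z)" unfolding H_def by (rule norm_triangle_ineq4)
          then show ?thesis using False Fb [OF z, of "k n"] fb [OF z] by (simp add: \<kappa>_def)
        qed
      qed measurable
      also have "\<dots> \<le> (\<integral>\<^sup>+r. ennreal e * (ennreal (weight g r) * indicator {0<..<1} r)
          + ennreal (2 * M') * (ennreal (weight g r) * indicator {\<rho><..<1} r) \<partial>lborel)"
        using e M'(1) by (intro nn_integral_mono) (auto simp: \<kappa>_def indicator_def ennreal_mult')
      also have "\<dots> = ennreal e * M_inf_log_integral g + ennreal (2 * M') * (\<integral>\<^sup>+r\<in>{\<rho><..<1}. ennreal (weight g r) \<partial>lborel)"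
      proof -
        have "(\<lambda>r. ennreal (weight g r) * indicator {0<..<1} r) \<in> borel_measurable lborel"
          by (rule borel_measurable_weight [OF g]) auto
        moreover have "(\<lambda>r. ennreal (weight g r) * indicator {\<rho><..<1} r) \<in> borel_measurable lborel"
          by (rule borel_measurable_weight [OF g]) (use \<rho> in auto)
        ultimately show ?thesis
          unfolding M_inf_log_integral_weight
          by (subst nn_integral_add)
            (auto simp only: nn_integral_cmult intro: borel_measurable_times_ennreal borel_measurable_const)
      qed
      also have "\<dots> \<le> ennreal e * ennreal I + ennreal (2 * M') * ennreal e"
        by (intro add_mono mult_left_mono tail) (simp_all add: I)
      also have "\<dots> = ennreal ((I + 2 * M') * e)"
        using e I M'(1) by (simp add: ennreal_mult' [symmetric] ennreal_plus [symmetric] algebra_simps del: ennreal_plus)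
      finally show ?case
        unfolding H_def using T_op_diff [OF gh F f] by simp
    qed
  qed
  have "(\<lambda>n. norm_Hinf (\<lambda>z. T_op g (F (k n)) z - T_op g f z)) \<longlonglongrightarrow> 0"
  proof (rule order_tendstoI)
    fix a :: ennreal assume "0 < a"
    then obtain b where b: "0 < b" "ennreal b < a"
    proof (cases a)
      case (real r)
      then show ?thesis using \<open>0 < a\<close> that [of "r / 2"] by (simp add: ennreal_less_iff)
    next
      case top
      then show ?thesis using that [of 1] by simp
    qed
    \<comment> \<open>The added 1 keeps the denominator positive when both \<open>I\<close> and
      \<open>M'\<close> vanish.\<close>
    define e where "e = b / (I + 2 * M' + 1)"
    have pos: "0 < I + 2 * M' + 1" using I M'(1) by simp
    then have e: "0 < e" using b by (simp add: e_def)
    have "(I + 2 * M') * e \<le> (I + 2 * M' + 1) * e" using e by (intro mult_right_mono) auto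
    also have "\<dots> = b" using pos by (simp add: e_def)
    finally have "ennreal ((I + 2 * M') * e) < a" using b(2) by (rule le_less_trans [OF ennreal_leI])
    with key [OF e] show "\<forall>\<^sub>F n in sequentially. norm_Hinf (\<lambda>z. T_op g (F (k n)) z - T_op g f z) < a"
      by (auto elim!: eventually_mono intro: le_less_trans)
  qed simp
  then show ?thesis using Tf k by blast
qed


text \<open>The common interface for the three spaces: the inclusion in \<open>Hlog\<close> with
  constant \<open>C\<close> gives all upper bounds, and the multiple of \<open>log_test\<close> in
  the unit ball gives all lower bounds.\<close>

context
  fixes Y :: "(complex \<Rightarrow> complex) set" and NY :: "(complex \<Rightarrow> complex) \<Rightarrow> ennreal" and C c :: real
  assumes Y: "Y \<subseteq> Hlog" and C: "0 \<le> C" "\<And>f. f \<in> Y \<Longrightarrow> norm_Hlog f \<le> ennreal C * NY f"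
    and c: "0 < c" "(\<lambda>z. of_real c * log_test z) \<in> Y" "NY (\<lambda>z. of_real c * log_test z) \<le> 1"
begin

lemma opnorm_le:
  assumes g: "g \<in> nonneg_symbols"
  shows "opnorm_to_Hinf Y NY (T_op g) \<le> ennreal C * M_inf_log_integral g"
  unfolding opnorm_to_Hinf_def
proof (rule SUP_least)
  fix f assume "f \<in> {f \<in> Y. NY f \<le> 1}"
  then have f: "f \<in> Y" "NY f \<le> 1" "f \<in> HD" "norm_Hlog f < \<infinity>" using Y by (auto simp: Hlog_def)
  have "norm_Hlog f \<le> ennreal C * 1"
    using C(2) [OF f(1)] f(2) by (meson mult_left_mono order_trans zero_le)
  then have "norm_Hlog f * M_inf_log_integral g \<le> ennreal C * M_inf_log_integral g"
    by (intro mult_right_mono) auto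
  then show "norm_Hinf (T_op g f) \<le> ennreal C * M_inf_log_integral g"
    using norm_T_op_le [OF g f(3,4)] by (rule order_trans [rotated])
qed

lemma T_op_scaled_log_test:
  assumes g: "g \<in> nonneg_symbols"
  shows "ennreal (c / 2) * M_inf_log_integral g \<le> norm_Hinf (T_op g (\<lambda>z. of_real c * log_test z))"
proof -
  have "T_op g (\<lambda>z. of_real c * log_test z) z = of_real c * T_op g log_test z" for z
  proof (cases "cmod z < 1")
    case True
    have "(\<lambda>\<zeta>. log_test \<zeta> * deriv g \<zeta>) contour_integrable_on linepath 0 z"
      by (intro contour_integrable_continuous_linepath continuous_on_segment_integrand nonneg_symbols_holomorphic [OF g] True)
        (use log_test_in_HD in \<open>simp add: HD_def\<close>)
    then show ?thesis by (simp add: T_op_def mult.assoc contour_integral_lmul)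
  qed (simp add: T_op_def)
  then have "norm_Hinf (T_op g (\<lambda>z. of_real c * log_test z)) = ennreal c * norm_Hinf (T_op g log_test)"
    using c(1) unfolding norm_Hinf_def by (simp add: norm_mult ennreal_mult' SUP_mult_left_ennreal)
  moreover have "ennreal (c / 2) * M_inf_log_integral g = ennreal c * (ennreal (1/2) * M_inf_log_integral g)"
    using c(1) by (subst mult.assoc [symmetric], subst ennreal_mult' [symmetric]) simp_all
  ultimately show ?thesis
    using T_op_lower_bound [OF g] by (simp add: mult_left_mono)
qed

lemma opnorm_ge:
  assumes g: "g \<in> nonneg_symbols"
  shows "ennreal (c / 2) * M_inf_log_integral g \<le> opnorm_to_Hinf Y NY (T_op g)"
  unfolding opnorm_to_Hinf_def
  using T_op_scaled_log_test [OF g] c(2,3) by (intro SUP_upper2 [of "\<lambda>z. of_real c * log_test z"]) auto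

text \<open>A bounded image of the one test function already forces finiteness. Boundedness and
  compactness both include this mapping property, so the same argument serves for both.\<close>

lemma finite_if_maps_to_Hinf:
  assumes g: "g \<in> nonneg_symbols" and "\<forall>f\<in>Y. T_op g f \<in> Hinf"
  shows "M_inf_log_integral g < \<infinity>"
proof -
  have "norm_Hinf (T_op g (\<lambda>z. of_real c * log_test z)) < \<infinity>"
    using assms(2) c(2) by (auto simp: Hinf_def)
  then have "ennreal (c / 2) * M_inf_log_integral g < \<infinity>"
    using T_op_scaled_log_test [OF g] by (rule le_less_trans [rotated])
  then show ?thesis using c(1) by (auto simp: ennreal_mult_less_top)
qed

lemma maps_to_Hinf_if_finite:
  assumes g: "g \<in> nonneg_symbols" and fin: "M_inf_log_integral g < \<infinity>" and f: "f \<in> Y"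
  shows "T_op g f \<in> Hinf"
proof -
  have f': "f \<in> HD" "norm_Hlog f < \<infinity>" using Y f by (auto simp: Hlog_def)
  have "norm_Hinf (T_op g f) < \<infinity>"
    using norm_T_op_le [OF g f'] fin f'(2) by (auto simp: ennreal_mult_less_top intro: le_less_trans)
  moreover have "T_op g f \<in> HD"
    using T_op_in_HD [OF nonneg_symbols_holomorphic [OF g]] f' by (simp add: HD_def)
  ultimately show ?thesis by (simp add: Hinf_def)
qed

lemma bounded_iff_finite:
  assumes g: "g \<in> nonneg_symbols"
  shows "bounded_to_Hinf Y NY (T_op g) \<longleftrightarrow> M_inf_log_integral g < \<infinity>"
proof
  assume "bounded_to_Hinf Y NY (T_op g)"
  then show "M_inf_log_integral g < \<infinity>"
    using finite_if_maps_to_Hinf [OF g] by (simp add: bounded_to_Hinf_def)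
next
  assume fin: "M_inf_log_integral g < \<infinity>"
  define I where "I = enn2real (M_inf_log_integral g)"
  have I: "M_inf_log_integral g = ennreal I" using fin by (simp add: I_def)
  have "norm_Hinf (T_op g f) \<le> ennreal (C * I) * NY f" if f: "f \<in> Y" for f
  proof -
    have f': "f \<in> HD" "norm_Hlog f < \<infinity>" using Y f by (auto simp: Hlog_def)
    have "norm_Hinf (T_op g f) \<le> norm_Hlog f * ennreal I" using norm_T_op_le [OF g f'] by (simp add: I)
    also have "\<dots> \<le> (ennreal C * NY f) * ennreal I" by (intro mult_right_mono C(2) f) auto
    also have "\<dots> = ennreal (C * I) * NY f" using C(1) by (simp add: ennreal_mult' mult_ac)
    finally show ?thesis .
  qed
  then show "bounded_to_Hinf Y NY (T_op g)"
    unfolding bounded_to_Hinf_def using maps_to_Hinf_if_finite [OF g fin] by blast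
qed

lemma compact_iff_finite:
  assumes g: "g \<in> nonneg_symbols"
  shows "compact_to_Hinf Y NY (T_op g) \<longleftrightarrow> M_inf_log_integral g < \<infinity>"
proof
  assume "compact_to_Hinf Y NY (T_op g)"
  then show "M_inf_log_integral g < \<infinity>"
    using finite_if_maps_to_Hinf [OF g] by (simp add: compact_to_Hinf_def)
next
  assume fin: "M_inf_log_integral g < \<infinity>"
  have "\<exists>h\<in>Hinf. \<exists>k. strict_mono (k :: nat \<Rightarrow> nat) \<and> (\<lambda>n. norm_Hinf (\<lambda>z. T_op g (F (k n)) z - h z)) \<longlonglongrightarrow> 0"
    if F: "\<And>n. F n \<in> Y" and M: "\<And>n. NY (F n) \<le> ennreal M" for F :: "nat \<Rightarrow> complex \<Rightarrow> complex" and M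
  proof (rule T_op_compact [OF g fin])
    show "F n \<in> HD" for n using F Y by (auto simp: Hlog_def)
    show "norm_Hlog (F n) \<le> ennreal (C * M)" for n
    proof -
      have "norm_Hlog (F n) \<le> ennreal C * NY (F n)" by (rule C(2) [OF F])
      also have "\<dots> \<le> ennreal C * ennreal M" by (intro mult_left_mono M) auto
      also have "\<dots> = ennreal (C * M)" using C(1) by (simp add: ennreal_mult')
      finally show ?thesis .
    qed
  qed
  then show "compact_to_Hinf Y NY (T_op g)"
    unfolding compact_to_Hinf_def using maps_to_Hinf_if_finite [OF g fin] by blast
qed

end

section \<open>Comparability with uniform constants\<close>

lemma comparable_onI:
  assumes "0 < a" "0 < b" "\<And>g. g \<in> G \<Longrightarrow> B g \<le> ennreal a * A g" "\<And>g. g \<in> G \<Longrightarrow> A g \<le> ennreal b * B g"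
  shows "comparable_on G A B"
proof -
  define C where "C = max a b"
  have C: "0 < C" "a \<le> C" "b \<le> C" using assms(1) by (auto simp: C_def)
  have "ennreal (1 / C) * B g \<le> A g" "A g \<le> ennreal C * B g" if g: "g \<in> G" for g
  proof -
    have "ennreal (1 / C) * B g \<le> ennreal (1 / C) * (ennreal C * A g)"
      using assms(3) [OF g] C by (intro mult_left_mono order_trans [OF assms(3) [OF g]] mult_right_mono ennreal_leI) auto
    also have "\<dots> = A g" using C by (simp add: mult.assoc [symmetric] ennreal_mult' [symmetric])
    finally show "ennreal (1 / C) * B g \<le> A g" .
    show "A g \<le> ennreal C * B g"
      using C by (intro order_trans [OF assms(4) [OF g]] mult_right_mono ennreal_leI) auto
  qed
  then show ?thesis unfolding comparable_on_def using C(1) by blast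
qed

text \<open>Both quantities are compared with \<open>I\<close>. The added 1 is due to the upper
  constants, which may be 0 while comparability asks for a positive one.\<close>

lemma comparable_on_via:
  assumes "0 < c1" "0 \<le> C1" "0 < c2" "0 \<le> C2"
    and "\<And>g. g \<in> G \<Longrightarrow> ennreal c1 * I g \<le> A g" "\<And>g. g \<in> G \<Longrightarrow> A g \<le> ennreal C1 * I g"
    and "\<And>g. g \<in> G \<Longrightarrow> ennreal c2 * I g \<le> B g" "\<And>g. g \<in> G \<Longrightarrow> B g \<le> ennreal C2 * I g"
  shows "comparable_on G A B"
proof (rule comparable_onI)
  have *: "B g \<le> ennreal ((C2 + 1) / c1) * A g"
    if "0 < c1" "0 \<le> C2" "ennreal c1 * I g \<le> A g" "B g \<le> ennreal C2 * I g" for c1 C2 A B g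
  proof -
    have "B g \<le> ennreal (C2 + 1) * I g"
      using that(2) by (intro order_trans [OF that(4)] mult_right_mono ennreal_leI) auto
    also have "\<dots> = ennreal ((C2 + 1) / c1) * (ennreal c1 * I g)"
      using that(1,2) by (simp add: mult.assoc [symmetric] ennreal_mult' [symmetric])
    also have "\<dots> \<le> ennreal ((C2 + 1) / c1) * A g" by (intro mult_left_mono that) auto
    finally show ?thesis .
  qed
  show "B g \<le> ennreal ((C2 + 1) / c1) * A g" if "g \<in> G" for g
    using that assms by (intro *) auto
  show "A g \<le> ennreal ((C1 + 1) / c2) * B g" if "g \<in> G" for g
    using that assms by (intro *) auto
qed (use assms in auto)

theorem theorem4:
  fixes X :: "(complex \<Rightarrow> complex) set" and N :: "(complex \<Rightarrow> complex) \<Rightarrow> real"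
  assumes "banach_space_in_HD X N"
    and "BMOA \<subseteq> X" and "X \<subseteq> Hlog"
  defines "NX \<equiv> (\<lambda>f. ennreal (N f))"
  shows
    "(\<forall>g\<in>nonneg_symbols.
        (bounded_to_Hinf Hlog norm_Hlog (T_op g) \<longleftrightarrow> compact_to_Hinf Hlog norm_Hlog (T_op g)) \<and>
        (bounded_to_Hinf X NX (T_op g) \<longleftrightarrow> compact_to_Hinf X NX (T_op g)) \<and>
        (bounded_to_Hinf BMOA norm_BMOA (T_op g) \<longleftrightarrow> compact_to_Hinf BMOA norm_BMOA (T_op g)) \<and>
        (bounded_to_Hinf Hlog norm_Hlog (T_op g) \<longleftrightarrow> bounded_to_Hinf X NX (T_op g)) \<and>
        (bounded_to_Hinf X NX (T_op g) \<longleftrightarrow> bounded_to_Hinf BMOA norm_BMOA (T_op g)) \<and>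
        (bounded_to_Hinf BMOA norm_BMOA (T_op g) \<longleftrightarrow> coeff_log_sum g < \<infinity>) \<and>
        (coeff_log_sum g < \<infinity> \<longleftrightarrow> M_inf_log_integral g < \<infinity>)) \<and>
     comparable_on nonneg_symbols
       (\<lambda>g. opnorm_to_Hinf BMOA norm_BMOA (T_op g)) (\<lambda>g. opnorm_to_Hinf X NX (T_op g)) \<and>
     comparable_on nonneg_symbols
       (\<lambda>g. opnorm_to_Hinf X NX (T_op g)) (\<lambda>g. opnorm_to_Hinf Hlog norm_Hlog (T_op g)) \<and>
     comparable_on nonneg_symbols
       (\<lambda>g. opnorm_to_Hinf Hlog norm_Hlog (T_op g)) M_inf_log_integral \<and>
     comparable_on nonneg_symbols M_inf_log_integral coeff_log_sum"
proof -
  interpret banach_in_HD X N using assms(1) by unfold_locales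
  \<comment> \<open>\<open>K\<close> stands for the norm of \<open>log_test\<close>; division by
    \<open>K + 1\<close> instead of \<open>K\<close> keeps the scalar well defined for
    \<open>K = 0\<close> as well.\<close>
  have scaled: "\<exists>c>0. (\<lambda>z. of_real c * log_test z) \<in> Y \<and> NY (\<lambda>z. of_real c * log_test z) \<le> 1"
    if "log_test \<in> Y" "\<And>c. (\<lambda>z. of_real c * log_test z) \<in> Y" "0 \<le> K"
      "\<And>c. 0 < c \<Longrightarrow> NY (\<lambda>z. of_real c * log_test z) \<le> ennreal (c * K)"
    for Y :: "(complex \<Rightarrow> complex) set" and NY :: "(complex \<Rightarrow> complex) \<Rightarrow> ennreal" and K :: real
  proof (intro exI conjI)
    show "0 < 1 / (K + 1)" using that(3) by simp
    have "NY (\<lambda>z. of_real (1 / (K + 1)) * log_test z) \<le> ennreal (1 / (K + 1) * K)"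
      using that(3) by (intro that(4)) auto
    also have "\<dots> \<le> 1" using that(3) by (simp add: ennreal_le_1)
    finally show "NY (\<lambda>z. of_real (1 / (K + 1)) * log_test z) \<le> 1" .
  qed (rule that(2))
  have lX: "log_test \<in> X" and lH: "log_test \<in> Hlog"
    using log_test_in_BMOA assms(2,3) by auto
  have "NX (\<lambda>z. of_real c * log_test z) \<le> ennreal (c * N log_test)" if "0 < c" for c
    using that N_scale [OF lX, of "of_real c"] by (simp add: NX_def)
  from scaled [OF lX scale_in [OF lX] N_nonneg [OF lX] this]
  obtain cX where cX: "0 < cX" "(\<lambda>z. of_real cX * log_test z) \<in> X" "NX (\<lambda>z. of_real cX * log_test z) \<le> 1"
    by blast
  have Hlog_scale: "norm_Hlog (\<lambda>z. of_real c * log_test z) = ennreal \<bar>c\<bar> * norm_Hlog log_test" for c :: real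
    unfolding norm_Hlog_def by (simp add: norm_mult ennreal_mult' SUP_mult_left_ennreal mult.assoc)
  have lfin: "norm_Hlog log_test < \<infinity>" using lH by (simp add: Hlog_def)
  have "(\<lambda>z. of_real c * log_test z) \<in> Hlog" for c :: real
    unfolding Hlog_def using Hlog_scale [of c] lfin log_test_in_HD
    by (auto simp: HD_def ennreal_mult_less_top intro!: holomorphic_intros)
  moreover have "norm_Hlog (\<lambda>z. of_real c * log_test z) \<le> ennreal (c * enn2real (norm_Hlog log_test))" if "0 < c" for c
    unfolding Hlog_scale using that lfin by (simp add: ennreal_mult')
  ultimately obtain cH where cH: "0 < cH" "(\<lambda>z. of_real cH * log_test z) \<in> Hlog" "norm_Hlog (\<lambda>z. of_real cH * log_test z) \<le> 1"
    using scaled [OF lH] by (metis enn2real_nonneg)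
  \<comment> \<open>For \<open>BMOA\<close> the normalisation of \<open>log_test\<close> already
    puts it in the unit ball, so the scalar is 1.\<close>
  have cB: "0 < (1::real)" "(\<lambda>z. of_real 1 * log_test z) \<in> BMOA" "norm_BMOA (\<lambda>z. of_real 1 * log_test z) \<le> 1"
    using log_test_in_BMOA norm_BMOA_log_test by simp_all
  obtain CX where CX: "0 \<le> CX" "\<And>f. f \<in> X \<Longrightarrow> norm_Hlog f \<le> ennreal CX * NX f"
    using norm_Hlog_le_N [OF assms(3)] unfolding NX_def by blast
  have CH: "(0::real) \<le> 1" "\<And>f. f \<in> Hlog \<Longrightarrow> norm_Hlog f \<le> ennreal 1 * norm_Hlog f" by simp_all
  have CB: "(0::real) \<le> 7" "\<And>f. f \<in> BMOA \<Longrightarrow> norm_Hlog f \<le> ennreal 7 * norm_BMOA f"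
    by (auto simp only: BMOA_def Hardy1_def intro: norm_Hlog_le_norm_BMOA)
  \<comment> \<open>The inclusion of \<open>BMOA\<close> in \<open>Hlog\<close> is read off from the
    chain through \<open>X\<close>.\<close>
  have subB: "BMOA \<subseteq> Hlog" using assms by blast
  note H = order_refl [of Hlog] CH cH and X = assms(3) CX cX and B = subB CB cB
  have sum_iff: "coeff_log_sum g < \<infinity> \<longleftrightarrow> M_inf_log_integral g < \<infinity>" if "g \<in> nonneg_symbols" for g
    using coeff_log_sum_le_integral [OF that] integral_le_coeff_log_sum [OF that]
    by (auto simp: ennreal_mult_less_top intro: le_less_trans)
  have "comparable_on nonneg_symbols M_inf_log_integral coeff_log_sum"
    by (rule comparable_onI [of 1 4]) (auto intro: coeff_log_sum_le_integral integral_le_coeff_log_sum[simplified])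
  moreover have "comparable_on nonneg_symbols
       (\<lambda>g. opnorm_to_Hinf BMOA norm_BMOA (T_op g)) (\<lambda>g. opnorm_to_Hinf X NX (T_op g))"
    by (rule comparable_on_via [OF _ CB(1) _ CX(1) opnorm_ge [OF B] opnorm_le [OF B] opnorm_ge [OF X] opnorm_le [OF X]])
      (use cX in auto)
  moreover have "comparable_on nonneg_symbols
       (\<lambda>g. opnorm_to_Hinf X NX (T_op g)) (\<lambda>g. opnorm_to_Hinf Hlog norm_Hlog (T_op g))"
    by (rule comparable_on_via [OF _ CX(1) _ CH(1) opnorm_ge [OF X] opnorm_le [OF X] opnorm_ge [OF H] opnorm_le [OF H]])
      (use cX cH in auto)
  moreover have "comparable_on nonneg_symbols
       (\<lambda>g. opnorm_to_Hinf Hlog norm_Hlog (T_op g)) M_inf_log_integral"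
    by (rule comparable_on_via [OF _ CH(1) zero_less_one CH(1) opnorm_ge [OF H] opnorm_le [OF H]])
      (use cH in auto)
  ultimately show ?thesis
    by (simp add: bounded_iff_finite [OF H] bounded_iff_finite [OF X] bounded_iff_finite [OF B]
        compact_iff_finite [OF H] compact_iff_finite [OF X] compact_iff_finite [OF B] sum_iff [unfolded infinity_ennreal_def])
qed

end
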